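(* Let $N$ be a Riemannian manifold, $\Sigma_0\subset N$ a complete embedded oriented hypersurface, and $\varrho=\operatorname{dist}(\cdot,\Sigma_0)$ the signed distance function from $\Sigma_0=\varrho^{-1}(0)$, supposed to be regular in some open domain $\mathcal{U}\subset N$ free of focal points of $\Sigma_0$. Suppose that there exists an even smooth function $G\colon\mathbb{R}\to\mathbb{R}$ such that $$K_N(\mathsf{v}\wedge\bar\nabla\varrho(p))\ge -G(\varrho(p))\qquad (1)$$ for every $p\in\mathcal{U}$ and every unit vector $\mathsf{v}\in T_pN$ with $\langle\mathsf{v},\bar\nabla\varrho(p)\rangle=0$. Let $h$ be a solution of the ODE $h''-Gh=0$ and let $(d_*,d^* )$ be the maximal interval where $h$ is positive, with $d_*<0<d^*$. If $$\bar\nabla^2\varrho\big|_{T\Sigma_0}\le\frac{h'(0)}{h(0)}\langle\,,\rangle\big|_{T\Sigma_0}\qquad (2)$$ then $$\bar\nabla^2\varrho(\mathsf{v},\mathsf{v})\le\frac{h'}{h}\langle\mathsf{v},\mathsf{v}\rangle$$ for any $(p,\mathsf{v})\in T\mathcal{U}$ with $\langle\mathsf{v},\bar\nabla\varrho(p)\rangle=0$, whenever $0\le\varrho(p)<d^*$ (with $h'/h$ evaluated at $\varrho(p)$). If instead of (1) and (2) one has $$K_N(\mathsf{v}\wedge\bar\nabla\varrho(p))\le -G(\varrho(p))\quad\text{and}\quad \bar\nabla^2\varrho\big|_{T\Sigma_0}\ge\frac{h'(0)}{h(0)}\langle\,,\rangle\big|_{T\Sigma_0}$$ (for the same $p$,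 $\mathsf v$), then $\bar\nabla^2\varrho(\mathsf{v},\mathsf{v})\ge\frac{h'}{h}\langle\mathsf{v},\mathsf{v}\rangle$ for the same range of $(p,\mathsf{v})$.
   Context: The signed distance $\varrho$ is the Riemannian distance to $\Sigma_0$, taken with opposite signs on the two sides of the oriented hypersurface $\Sigma_0$; "regular" in $\mathcal{U}$ means smooth there (so $|\bar\nabla\varrho|=1$). $\bar\nabla\varrho$ and $\bar\nabla^2\varrho$ are the gradient and Hessian of $\varrho$ in $N$. $K_N(\mathsf{v}\wedge\bar\nabla\varrho)$ is the sectional curvature of the two-plane spanned by $\mathsf{v}$ and $\bar\nabla\varrho$ along the geodesics issuing orthogonally from $\Sigma_0$.
   Formalization: Added hypothesis: each p in U with ρ(p) ≥ 0 is joined to Σ₀ by a unit-speed geodesic segment of length ρ(p), orthogonal to Σ₀ and contained in U; without it the bound (1) on U says nothing between Σ₀ and p and the claim fails. *)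

theory Defs
  imports "HOL-Analysis.Analysis"
begin

section \<open>Smooth maps between normed spaces\<close>

text \<open>The sets \<open>S\<close> below are always open; in finite dimension, continuity of all iterated
  directional derivatives is the usual class \<open>C^k\<close>.\<close>

primrec Ck_on :: "nat \<Rightarrow> 'b::real_normed_vector set \<Rightarrow> ('b \<Rightarrow> 'c::real_normed_vector) \<Rightarrow> bool" where
  "Ck_on 0 S f \<longleftrightarrow> continuous_on S f"
| "Ck_on (Suc k) S f \<longleftrightarrow> (\<forall>x\<in>S. f differentiable (at x)) \<and>
     (\<forall>v. Ck_on k S (\<lambda>x. frechet_derivative f (at x) v))"

definition smooth_on :: "'b::real_normed_vector set \<Rightarrow> ('b \<Rightarrow> 'c::real_normed_vector) \<Rightarrow> bool" where
  "smooth_on S f \<longleftrightarrow> (\<forall>k. Ck_on k S f)"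

section \<open>Riemannian geometry in a coordinate domain\<close>

text \<open>Here \<open>m x u v\<close> is the inner product at the point \<open>x\<close> of a coordinate domain
  of the tangent vectors with components \<open>u\<close> and \<open>v\<close>.\<close>

type_synonym 'e coord_metric = "'e \<Rightarrow> 'e \<Rightarrow> 'e \<Rightarrow> real"

text \<open>The Koszul formula for vector fields with constant components (whose Lie brackets vanish):
  \<open>christoffel m x u v\<close> is the covariant derivative at \<open>x\<close> of the constant field \<open>v\<close>
  in the direction \<open>u\<close>, that is, the vector with components
  \<open>\<Gamma>^k_ij u^i v^j\<close>.\<close>

definition christoffel :: "'e::euclidean_space coord_metric \<Rightarrow> 'e \<Rightarrow> 'e \<Rightarrow> 'e \<Rightarrow> 'e" where
  "christoffel m x u v = (THE w. \<forall>z. 2 * m x w z =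
      frechet_derivative (\<lambda>y. m y v z) (at x) u
    + frechet_derivative (\<lambda>y. m y u z) (at x) v
    - frechet_derivative (\<lambda>y. m y u v) (at x) z)"

definition cov_deriv :: "'e::euclidean_space coord_metric \<Rightarrow> ('e \<Rightarrow> 'e) \<Rightarrow> 'e \<Rightarrow> 'e \<Rightarrow> 'e" where
  "cov_deriv m X x u = frechet_derivative X (at x) u + christoffel m x u (X x)"

definition coord_gradient :: "'e::euclidean_space coord_metric \<Rightarrow> ('e \<Rightarrow> real) \<Rightarrow> 'e \<Rightarrow> 'e" where
  "coord_gradient m f x = (THE w. \<forall>v. m x w v = frechet_derivative f (at x) v)"

definition coord_hessian ::
    "'e::euclidean_space coord_metric \<Rightarrow> ('e \<Rightarrow> real) \<Rightarrow> 'e \<Rightarrow> 'e \<Rightarrow> 'e \<Rightarrow> real" where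
  "coord_hessian m f x u v = m x (cov_deriv m (coord_gradient m f) x u) v"

text \<open>The curvature tensor
  \<open>R(u,v)w = \<nabla>_u \<nabla>_v w - \<nabla>_v \<nabla>_u w - \<nabla>_[u,v] w\<close>, computed on
  fields with constant components, so that the bracket term is absent.\<close>

definition coord_curvature ::
    "'e::euclidean_space coord_metric \<Rightarrow> 'e \<Rightarrow> 'e \<Rightarrow> 'e \<Rightarrow> 'e \<Rightarrow> 'e" where
  "coord_curvature m x u v w =
     cov_deriv m (\<lambda>y. christoffel m y v w) x u - cov_deriv m (\<lambda>y. christoffel m y u w) x v"

definition coord_sectional :: "'e::euclidean_space coord_metric \<Rightarrow> 'e \<Rightarrow> 'e \<Rightarrow> 'e \<Rightarrow> real" where
  "coord_sectional m x u v =
     m x (coord_curvature m x u v v) u / (m x u u * m x v v - (m x u v)\<^sup>2)"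

section \<open>Riemannian manifolds\<close>

text \<open>A chart is an open set of the underlying topological space together with a coordinate
  map, whose values outside that set are irrelevant.\<close>

type_synonym ('a, 'e) chart = "'a set \<times> ('a \<Rightarrow> 'e)"

abbreviation cdom :: "('a, 'e) chart \<Rightarrow> 'a set" where "cdom c \<equiv> fst c"
abbreviation crd :: "('a, 'e) chart \<Rightarrow> 'a \<Rightarrow> 'e" where "crd c \<equiv> snd c"

definition chart_inv :: "('a, 'e) chart \<Rightarrow> 'e \<Rightarrow> 'a" where
  "chart_inv c = inv_into (cdom c) (crd c)"

definition is_chart :: "('a::topological_space, 'e::euclidean_space) chart \<Rightarrow> bool" where
  "is_chart c \<longleftrightarrow> open (cdom c) \<and> open (crd c ` cdom c) \<and>
     homeomorphism (cdom c) (crd c ` cdom c) (crd c) (chart_inv c)"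

definition compatible ::
    "('a::topological_space, 'e::euclidean_space) chart \<Rightarrow> ('a, 'e) chart \<Rightarrow> bool" where
  "compatible c d \<longleftrightarrow> smooth_on (crd c ` (cdom c \<inter> cdom d)) (crd d \<circ> chart_inv c) \<and>
     smooth_on (crd d ` (cdom c \<inter> cdom d)) (crd c \<circ> chart_inv d)"

text \<open>A smooth structure on the whole space, i.e. a maximal smooth atlas.\<close>

definition smooth_structure :: "('a::topological_space, 'e::euclidean_space) chart set \<Rightarrow> bool" where
  "smooth_structure A \<longleftrightarrow> (\<forall>c\<in>A. is_chart c) \<and> (\<Union>c\<in>A. cdom c) = UNIV \<and>
     (\<forall>c\<in>A. \<forall>d\<in>A. compatible c d) \<and>
     (\<forall>c. is_chart c \<longrightarrow> (\<forall>d\<in>A. compatible c d) \<longrightarrow> c \<in> A)"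

text \<open>A tangent vector at \<open>p\<close> is given by its components \<open>v\<close> in a chart \<open>c\<close> around \<open>p\<close>;
  \<open>change_chart c d p v\<close> are the components of the same vector in the chart \<open>d\<close>.\<close>

definition change_chart ::
    "('a, 'e::euclidean_space) chart \<Rightarrow> ('a, 'e) chart \<Rightarrow> 'a \<Rightarrow> 'e \<Rightarrow> 'e" where
  "change_chart c d p v = frechet_derivative (crd d \<circ> chart_inv c) (at (crd c p)) v"

record ('a, 'e) riem =
  charts :: "('a, 'e) chart set"
  rmetric :: "('a, 'e) chart \<Rightarrow> 'e coord_metric"

definition inner_at ::
    "('a, 'e::euclidean_space) riem \<Rightarrow> ('a, 'e) chart \<Rightarrow> 'a \<Rightarrow> 'e \<Rightarrow> 'e \<Rightarrow> real" where
  "inner_at N c p u v = rmetric N c (crd c p) u v"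

text \<open>The topological part of the definition of a manifold (Hausdorff, second countable) is
  carried by the sort of \<open>'a\<close>; the dimension is that of the model space \<open>'e\<close>.\<close>

definition riemannian_manifold ::
    "('a::{t2_space,second_countable_topology}, 'e::euclidean_space) riem \<Rightarrow> bool" where
  "riemannian_manifold N \<longleftrightarrow> smooth_structure (charts N) \<and>
     (\<forall>c\<in>charts N.
        (\<forall>u v. smooth_on (crd c ` cdom c) (\<lambda>x. rmetric N c x u v)) \<and>
        (\<forall>p\<in>cdom c. bilinear (inner_at N c p) \<and>
           (\<forall>u v. inner_at N c p u v = inner_at N c p v u) \<and>
           (\<forall>v. v \<noteq> 0 \<longrightarrow> 0 < inner_at N c p v v))) \<and>
     (\<forall>c\<in>charts N. \<forall>d\<in>charts N. \<forall>p\<in>cdom c \<inter> cdom d. \<forall>u v.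
        inner_at N c p u v = inner_at N d p (change_chart c d p u) (change_chart c d p v))"

definition smooth_fun_on ::
    "('a::topological_space, 'e::euclidean_space) riem \<Rightarrow> 'a set \<Rightarrow> ('a \<Rightarrow> real) \<Rightarrow> bool" where
  "smooth_fun_on N U f \<longleftrightarrow>
     (\<forall>c\<in>charts N. smooth_on (crd c ` (cdom c \<inter> U)) (f \<circ> chart_inv c))"

definition gradient ::
    "('a, 'e::euclidean_space) riem \<Rightarrow> ('a, 'e) chart \<Rightarrow> ('a \<Rightarrow> real) \<Rightarrow> 'a \<Rightarrow> 'e" where
  "gradient N c f p = coord_gradient (rmetric N c) (f \<circ> chart_inv c) (crd c p)"

definition hessian ::
    "('a, 'e::euclidean_space) riem \<Rightarrow> ('a, 'e) chart \<Rightarrow> ('a \<Rightarrow> real) \<Rightarrow> 'a \<Rightarrow> 'e \<Rightarrow> 'e \<Rightarrow> real" where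
  "hessian N c f p u v = coord_hessian (rmetric N c) (f \<circ> chart_inv c) (crd c p) u v"

definition sectional_curvature ::
    "('a, 'e::euclidean_space) riem \<Rightarrow> ('a, 'e) chart \<Rightarrow> 'a \<Rightarrow> 'e \<Rightarrow> 'e \<Rightarrow> real" where
  "sectional_curvature N c p u v = coord_sectional (rmetric N c) (crd c p) u v"

section \<open>Curves, geodesics and distance\<close>

text \<open>Smooth maps from an open subset \<open>T\<close> of a normed space (an open interval, or an open
  rectangle in the plane) into the manifold.\<close>

definition smooth_into ::
    "('a::topological_space, 'e::euclidean_space) riem \<Rightarrow> 'b::real_normed_vector set \<Rightarrow> ('b \<Rightarrow> 'a) \<Rightarrow> bool" where
  "smooth_into N T F \<longleftrightarrow> continuous_on T F \<and>
     (\<forall>c\<in>charts N. smooth_on (T \<inter> F -` cdom c) (crd c \<circ> F))"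

definition velocity :: "('a, 'e::euclidean_space) chart \<Rightarrow> (real \<Rightarrow> 'a) \<Rightarrow> real \<Rightarrow> 'e" where
  "velocity c \<gamma> t = vector_derivative (crd c \<circ> \<gamma>) (at t)"

definition geodesic_on ::
    "('a::topological_space, 'e::euclidean_space) riem \<Rightarrow> real set \<Rightarrow> (real \<Rightarrow> 'a) \<Rightarrow> bool" where
  "geodesic_on N I \<gamma> \<longleftrightarrow> smooth_into N I \<gamma> \<and>
     (\<forall>t\<in>I. \<forall>c\<in>charts N. \<gamma> t \<in> cdom c \<longrightarrow>
        vector_derivative (velocity c \<gamma>) (at t)
        + christoffel (rmetric N c) (crd c (\<gamma> t)) (velocity c \<gamma> t) (velocity c \<gamma> t) = 0)"

definition speed :: "('a, 'e::euclidean_space) riem \<Rightarrow> (real \<Rightarrow> 'a) \<Rightarrow> real \<Rightarrow> real" where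
  "speed N \<gamma> t = (let c = (SOME c. c \<in> charts N \<and> \<gamma> t \<in> cdom c)
     in sqrt (inner_at N c (\<gamma> t) (velocity c \<gamma> t) (velocity c \<gamma> t)))"

definition curve_length :: "('a, 'e::euclidean_space) riem \<Rightarrow> (real \<Rightarrow> 'a) \<Rightarrow> ennreal" where
  "curve_length N \<gamma> = (\<integral>\<^sup>+t\<in>{0..1}. ennreal (speed N \<gamma> t) \<partial>lborel)"

definition piecewise_C1_curve ::
    "('a::topological_space, 'e::euclidean_space) riem \<Rightarrow> (real \<Rightarrow> 'a) \<Rightarrow> bool" where
  "piecewise_C1_curve N \<gamma> \<longleftrightarrow> continuous_on {0..1} \<gamma> \<and>
     (\<exists>K. finite K \<and>
       (\<forall>c\<in>charts N. (crd c \<circ> \<gamma>) C1_differentiable_on (({0<..<1} - K) \<inter> \<gamma> -` cdom c)))"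

text \<open>The infimum of the lengths of the curves in \<open>S\<close> joining \<open>p\<close> to \<open>q\<close> (infinite if there is
  none). For \<open>S = UNIV\<close> this is the Riemannian distance of the manifold; for an embedded
  submanifold \<open>S\<close> it is the Riemannian distance of the induced metric.\<close>

definition rdist ::
    "('a::topological_space, 'e::euclidean_space) riem \<Rightarrow> 'a set \<Rightarrow> 'a \<Rightarrow> 'a \<Rightarrow> ennreal" where
  "rdist N S p q = (INF \<gamma>\<in>{\<gamma>. piecewise_C1_curve N \<gamma> \<and> \<gamma> ` {0..1} \<subseteq> S \<and> \<gamma> 0 = p \<and> \<gamma> 1 = q}.
     curve_length N \<gamma>)"

definition rdist_to ::
    "('a::topological_space, 'e::euclidean_space) riem \<Rightarrow> 'a set \<Rightarrow> 'a \<Rightarrow> ennreal" where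
  "rdist_to N S p = (INF q\<in>S. rdist N UNIV q p)"

section \<open>Hypersurfaces\<close>

text \<open>Slice charts. As the atlas is maximal, the slice may be taken through the origin and
  orthogonal to some vector \<open>b\<close>.\<close>

definition embedded_hypersurface ::
    "('a::topological_space, 'e::euclidean_space) riem \<Rightarrow> 'a set \<Rightarrow> bool" where
  "embedded_hypersurface N S \<longleftrightarrow>
     (\<forall>p\<in>S. \<exists>c\<in>charts N. \<exists>b. b \<noteq> 0 \<and> p \<in> cdom c \<and> S \<inter> cdom c = {q\<in>cdom c. crd c q \<bullet> b = 0})"

definition tangent_to ::
    "('a::topological_space, 'e::euclidean_space) riem \<Rightarrow> 'a set \<Rightarrow> ('a, 'e) chart \<Rightarrow> 'a \<Rightarrow> 'e set" where
  "tangent_to N S c p = {v. \<exists>e>0. \<exists>\<gamma>. smooth_into N {-e<..<e} \<gamma> \<and> \<gamma> ` {-e<..<e} \<subseteq> S \<and>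
     \<gamma> 0 = p \<and> velocity c \<gamma> 0 = v}"

definition complete_hypersurface ::
    "('a::topological_space, 'e::euclidean_space) riem \<Rightarrow> 'a set \<Rightarrow> bool" where
  "complete_hypersurface N S \<longleftrightarrow>
     (\<forall>\<sigma>::nat \<Rightarrow> 'a. range \<sigma> \<subseteq> S \<longrightarrow>
        (\<forall>e>0. \<exists>M. \<forall>m\<ge>M. \<forall>n\<ge>M. rdist N S (\<sigma> m) (\<sigma> n) < e) \<longrightarrow>
        (\<exists>q\<in>S. (\<lambda>n. rdist N S (\<sigma> n) q) \<longlonglongrightarrow> 0))"

text \<open>The orientation of the hypersurface is a continuous choice of one of the two unit normals;
  \<open>\<nu> c p\<close> are its components at \<open>p\<close> in the chart \<open>c\<close>.\<close>

definition unit_normal_field ::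
    "('a::topological_space, 'e::euclidean_space) riem \<Rightarrow> 'a set \<Rightarrow> (('a, 'e) chart \<Rightarrow> 'a \<Rightarrow> 'e) \<Rightarrow> bool" where
  "unit_normal_field N S \<nu> \<longleftrightarrow>
     (\<forall>c\<in>charts N. continuous_on (S \<inter> cdom c) (\<nu> c) \<and>
        (\<forall>p\<in>S \<inter> cdom c. inner_at N c p (\<nu> c p) (\<nu> c p) = 1 \<and>
           (\<forall>w\<in>tangent_to N S c p. inner_at N c p (\<nu> c p) w = 0))) \<and>
     (\<forall>c\<in>charts N. \<forall>d\<in>charts N. \<forall>p\<in>S \<inter> cdom c \<inter> cdom d. \<nu> d p = change_chart c d p (\<nu> c p))"

text \<open>The absolute value of \<open>\<rho>\<close> is the distance to \<open>S\<close> and \<open>S\<close> is its zero set; by continuity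
  \<open>\<rho>\<close> has a constant sign on each component of \<open>U - S\<close>, and it is positive on the side of
  \<open>S\<close> into which \<open>\<nu>\<close> points and negative on the other side.\<close>

definition signed_distance_on ::
    "('a::topological_space, 'e::euclidean_space) riem \<Rightarrow> 'a set \<Rightarrow> (('a, 'e) chart \<Rightarrow> 'a \<Rightarrow> 'e)
       \<Rightarrow> 'a set \<Rightarrow> ('a \<Rightarrow> real) \<Rightarrow> bool" where
  "signed_distance_on N S \<nu> U \<rho> \<longleftrightarrow>
     (\<forall>p\<in>U. ennreal \<bar>\<rho> p\<bar> = rdist_to N S p) \<and>
     (\<forall>p\<in>U. \<rho> p = 0 \<longleftrightarrow> p \<in> S) \<and>
     continuous_on U \<rho> \<and>
     (\<forall>c\<in>charts N. \<forall>p\<in>S \<inter> U \<inter> cdom c. \<forall>\<^sub>F t in at_right 0.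
        \<rho> (chart_inv c (crd c p + t *\<^sub>R \<nu> c p)) > 0 \<and>
        \<rho> (chart_inv c (crd c p - t *\<^sub>R \<nu> c p)) < 0)"

text \<open>Geodesics issuing orthogonally from \<open>S\<close> at time 0, without normalization of the speed.\<close>

definition normal_geodesic ::
    "('a::topological_space, 'e::euclidean_space) riem \<Rightarrow> 'a set \<Rightarrow> real set \<Rightarrow> (real \<Rightarrow> 'a) \<Rightarrow> bool" where
  "normal_geodesic N S I \<gamma> \<longleftrightarrow> open I \<and> connected I \<and> 0 \<in> I \<and> geodesic_on N I \<gamma> \<and> \<gamma> 0 \<in> S \<and>
     (\<forall>c\<in>charts N. \<gamma> 0 \<in> cdom c \<longrightarrow>
        (\<forall>w\<in>tangent_to N S c (\<gamma> 0). inner_at N c (\<gamma> 0) (velocity c \<gamma> 0) w = 0))"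

text \<open>Critical values of the normal exponential map: some variation of a normal geodesic through
  normal geodesics (that is, a curve in the normal bundle) has a variation field that is not
  identically zero and vanishes at the time \<open>l > 0\<close> at which the geodesic reaches \<open>q\<close>.\<close>

definition focal_point ::
    "('a::topological_space, 'e::euclidean_space) riem \<Rightarrow> 'a set \<Rightarrow> 'a \<Rightarrow> bool" where
  "focal_point N S q \<longleftrightarrow> (\<exists>e>0. \<exists>I. \<exists>F::real \<times> real \<Rightarrow> 'a. \<exists>l>0.
     l \<in> I \<and> smooth_into N ({-e<..<e} \<times> I) F \<and>
     (\<forall>s\<in>{-e<..<e}. normal_geodesic N S I (\<lambda>t. F (s, t))) \<and>
     F (0, l) = q \<and>
     (\<forall>c\<in>charts N. q \<in> cdom c \<longrightarrow> velocity c (\<lambda>s. F (s, l)) 0 = 0) \<and>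
     (\<exists>t\<in>I. \<exists>c\<in>charts N. F (0, t) \<in> cdom c \<and> velocity c (\<lambda>s. F (s, t)) 0 \<noteq> 0))"

text \<open>The unit speed geodesic segment of length \<open>r\<close> from \<open>S\<close> to \<open>p\<close>, orthogonal to \<open>S\<close>, runs
  inside \<open>U\<close>.\<close>

definition normal_segment_in ::
    "('a::topological_space, 'e::euclidean_space) riem \<Rightarrow> 'a set \<Rightarrow> 'a set \<Rightarrow> 'a \<Rightarrow> real \<Rightarrow> bool" where
  "normal_segment_in N S U p r \<longleftrightarrow> (\<exists>I \<gamma>. normal_geodesic N S I \<gamma> \<and>
     {0..r} \<subseteq> I \<and> \<gamma> ` {0..r} \<subseteq> U \<and> \<gamma> r = p \<and> (\<forall>t\<in>I. speed N \<gamma> t = 1))"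

section \<open>The scalar comparison equation\<close>

definition ode_solution :: "(real \<Rightarrow> real) \<Rightarrow> (real \<Rightarrow> real) \<Rightarrow> bool" where
  "ode_solution G h \<longleftrightarrow> (\<forall>t. h differentiable (at t)) \<and>
     (\<forall>t. (deriv h has_real_derivative G t * h t) (at t))"

definition maximal_positive_interval :: "(real \<Rightarrow> real) \<Rightarrow> ereal \<Rightarrow> ereal \<Rightarrow> bool" where
  "maximal_positive_interval h a b \<longleftrightarrow>
     (\<forall>t. a < ereal t \<and> ereal t < b \<longrightarrow> h t > 0) \<and>
     (\<forall>a' b'. a' \<le> a \<longrightarrow> b \<le> b' \<longrightarrow> (\<forall>t. a' < ereal t \<and> ereal t < b' \<longrightarrow> h t > 0) \<longrightarrow>
        a' = a \<and> b' = b)"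

end

theory Submission
  imports Defs
begin

text \<open>The theorem is the comparison theorem for the matrix Riccati equation. Where the gradient \<open>X\<close> of
  the distance has length 1, its integral curves are geodesics, and its covariant derivative
  \<open>A\<close>, the Hessian with one index raised, satisfies \<open>\<nabla>\<^sub>X A + A\<^sup>2 + R(\<cdot>,X)X = 0\<close> (lemma
  \<open>riccati\<close>); on the other hand \<open>\<omega> = h'/h\<close> solves the scalar equation \<open>\<omega>' + \<omega>\<^sup>2 = G\<close>. Let
  \<open>E\<close> be the difference of the Hessian and of \<open>\<omega>\<close> times the metric on the orthogonal complement
  of \<open>X\<close>. Because \<open>A\<^sup>2 - \<omega>\<^sup>2\<close> factors, \<open>E\<close> satisfies a linear differential inequality
  along each integral curve of \<open>X\<close>, and such an inequality preserves semidefiniteness (lemmas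
  \<open>excess_derivative\<close> and \<open>quadratic_form_comparison\<close>). Unlike arguments with extremal
  eigenvalues, this one treats both halves of the theorem alike: they differ by a factor
  \<open>\<sigma> = \<plusminus>1\<close> only.

  Three further facts are needed to apply this to the signed distance.

  First, \<open>X\<close> has length 1 and the normal segments are integral curves of \<open>X\<close>. The length is at
  most 1 because a normal segment followed by a short straight piece in a chart is a competitor for
  the distance (\<open>rdist_to_le_broken_curve\<close>, \<open>gradient_norm_le_1\<close>). Along a normal segment \<open>\<rho>\<close>
  therefore equals arc length, so that the velocity, a unit vector whose inner product with \<open>X\<close>
  is 1, must be \<open>X\<close> (\<open>\<rho>_along_segment\<close>, \<open>segment_is_integral_curve\<close>).

  Second, at the foot of the segment the hypothesis on the second fundamental form covers all
  vectors orthogonal to \<open>X\<close>: in a slice chart the tangent space of the hypersurface is a hyperplane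
  inside the kernel of the nonzero differential of \<open>\<rho>\<close>, hence equal to it
  (\<open>tangent_to_level_set\<close>).

  Third, a normal segment need not lie in one chart. The sign of \<open>E\<close> does not depend on the chart,
  as the Hessian is half the Lie derivative of the metric along \<open>X\<close> (\<open>hess_lie\<close>, \<open>hess_eq\<close>),
  and so the comparison in single charts can be continued along the whole segment
  (\<open>form_sign_along_segment\<close>).\<close>

section \<open>Families of linear and bilinear maps\<close>

text \<open>Metrics, Christoffel symbols and differentials are families of (bi)linear maps that are known to be
  differentiable only for fixed arguments. In finite dimension this suffices for the product rule
  with varying arguments, since an expansion in a basis has finitely many terms.\<close>

lemma has_derivative_linear_family:
  fixes L :: "'x::real_normed_vector \<Rightarrow> 'e::euclidean_space \<Rightarrow> 'g::real_normed_vector"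
  assumes S: "open S" "x \<in> S" and lin: "\<And>y. y \<in> S \<Longrightarrow> linear (L y)"
    and der: "\<And>z. ((\<lambda>y. L y z) has_derivative (\<lambda>h. L' h z)) (at x)"
    and Z: "(Z has_derivative Z') (at x)"
  shows "((\<lambda>y. L y (Z y)) has_derivative (\<lambda>h. L' h (Z x) + L x (Z' h))) (at x)"
proof -
  have expand: "L y z = (\<Sum>i\<in>Basis. (z \<bullet> i) *\<^sub>R L y i)" if "y \<in> S" for y z
    using linear_sum[OF lin[OF that], of "\<lambda>i. (z \<bullet> i) *\<^sub>R i" Basis]
    by (simp add: linear_cmul[OF lin[OF that]] euclidean_representation)
  have expand': "L' h z = (\<Sum>i\<in>Basis. (z \<bullet> i) *\<^sub>R L' h i)" for h z
  proof -
    have "((\<lambda>y. \<Sum>i\<in>Basis. (z \<bullet> i) *\<^sub>R L y i) has_derivative (\<lambda>h. \<Sum>i\<in>Basis. (z \<bullet> i) *\<^sub>R L' h i)) (at x)"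
      by (intro has_derivative_sum has_derivative_scaleR_right der)
    then have "((\<lambda>y. L y z) has_derivative (\<lambda>h. \<Sum>i\<in>Basis. (z \<bullet> i) *\<^sub>R L' h i)) (at x)"
      by (rule has_derivative_transform_within_open[OF _ S]) (simp add: expand)
    from has_derivative_unique[OF this der] show ?thesis by metis
  qed
  have "((\<lambda>y. \<Sum>i\<in>Basis. (Z y \<bullet> i) *\<^sub>R L y i) has_derivative
         (\<lambda>h. \<Sum>i\<in>Basis. (Z x \<bullet> i) *\<^sub>R L' h i + (Z' h \<bullet> i) *\<^sub>R L x i)) (at x)"
    by (intro has_derivative_sum has_derivative_scaleR der has_derivative_inner_left Z)
  then have "((\<lambda>y. L y (Z y)) has_derivative
         (\<lambda>h. \<Sum>i\<in>Basis. (Z x \<bullet> i) *\<^sub>R L' h i + (Z' h \<bullet> i) *\<^sub>R L x i)) (at x)"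
    by (rule has_derivative_transform_within_open[OF _ S]) (subst expand, auto)
  moreover have "(\<Sum>i\<in>Basis. (Z x \<bullet> i) *\<^sub>R L' h i + (Z' h \<bullet> i) *\<^sub>R L x i) = L' h (Z x) + L x (Z' h)" for h
    using expand'[of h "Z x"] expand[OF S(2), of "Z' h"] by (simp add: sum.distrib)
  ultimately show ?thesis by simp
qed

lemma has_derivative_bilinear_family:
  fixes B :: "'x::real_normed_vector \<Rightarrow> 'e::euclidean_space \<Rightarrow> 'e \<Rightarrow> 'g::real_normed_vector"
  assumes S: "open S" "x \<in> S" and bil: "\<And>y. y \<in> S \<Longrightarrow> bilinear (B y)"
    and der: "\<And>u v. ((\<lambda>y. B y u v) has_derivative (\<lambda>h. B' h u v)) (at x)"
    and Y: "(Y has_derivative Y') (at x)" and Z: "(Z has_derivative Z') (at x)"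
  shows "((\<lambda>y. B y (Y y) (Z y)) has_derivative
           (\<lambda>h. B' h (Y x) (Z x) + B x (Y' h) (Z x) + B x (Y x) (Z' h))) (at x)"
proof -
  have "((\<lambda>y. B y (Y y) z) has_derivative (\<lambda>h. B' h (Y x) z + B x (Y' h) z)) (at x)" for z
    by (rule has_derivative_linear_family[where L="\<lambda>y u. B y u z" and L'="\<lambda>h u. B' h u z", OF S _ der Y])
       (use bil in \<open>auto simp: bilinear_def\<close>)
  from has_derivative_linear_family[where L="\<lambda>y. B y (Y y)" and L'="\<lambda>h z. B' h (Y x) z + B x (Y' h) z", OF S _ this Z]
  show ?thesis using bil by (auto simp: bilinear_def)
qed

lemma continuous_on_linear_family:
  fixes L :: "'x::topological_space \<Rightarrow> 'e::euclidean_space \<Rightarrow> 'g::real_normed_vector"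
  assumes lin: "\<And>y. y \<in> S \<Longrightarrow> linear (L y)"
    and cont: "\<And>z. continuous_on S (\<lambda>y. L y z)" and Z: "continuous_on S Z"
  shows "continuous_on S (\<lambda>y. L y (Z y))"
proof -
  have expand: "L y z = (\<Sum>i\<in>Basis. (z \<bullet> i) *\<^sub>R L y i)" if "y \<in> S" for y z
    using linear_sum[OF lin[OF that], of "\<lambda>i. (z \<bullet> i) *\<^sub>R i" Basis]
    by (simp add: linear_cmul[OF lin[OF that]] euclidean_representation)
  have "continuous_on S (\<lambda>y. \<Sum>i\<in>Basis. (Z y \<bullet> i) *\<^sub>R L y i)"
    by (intro continuous_intros cont Z)
  then show ?thesis
    by (rule continuous_on_eq) (subst expand, auto)
qed

lemma continuous_on_bilinear_family:
  fixes B :: "'x::topological_space \<Rightarrow> 'e::euclidean_space \<Rightarrow> 'e \<Rightarrow> 'g::real_normed_vector"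
  assumes bil: "\<And>y. y \<in> S \<Longrightarrow> bilinear (B y)"
    and cont: "\<And>u v. continuous_on S (\<lambda>y. B y u v)"
    and Y: "continuous_on S Y" and Z: "continuous_on S Z"
  shows "continuous_on S (\<lambda>y. B y (Y y) (Z y))"
proof -
  have "continuous_on S (\<lambda>y. B y (Y y) z)" for z
    by (rule continuous_on_linear_family[where L="\<lambda>y u. B y u z", OF _ cont Y])
       (use bil in \<open>auto simp: bilinear_def\<close>)
  from continuous_on_linear_family[where L="\<lambda>y. B y (Y y)", OF _ this Z]
  show ?thesis using bil by (auto simp: bilinear_def)
qed

lemma linear_family_bound:
  fixes L :: "'x::topological_space \<Rightarrow> 'e::euclidean_space \<Rightarrow> 'g::real_normed_vector"
  assumes K: "compact K" and lin: "\<And>y. y \<in> K \<Longrightarrow> linear (L y)"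
    and cont: "\<And>z. continuous_on K (\<lambda>y. L y z)"
  obtains C where "C \<ge> 0" "\<And>y z. y \<in> K \<Longrightarrow> norm (L y z) \<le> C * norm z"
proof -
  have "\<exists>c. \<forall>y\<in>K. norm (L y z) \<le> c" for z
    using compact_imp_bounded[OF compact_continuous_image[OF cont K]] unfolding bounded_iff by auto
  then obtain c where c: "\<And>z y. y \<in> K \<Longrightarrow> norm (L y z) \<le> c z" by metis
  show ?thesis
  proof (rule that[of "\<Sum>i\<in>Basis. \<bar>c i\<bar>"])
    fix y z assume y: "y \<in> K"
    have "L y z = (\<Sum>i\<in>Basis. (z \<bullet> i) *\<^sub>R L y i)"
      using linear_sum[OF lin[OF y], of "\<lambda>i. (z \<bullet> i) *\<^sub>R i" Basis]
      by (simp add: linear_cmul[OF lin[OF y]] euclidean_representation)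
    also have "norm \<dots> \<le> (\<Sum>i\<in>Basis. norm z * \<bar>c i\<bar>)"
    proof (rule sum_norm_le)
      fix i :: 'e assume i: "i \<in> Basis"
      have "norm (L y i) \<le> \<bar>c i\<bar>" using c[OF y, of i] by linarith
      then show "norm ((z \<bullet> i) *\<^sub>R L y i) \<le> norm z * \<bar>c i\<bar>"
        using Basis_le_norm[OF i, of z] by (simp add: mult_mono)
    qed
    finally show "norm (L y z) \<le> (\<Sum>i\<in>Basis. \<bar>c i\<bar>) * norm z"
      by (simp add: sum_distrib_left mult.commute)
  qed (simp add: sum_nonneg)
qed

lemma positive_definite_coercive_near:
  fixes B :: "'x::t2_space \<Rightarrow> 'e::euclidean_space \<Rightarrow> 'e \<Rightarrow> real"
  assumes S: "open S" "x \<in> S" and bil: "\<And>y. y \<in> S \<Longrightarrow> bilinear (B y)"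
    and cont: "\<And>u v. isCont (\<lambda>y. B y u v) x"
    and pos: "\<And>v. v \<noteq> 0 \<Longrightarrow> 0 < B x v v"
  obtains c where "c > 0" "\<forall>\<^sub>F y in nhds x. \<forall>v. c * (norm v)\<^sup>2 \<le> B y v v"
proof -
  have "continuous_on (sphere 0 1) (\<lambda>v. B x v v)"
    by (rule continuous_on_bilinear_family) (use bil S in auto)
  moreover have "sphere (0::'e) 1 \<noteq> {}" by simp
  ultimately obtain v0 where v0: "v0 \<in> sphere 0 1" and min: "\<And>v. v \<in> sphere 0 1 \<Longrightarrow> B x v0 v0 \<le> B x v v"
    using continuous_attains_inf[of "sphere (0::'e) 1"] by fastforce
  define c0 where "c0 = B x v0 v0"
  have c0: "c0 > 0" unfolding c0_def using v0 by (intro pos) auto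
  have lower: "c0 * (norm v)\<^sup>2 \<le> B x v v" for v
  proof (cases "v = 0")
    case True then show ?thesis using bilinear_lzero[OF bil[OF S(2)]] by simp
  next
    case False
    have "c0 \<le> B x (v /\<^sub>R norm v) (v /\<^sub>R norm v)"
      unfolding c0_def by (rule min) (use False in simp)
    also have "\<dots> = B x v v / (norm v)\<^sup>2"
      using bil[OF S(2)] by (simp add: bilinear_lmul bilinear_rmul power2_eq_square divide_inverse)
    finally show ?thesis using False by (simp add: pos_le_divide_eq)
  qed
  have "((\<lambda>y. \<Sum>i\<in>Basis. \<Sum>j\<in>Basis. \<bar>B y i j - B x i j\<bar>) \<longlongrightarrow>
          (\<Sum>i\<in>Basis. \<Sum>j\<in>Basis. \<bar>B x i j - B x i j\<bar>)) (nhds x)"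
  proof (intro tendsto_intros)
    fix i j
    show "((\<lambda>y. B y i j) \<longlongrightarrow> B x i j) (nhds x)"
      using cont[of i j] unfolding isCont_def by (rule tendsto_at_iff_tendsto_nhds[of "\<lambda>y. B y i j", THEN iffD1])
  qed
  then have "\<forall>\<^sub>F y in nhds x. (\<Sum>i\<in>Basis. \<Sum>j\<in>Basis. \<bar>B y i j - B x i j\<bar>) < c0 / 2"
    by (rule order_tendstoD) (use c0 in auto)
  moreover have "\<forall>\<^sub>F y in nhds x. y \<in> S" using S by (rule eventually_nhds_in_open)
  ultimately have "\<forall>\<^sub>F y in nhds x. \<forall>v. (c0/2) * (norm v)\<^sup>2 \<le> B y v v"
  proof eventually_elim
    case (elim y)
    show ?case
    proof
      fix v
      have *: "B y v v = (\<Sum>i\<in>Basis. \<Sum>j\<in>Basis. ((v \<bullet> i) * (v \<bullet> j)) * B y i j)" if "y \<in> S" for y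
        using bilinear_sum[OF bil[OF that], of "\<lambda>i. (v \<bullet> i) *\<^sub>R i" Basis "\<lambda>i. (v \<bullet> i) *\<^sub>R i" Basis]
        by (simp add: bilinear_lmul[OF bil[OF that]] bilinear_rmul[OF bil[OF that]] euclidean_representation
              sum.cartesian_product mult.assoc mult.left_commute)
      have "B x v v - B y v v = (\<Sum>i\<in>Basis. \<Sum>j\<in>Basis. ((v \<bullet> i) * (v \<bullet> j)) * (B x i j - B y i j))"
        unfolding *[OF S(2)] *[OF elim(2)] by (simp add: sum_subtractf right_diff_distrib)
      also have "\<dots> \<le> (\<Sum>i\<in>Basis. \<Sum>j\<in>Basis. (norm v)\<^sup>2 * \<bar>B y i j - B x i j\<bar>)"
      proof (intro sum_mono)
        fix i j :: 'e assume ij: "i \<in> Basis" "j \<in> Basis"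
        have "\<bar>(v \<bullet> i) * (v \<bullet> j)\<bar> \<le> (norm v)\<^sup>2"
          unfolding abs_mult power2_eq_square using ij by (intro mult_mono Basis_le_norm) auto
        then have "\<bar>(v \<bullet> i) * (v \<bullet> j)\<bar> * \<bar>B x i j - B y i j\<bar> \<le> (norm v)\<^sup>2 * \<bar>B y i j - B x i j\<bar>"
          by (simp add: abs_minus_commute mult_right_mono)
        then show "((v \<bullet> i) * (v \<bullet> j)) * (B x i j - B y i j) \<le> (norm v)\<^sup>2 * \<bar>B y i j - B x i j\<bar>"
          by (metis abs_ge_self abs_mult order_trans)
      qed
      also have "\<dots> = (norm v)\<^sup>2 * (\<Sum>i\<in>Basis. \<Sum>j\<in>Basis. \<bar>B y i j - B x i j\<bar>)"
        by (simp add: sum_distrib_left)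
      also have "\<dots> \<le> (norm v)\<^sup>2 * (c0/2)"
        using elim(1) by (intro mult_left_mono) auto
      finally show "(c0/2) * (norm v)\<^sup>2 \<le> B y v v" using lower[of v] by (simp add: algebra_simps)
    qed
  qed
  with c0 show ?thesis by (intro that[of "c0/2"]) auto
qed

lemma positive_definite_representation:
  fixes B :: "'e::euclidean_space \<Rightarrow> 'e \<Rightarrow> real"
  assumes bil: "bilinear B" and pos: "\<And>v. v \<noteq> 0 \<Longrightarrow> 0 < B v v"
  obtains \<Psi> where "linear \<Psi>" "\<And>l z. linear l \<Longrightarrow> B (\<Psi> (\<Sum>i\<in>Basis. l i *\<^sub>R i)) z = l z"
proof -
  define \<Phi> where "\<Phi> w = (\<Sum>i\<in>Basis. B w i *\<^sub>R i)" for w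
  have lin: "linear \<Phi>"
    unfolding \<Phi>_def using bil
    by (intro linearI) (auto simp: bilinear_ladd bilinear_lmul scaleR_left_distrib sum.distrib scaleR_sum_right)
  have inner: "\<Phi> w \<bullet> z = B w z" for w z
  proof -
    have "B w z = (\<Sum>i\<in>Basis. (z \<bullet> i) * B w i)"
      using bil linear_sum[of "B w" "\<lambda>i. (z \<bullet> i) *\<^sub>R i" Basis]
      by (simp add: bilinear_def linear_cmul euclidean_representation)
    then show ?thesis by (simp add: \<Phi>_def inner_sum_left inner_commute[of z] mult.commute)
  qed
  have "inj \<Phi>"
    unfolding linear_injective_0[OF lin]
    by (metis inner inner_zero_left less_irrefl pos)
  then have "surj \<Phi>" by (intro linear_injective_imp_surjective[OF lin]) simp_all
  define \<Psi> where "\<Psi> = inv \<Phi>"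
  have "linear \<Psi>"
    unfolding \<Psi>_def using inj_linear_imp_inv_linear[OF lin \<open>inj \<Phi>\<close>] .
  moreover have "B (\<Psi> (\<Sum>i\<in>Basis. l i *\<^sub>R i)) z = l z" if "linear l" for l z
  proof -
    have "B (\<Psi> (\<Sum>i\<in>Basis. l i *\<^sub>R i)) z = (\<Sum>i\<in>Basis. l i *\<^sub>R i) \<bullet> z"
      unfolding inner[symmetric] \<Psi>_def by (simp add: surj_f_inv_f[OF \<open>surj \<Phi>\<close>])
    also have "\<dots> = (\<Sum>i\<in>Basis. (z \<bullet> i) * l i)"
      by (simp add: inner_sum_left inner_commute[of z] mult.commute)
    also have "\<dots> = l z"
      using linear_sum[OF that, of "\<lambda>i. (z \<bullet> i) *\<^sub>R i" Basis]
      by (simp add: linear_cmul[OF that] euclidean_representation)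
    finally show ?thesis .
  qed
  ultimately show ?thesis by (rule that)
qed

lemma positive_definite_represents:
  fixes B :: "'e::euclidean_space \<Rightarrow> 'e \<Rightarrow> real"
  assumes "bilinear B" "\<And>v. v \<noteq> 0 \<Longrightarrow> 0 < B v v" "linear l"
  obtains w where "\<And>z. B w z = l z"
proof -
  obtain \<Psi> where \<Psi>: "linear \<Psi>" "\<And>l z. linear l \<Longrightarrow> B (\<Psi> (\<Sum>i\<in>Basis. l i *\<^sub>R i)) z = l z"
    using positive_definite_representation[OF assms(1,2)] by blast
  show ?thesis by (rule that) (rule \<Psi>(2)[OF assms(3)])
qed

lemma nondegenerate_eqI:
  fixes B :: "'e::euclidean_space \<Rightarrow> 'e \<Rightarrow> real"
  assumes bil: "bilinear B" and pos: "\<And>v. v \<noteq> 0 \<Longrightarrow> 0 < B v v" and eq: "\<And>z. B u z = B v z"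
  shows "u = v"
proof -
  have "B (u - v) (u - v) = 0" using eq by (simp add: bilinear_lsub[OF bil])
  then show ?thesis using pos[of "u - v"] by (metis less_irrefl right_minus_eq)
qed

text \<open>Gradients and Christoffel symbols are defined implicitly, as solutions \<open>w\<close> of
  \<open>B(w,\<cdot>) = l\<close>. The derivative of \<open>w\<close> is again the solution of such an equation, so that
  the lemma can be iterated to obtain higher derivatives.\<close>

lemma solution_has_derivative:
  fixes B :: "'x::euclidean_space \<Rightarrow> 'e::euclidean_space \<Rightarrow> 'e \<Rightarrow> real"
  assumes S: "open S" "x \<in> S" and bil: "\<And>y. y \<in> S \<Longrightarrow> bilinear (B y)"
    and pos: "\<And>v. v \<noteq> 0 \<Longrightarrow> 0 < B x v v"
    and B': "\<And>u v. ((\<lambda>y. B y u v) has_derivative (\<lambda>h. B' h u v)) (at x)"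
    and l': "\<And>z. ((\<lambda>y. l y z) has_derivative (\<lambda>h. l' h z)) (at x)"
    and sol: "\<And>y z. y \<in> S \<Longrightarrow> B y (w y) z = l y z"
  obtains w' where "(w has_derivative w') (at x)" "\<And>h z. B x (w' h) z = l' h z - B' h (w x) z"
proof -
  obtain \<Psi> where \<Psi>: "linear \<Psi>" "\<And>l z. linear l \<Longrightarrow> B x (\<Psi> (\<Sum>i\<in>Basis. l i *\<^sub>R i)) z = l z"
    using positive_definite_representation[OF bil[OF S(2)] pos] by metis
  define k where "k y z = l y z - B y (w x) z" for y z
  define k' where "k' h z = l' h z - B' h (w x) z" for h z
  have k_lin: "linear (k y)" if "y \<in> S" for y
  proof -
    have "linear (\<lambda>z. B y (w y) z - B y (w x) z)"
      using bil[OF that] by (intro linear_compose_sub) (auto simp: bilinear_def)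
    then show ?thesis using sol[OF that] by (simp add: k_def[abs_def])
  qed
  have k_der: "((\<lambda>y. k y z) has_derivative (\<lambda>h. k' h z)) (at x)" for z
    unfolding k_def k'_def by (intro has_derivative_diff l' B')
  have k'_lin: "linear (k' h)" for h
  proof (rule linearI)
    fix u v :: 'e and r :: real
    have "((\<lambda>y. k y u + k y v) has_derivative (\<lambda>h. k' h u + k' h v)) (at x)"
      by (intro has_derivative_add k_der)
    then have "((\<lambda>y. k y (u + v)) has_derivative (\<lambda>h. k' h u + k' h v)) (at x)"
      by (rule has_derivative_transform_within_open[OF _ S]) (simp add: linear_add[OF k_lin])
    from has_derivative_unique[OF this k_der] show "k' h (u + v) = k' h u + k' h v" by metis
    have "((\<lambda>y. r *\<^sub>R k y u) has_derivative (\<lambda>h. r *\<^sub>R k' h u)) (at x)"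
      by (intro has_derivative_scaleR_right k_der)
    then have "((\<lambda>y. k y (r *\<^sub>R u)) has_derivative (\<lambda>h. r *\<^sub>R k' h u)) (at x)"
      by (rule has_derivative_transform_within_open[OF _ S]) (simp add: linear_cmul[OF k_lin])
    from has_derivative_unique[OF this k_der] show "k' h (r *\<^sub>R u) = r *\<^sub>R k' h u" by metis
  qed
  define w' where "w' h = \<Psi> (\<Sum>i\<in>Basis. k' h i *\<^sub>R i)" for h
  have w'_eq: "B x (w' h) z = k' h z" for h z
    unfolding w'_def by (rule \<Psi>(2)[OF k'_lin])
  have bl_k': "bounded_linear (\<lambda>h. k' h z)" for z using k_der by (rule has_derivative_bounded_linear)
  have "linear w'"
  proof (rule linearI)
    fix g h :: 'x and r :: real
    show "w' (g + h) = w' g + w' h"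
      by (rule nondegenerate_eqI[OF bil[OF S(2)] pos])
         (simp_all add: w'_eq bilinear_ladd[OF bil[OF S(2)]] linear_add[OF bounded_linear.linear[OF bl_k']])
    show "w' (r *\<^sub>R h) = r *\<^sub>R w' h"
      by (rule nondegenerate_eqI[OF bil[OF S(2)] pos])
         (simp_all add: w'_eq bilinear_lmul[OF bil[OF S(2)]] linear_cmul[OF bounded_linear.linear[OF bl_k']])
  qed
  then have bl_w': "bounded_linear w'" by (simp add: linear_linear)
  have cont: "isCont (\<lambda>y. B y u v) x" for u v
    using B' has_derivative_continuous by blast
  obtain c where c: "c > 0" "\<forall>\<^sub>F y in nhds x. \<forall>v. c * (norm v)\<^sup>2 \<le> B y v v"
    using positive_definite_coercive_near[OF S bil cont pos] by blast
  \<comment> \<open>The defect of the linear approximation of the solution is the solution for the right-hand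
      side \<open>\<psi>\<close>, which vanishes to first order at \<open>x\<close>; coercivity turns this into a
      first-order bound for the defect.\<close>
  define \<psi> where "\<psi> z y = k y z - B y (w' (y - x)) z" for z y
  have \<psi>: "(\<psi> z has_derivative (\<lambda>h. 0)) (at x)" for z
  proof -
    have "((\<lambda>y. w' (y - x)) has_derivative w') (at x)"
      by (auto intro!: derivative_eq_intros bounded_linear.has_derivative[OF bl_w'])
    from has_derivative_bilinear_family[OF S bil B' this has_derivative_const[of z]]
    have "((\<lambda>y. B y (w' (y - x)) z) has_derivative (\<lambda>h. B' h 0 z + B x (w' h) z)) (at x)"
      using linear_0[OF \<open>linear w'\<close>] by (simp add: bilinear_rzero[OF bil[OF S(2)]])
    moreover have "B' h 0 z = 0" for h
    proof -
      have "((\<lambda>y. 0) has_derivative (\<lambda>h. B' h 0 z)) (at x)"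
        by (rule has_derivative_transform_within_open[OF B'[of 0 z] S]) (simp add: bilinear_lzero[OF bil])
      from has_derivative_unique[OF this has_derivative_const] show ?thesis by metis
    qed
    ultimately have "((\<lambda>y. B y (w' (y - x)) z) has_derivative (\<lambda>h. k' h z)) (at x)"
      by (simp add: w'_eq)
    from has_derivative_diff[OF k_der[of z] this] show ?thesis by (simp add: \<psi>_def[abs_def])
  qed
  have \<psi>0: "\<psi> z x = 0" for z
    using linear_0[OF \<open>linear w'\<close>] sol[OF S(2), of z] by (simp add: \<psi>_def k_def bilinear_lzero[OF bil[OF S(2)]])
  have "(w has_derivative w') (at x)"
    unfolding has_derivative_at
  proof (intro conjI bl_w')
    let ?e = "\<lambda>y. w y - w x - w' (y - x)"
    have bound: "\<forall>\<^sub>F h in at 0. norm (w (x + h) - w x - w' h) / norm h \<le> (\<Sum>i\<in>Basis. \<bar>\<psi> i (x + h)\<bar> / norm h) / c"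
    proof -
      have "\<forall>\<^sub>F y in nhds x. (\<forall>v. c * (norm v)\<^sup>2 \<le> B y v v) \<and> y \<in> S"
        using c(2) eventually_nhds_in_open[OF S] by (rule eventually_conj)
      then have "\<forall>\<^sub>F y in at x. (\<forall>v. c * (norm v)\<^sup>2 \<le> B y v v) \<and> y \<in> S"
        by (rule eventually_nhds_conv_at[THEN iffD1, THEN conjunct1])
      then have "\<forall>\<^sub>F h in at 0. (\<forall>v. c * (norm v)\<^sup>2 \<le> B (h + x) v v) \<and> h + x \<in> S"
        unfolding at_to_0[of x] eventually_filtermap .
      then show ?thesis
      proof eventually_elim
        case (elim h)
        define y where "y = x + h"
        have y: "y \<in> S" "\<And>v. c * (norm v)\<^sup>2 \<le> B y v v" "y - x = h" using elim by (auto simp: y_def add.commute)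
        define e where "e = ?e y"
        have Be: "B y e z = \<psi> z y" for z
          unfolding e_def \<psi>_def k_def using sol[OF y(1), of z] by (simp add: bilinear_lsub[OF bil[OF y(1)]])
        have "B y e e = (\<Sum>i\<in>Basis. (e \<bullet> i) * B y e i)"
          using bil[OF y(1)] linear_sum[of "B y e" "\<lambda>i. (e \<bullet> i) *\<^sub>R i" Basis]
          by (simp add: bilinear_def linear_cmul euclidean_representation)
        also have "\<dots> \<le> (\<Sum>i\<in>Basis. norm e * \<bar>\<psi> i y\<bar>)"
        proof (rule sum_mono)
          fix i :: 'e assume "i \<in> Basis"
          have "(e \<bullet> i) * \<psi> i y \<le> \<bar>e \<bullet> i\<bar> * \<bar>\<psi> i y\<bar>" by (metis abs_ge_self abs_mult)
          also have "\<dots> \<le> norm e * \<bar>\<psi> i y\<bar>" using Basis_le_norm[OF \<open>i \<in> Basis\<close>] by (intro mult_right_mono) auto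
          finally show "(e \<bullet> i) * B y e i \<le> norm e * \<bar>\<psi> i y\<bar>" by (simp add: Be)
        qed
        finally have "c * (norm e)\<^sup>2 \<le> norm e * (\<Sum>i\<in>Basis. \<bar>\<psi> i y\<bar>)"
          using y(2)[of e] by (simp add: sum_distrib_left)
        then have "norm e \<le> (\<Sum>i\<in>Basis. \<bar>\<psi> i y\<bar>) / c"
          using c(1) by (cases "norm e = 0") (auto simp: power2_eq_square field_simps sum_nonneg)
        then have "norm e / norm h \<le> ((\<Sum>i\<in>Basis. \<bar>\<psi> i y\<bar>) / c) / norm h"
          by (rule divide_right_mono) simp
        then show ?case using y(3)
          by (simp add: e_def y_def sum_divide_distrib mult.commute)
      qed
    qed
    have "((\<lambda>h. norm (\<psi> z (x + h)) / norm h) \<longlongrightarrow> 0) (at 0)" for z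
      using \<psi>[of z] unfolding has_derivative_at by (simp add: \<psi>0)
    then have lim: "((\<lambda>h. (\<Sum>i\<in>Basis. \<bar>\<psi> i (x + h)\<bar> / norm h) / c) \<longlongrightarrow> (\<Sum>i\<in>(Basis::'e set). 0) / c) (at 0)"
      using c(1) by (intro tendsto_divide tendsto_sum) auto
    show "((\<lambda>h. norm (w (x + h) - w x - w' h) / norm h) \<longlongrightarrow> 0) (at 0)"
      by (rule tendsto_sandwich[OF _ bound tendsto_const]) (use lim in auto)
  qed
  then show ?thesis using w'_eq by (intro that[of w']) (auto simp: k'_def)
qed

section \<open>Symmetry of second derivatives\<close>

text \<open>By the mean value theorem in the direction \<open>v\<close>, the second difference quotient tends to the second
  derivative taken in the order \<open>v\<close>, \<open>u\<close>. The quotient is symmetric in \<open>u\<close> and \<open>v\<close>, whence the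
  symmetry of the second derivative.\<close>

lemma second_difference_estimate:
  fixes f :: "'x::real_normed_vector \<Rightarrow> real"
  assumes S: "open S" "x \<in> S" and f: "\<And>y. y \<in> S \<Longrightarrow> f differentiable (at y)"
    and F: "((\<lambda>y. frechet_derivative f (at y) v) has_derivative F) (at x)"
  shows "((\<lambda>s. (f (x + s *\<^sub>R u + s *\<^sub>R v) - f (x + s *\<^sub>R u) - f (x + s *\<^sub>R v) + f x) / s\<^sup>2) \<longlongrightarrow> F u) (at_right 0)"
proof (rule tendstoI)
  fix e' :: real assume e': "e' > 0"
  define M where "M = norm u + norm v + 1"
  have M: "M > 0" by (simp add: M_def add_nonneg_pos)
  define e where "e = e' / (4 * M)"
  have e: "e > 0" using e' M by (simp add: e_def)
  let ?D = "\<lambda>y. frechet_derivative f (at y) v"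
  obtain d1 where d1: "d1 > 0" "\<And>y. norm (y - x) < d1 \<Longrightarrow> norm (?D y - ?D x - F (y - x)) \<le> e * norm (y - x)"
    using F e unfolding has_derivative_at_alt by meson
  obtain d2 where d2: "d2 > 0" "ball x d2 \<subseteq> S" using S open_contains_ball by metis
  have linF: "linear F" using F by (simp add: has_derivative_bounded_linear bounded_linear.linear)
  have "\<forall>\<^sub>F s in at_right 0. s < min d1 d2 / M"
    using M d1(1) d2(1) by (intro order_tendstoD[of "\<lambda>s. s" 0]) (auto intro!: tendsto_eq_intros)
  moreover have "\<forall>\<^sub>F s::real in at_right 0. s > 0" by (simp add: eventually_at_right_less)
  ultimately show "\<forall>\<^sub>F s in at_right 0. dist ((f (x + s *\<^sub>R u + s *\<^sub>R v) - f (x + s *\<^sub>R u) - f (x + s *\<^sub>R v) + f x) / s\<^sup>2) (F u) < e'"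
  proof eventually_elim
    case (elim s)
    have sM: "s * M < d1" "s * M < d2" using elim(1) M by (auto simp: field_simps)
    have near: "norm ((a *\<^sub>R u + b *\<^sub>R v)) \<le> s * M" if "0 \<le> a" "a \<le> s" "0 \<le> b" "b \<le> s" for a b
    proof -
      have "norm (a *\<^sub>R u + b *\<^sub>R v) \<le> a * norm u + b * norm v"
        using norm_triangle_ineq[of "a *\<^sub>R u" "b *\<^sub>R v"] that by simp
      also have "\<dots> \<le> s * norm u + s * norm v" using that by (intro add_mono mult_right_mono) auto
      also have "\<dots> \<le> s * M" using elim(2) by (simp add: M_def algebra_simps)
      finally show ?thesis .
    qed
    define \<psi> where "\<psi> \<tau> = f (x + s *\<^sub>R u + \<tau> *\<^sub>R v) - f (x + \<tau> *\<^sub>R v)" for \<tau>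
    have line: "((\<lambda>\<tau>. f (z + \<tau> *\<^sub>R v)) has_real_derivative ?D (z + \<tau> *\<^sub>R v)) (at \<tau>)"
      if "z + \<tau> *\<^sub>R v \<in> S" for z \<tau>
    proof -
      have "(f has_derivative frechet_derivative f (at (z + \<tau> *\<^sub>R v))) (at (z + \<tau> *\<^sub>R v))"
        using f[OF that] by (simp add: frechet_derivative_works)
      moreover have "((\<lambda>\<tau>. z + \<tau> *\<^sub>R v) has_derivative (\<lambda>h. h *\<^sub>R v)) (at \<tau>)"
        by (auto intro!: derivative_eq_intros)
      ultimately have "((\<lambda>\<tau>. f (z + \<tau> *\<^sub>R v)) has_derivative (\<lambda>h. frechet_derivative f (at (z + \<tau> *\<^sub>R v)) (h *\<^sub>R v))) (at \<tau>)"
        using diff_chain_at[of "\<lambda>\<tau>. z + \<tau> *\<^sub>R v"] unfolding o_def by blast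
      then have "((\<lambda>\<tau>. f (z + \<tau> *\<^sub>R v)) has_derivative (\<lambda>h. ?D (z + \<tau> *\<^sub>R v) * h)) (at \<tau>)"
        by (simp add: linear_cmul[OF linear_frechet_derivative[OF f[OF that]]] mult.commute)
      then show ?thesis by (rule has_derivative_imp_has_field_derivative) simp
    qed
    have inS: "x + a *\<^sub>R u + b *\<^sub>R v \<in> S" if "0 \<le> a" "a \<le> s" "0 \<le> b" "b \<le> s" for a b
    proof -
      have "dist x (x + a *\<^sub>R u + b *\<^sub>R v) < d2"
        using near[OF that] sM(2) by (simp add: dist_commute[of x] add.assoc) (simp add: dist_norm)
      then show ?thesis using d2(2) by auto
    qed
    have "\<exists>\<xi>. 0 < \<xi> \<and> \<xi> < s \<and> \<psi> s - \<psi> 0 = (s - 0) * (?D (x + s *\<^sub>R u + \<xi> *\<^sub>R v) - ?D (x + \<xi> *\<^sub>R v))"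
    proof (rule MVT2[OF elim(2)])
      fix \<tau> assume \<tau>: "0 \<le> \<tau>" "\<tau> \<le> s"
      show "(\<psi> has_real_derivative ?D (x + s *\<^sub>R u + \<tau> *\<^sub>R v) - ?D (x + \<tau> *\<^sub>R v)) (at \<tau>)"
        unfolding \<psi>_def using inS[of s \<tau>] inS[of 0 \<tau>] \<tau> elim(2)
        by (intro DERIV_diff line) auto
    qed
    then obtain \<xi> where \<xi>: "0 < \<xi>" "\<xi> < s"
      and eq: "\<psi> s - \<psi> 0 = s * (?D (x + s *\<^sub>R u + \<xi> *\<^sub>R v) - ?D (x + \<xi> *\<^sub>R v))" by auto
    define r where "r a = ?D (x + (a *\<^sub>R u + \<xi> *\<^sub>R v)) - ?D x - F (a *\<^sub>R u + \<xi> *\<^sub>R v)" for a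
    have r: "\<bar>r a\<bar> \<le> e * (s * M)" if "0 \<le> a" "a \<le> s" for a
    proof -
      have n: "norm (a *\<^sub>R u + \<xi> *\<^sub>R v) \<le> s * M" using near[OF that] \<xi> by simp
      then have "norm (r a) \<le> e * norm (a *\<^sub>R u + \<xi> *\<^sub>R v)"
        unfolding r_def using d1(2)[of "x + (a *\<^sub>R u + \<xi> *\<^sub>R v)"] sM(1) by simp
      also have "\<dots> \<le> e * (s * M)" using n e by (intro mult_left_mono) auto
      finally show ?thesis by simp
    qed
    have "?D (x + s *\<^sub>R u + \<xi> *\<^sub>R v) - ?D (x + \<xi> *\<^sub>R v) = s * F u + r s - r 0"
      by (simp add: r_def add.assoc linear_add[OF linF] linear_cmul[OF linF])
    with eq have "\<psi> s - \<psi> 0 = s * (s * F u + r s - r 0)" by simp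
    then have "\<psi> s - \<psi> 0 = s\<^sup>2 * F u + s * (r s - r 0)" by (simp add: power2_eq_square algebra_simps)
    then have "(\<psi> s - \<psi> 0) / s\<^sup>2 - F u = (r s - r 0) / s"
      using elim(2) by (simp add: add_divide_distrib power2_eq_square)
    moreover have "\<bar>(r s - r 0) / s\<bar> \<le> 2 * e * M"
    proof -
      have "\<bar>r s - r 0\<bar> \<le> 2 * (e * (s * M))" using r[of s] r[of 0] elim(2) by linarith
      then show ?thesis using elim(2) by (simp add: abs_divide divide_le_eq mult.commute mult.left_commute)
    qed
    moreover have "2 * e * M < e'" using M e' by (simp add: e_def)
    ultimately have "\<bar>(\<psi> s - \<psi> 0) / s\<^sup>2 - F u\<bar> < e'" by linarith
    then show ?case by (simp add: \<psi>_def dist_real_def algebra_simps)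
  qed
qed

lemma second_derivative_symmetric:
  fixes f :: "'x::real_normed_vector \<Rightarrow> 'y::euclidean_space"
  assumes S: "open S" "x \<in> S" and f: "\<And>y. y \<in> S \<Longrightarrow> f differentiable (at y)"
    and Fu: "((\<lambda>y. frechet_derivative f (at y) u) has_derivative Fu) (at x)"
    and Fv: "((\<lambda>y. frechet_derivative f (at y) v) has_derivative Fv) (at x)"
  shows "Fu v = Fv u"
proof (rule euclidean_eqI)
  fix b :: 'y assume "b \<in> Basis"
  define g where "g y = f y \<bullet> b" for y
  have fd: "(f has_derivative frechet_derivative f (at y)) (at y)" if "y \<in> S" for y
    using f[OF that] by (simp add: frechet_derivative_works)
  have gd: "(g has_derivative (\<lambda>h. frechet_derivative f (at y) h \<bullet> b)) (at y)" if "y \<in> S" for y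
    unfolding g_def by (intro has_derivative_inner_left fd that)
  then have gdiff: "\<And>y. y \<in> S \<Longrightarrow> g differentiable (at y)" by (meson differentiableI)
  have geq: "frechet_derivative g (at y) w = frechet_derivative f (at y) w \<bullet> b" if "y \<in> S" for y w
    using frechet_derivative_at[OF gd[OF that]] by metis
  have G: "((\<lambda>y. frechet_derivative g (at y) w) has_derivative (\<lambda>h. F h \<bullet> b)) (at x)"
    if "((\<lambda>y. frechet_derivative f (at y) w) has_derivative F) (at x)" for w F
    by (rule has_derivative_transform_within_open[OF has_derivative_inner_left[OF that] S]) (simp add: geq)
  have "((\<lambda>s. (g (x + s *\<^sub>R v + s *\<^sub>R u) - g (x + s *\<^sub>R v) - g (x + s *\<^sub>R u) + g x) / s\<^sup>2) \<longlongrightarrow> Fu v \<bullet> b) (at_right 0)"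
    by (rule second_difference_estimate[OF S gdiff G[OF Fu]])
  moreover have "((\<lambda>s. (g (x + s *\<^sub>R u + s *\<^sub>R v) - g (x + s *\<^sub>R u) - g (x + s *\<^sub>R v) + g x) / s\<^sup>2) \<longlongrightarrow> Fv u \<bullet> b) (at_right 0)"
    by (rule second_difference_estimate[OF S gdiff G[OF Fv]])
  moreover have "(g (x + s *\<^sub>R v + s *\<^sub>R u) - g (x + s *\<^sub>R v) - g (x + s *\<^sub>R u) + g x) / s\<^sup>2
      = (g (x + s *\<^sub>R u + s *\<^sub>R v) - g (x + s *\<^sub>R u) - g (x + s *\<^sub>R v) + g x) / s\<^sup>2" for s
  proof -
    have swap: "x + s *\<^sub>R v + s *\<^sub>R u = x + s *\<^sub>R u + s *\<^sub>R v" by (simp add: algebra_simps)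
    show ?thesis unfolding swap by simp
  qed
  ultimately have "((\<lambda>s. (g (x + s *\<^sub>R u + s *\<^sub>R v) - g (x + s *\<^sub>R u) - g (x + s *\<^sub>R v) + g x) / s\<^sup>2) \<longlongrightarrow> Fu v \<bullet> b) (at_right 0)"
    and "((\<lambda>s. (g (x + s *\<^sub>R u + s *\<^sub>R v) - g (x + s *\<^sub>R u) - g (x + s *\<^sub>R v) + g x) / s\<^sup>2) \<longlongrightarrow> Fv u \<bullet> b) (at_right 0)"
    by (simp_all only:)
  then show "Fu v \<bullet> b = Fv u \<bullet> b"
    by (rule tendsto_unique[OF trivial_limit_at_right_real])
qed

section \<open>Smooth maps\<close>

lemma smooth_on_differentiable:
  assumes "smooth_on S f" "x \<in> S"
  shows "f differentiable (at x)"
proof -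
  have "Ck_on (Suc 0) S f" using assms(1) unfolding smooth_on_def by blast
  then show ?thesis using assms(2) by simp
qed

lemma smooth_on_frechet_derivative:
  assumes "smooth_on S f"
  shows "smooth_on S (\<lambda>x. frechet_derivative f (at x) v)"
  unfolding smooth_on_def
proof
  fix k
  have "Ck_on (Suc k) S f" using assms unfolding smooth_on_def by blast
  then show "Ck_on k S (\<lambda>x. frechet_derivative f (at x) v)" by simp
qed

lemma smooth_on_has_derivative:
  "smooth_on S f \<Longrightarrow> x \<in> S \<Longrightarrow> (f has_derivative frechet_derivative f (at x)) (at x)"
  by (simp add: frechet_derivative_works[symmetric] smooth_on_differentiable)

lemma smooth_on_continuous:
  assumes "smooth_on S f"
  shows "continuous_on S f"
proof -
  have "Ck_on 0 S f" using assms unfolding smooth_on_def by blast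
  then show ?thesis by simp
qed

lemma Ck_on_cong:
  assumes "Ck_on k S f" "open S" "\<And>x. x \<in> S \<Longrightarrow> f x = g x"
  shows "Ck_on k S g"
  using assms
proof (induction k arbitrary: f g)
  case 0
  then show ?case using continuous_on_eq by auto
next
  case (Suc k)
  have f: "(f has_derivative frechet_derivative f (at x)) (at x)" if "x \<in> S" for x
    using Suc.prems(1) that by (simp add: frechet_derivative_works[symmetric])
  have g: "(g has_derivative frechet_derivative f (at x)) (at x)" if "x \<in> S" for x
    using has_derivative_transform_within_open[OF f[OF that] Suc.prems(2) that] Suc.prems(3) by auto
  have eq: "frechet_derivative f (at x) = frechet_derivative g (at x)" if "x \<in> S" for x
    using frechet_derivative_at[OF g[OF that]] .
  have "Ck_on k S (\<lambda>x. frechet_derivative g (at x) v)" for v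
    by (rule Suc.IH[of "\<lambda>x. frechet_derivative f (at x) v"]) (use Suc.prems eq in auto)
  then show ?case using g by (auto simp: differentiable_def)
qed

lemma Ck_on_compose_affine:
  assumes "Ck_on k S f" "bounded_linear L" "open T" "\<And>t. t \<in> T \<Longrightarrow> a + L t \<in> S"
  shows "Ck_on k T (\<lambda>t. f (a + L t))"
  using assms
proof (induction k arbitrary: f)
  case 0
  have "continuous_on T (\<lambda>t. a + L t)"
    by (intro continuous_intros linear_continuous_on \<open>bounded_linear L\<close>)
  then have "continuous_on T (f \<circ> (\<lambda>t. a + L t))"
    by (rule continuous_on_compose) (rule continuous_on_subset[of S], use 0 in auto)
  then show ?case by (simp add: o_def)
next
  case (Suc k)
  have f: "(f has_derivative frechet_derivative f (at x)) (at x)" if "x \<in> S" for x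
    using Suc.prems(1) that by (simp add: frechet_derivative_works[symmetric])
  have g: "((\<lambda>t. f (a + L t)) has_derivative (\<lambda>h. frechet_derivative f (at (a + L t)) (L h))) (at t)"
    if "t \<in> T" for t
  proof -
    have "((\<lambda>t. a + L t) has_derivative L) (at t)"
      by (auto intro!: derivative_eq_intros bounded_linear.has_derivative[OF \<open>bounded_linear L\<close>])
    from diff_chain_at[OF this f[OF Suc.prems(4)[OF that]]] show ?thesis by (simp add: o_def)
  qed
  have eq: "frechet_derivative (\<lambda>t. f (a + L t)) (at t) v = frechet_derivative f (at (a + L t)) (L v)"
    if "t \<in> T" for t v
    using frechet_derivative_at[OF g[OF that]] by metis
  have "Ck_on k T (\<lambda>t. frechet_derivative (\<lambda>t. f (a + L t)) (at t) v)" for v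
  proof (rule Ck_on_cong[OF _ Suc.prems(3)])
    show "Ck_on k T (\<lambda>t. frechet_derivative f (at (a + L t)) (L v))"
      by (rule Suc.IH[of "\<lambda>x. frechet_derivative f (at x) (L v)"]) (use Suc.prems in auto)
  qed (simp add: eq)
  then show ?case using g by (auto simp: differentiable_def)
qed

lemma Ck_on_subset: "Ck_on k S f \<Longrightarrow> T \<subseteq> S \<Longrightarrow> Ck_on k T f"
  by (induction k arbitrary: f) (auto intro: continuous_on_subset)

lemma smooth_on_subset: "smooth_on S f \<Longrightarrow> T \<subseteq> S \<Longrightarrow> smooth_on T f"
  unfolding smooth_on_def using Ck_on_subset by blast

lemma smooth_on_cong:
  "smooth_on S f \<Longrightarrow> open S \<Longrightarrow> (\<And>x. x \<in> S \<Longrightarrow> f x = g x) \<Longrightarrow> smooth_on S g"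
  unfolding smooth_on_def using Ck_on_cong by blast

lemma smooth_on_compose_affine:
  assumes "smooth_on S f" "bounded_linear L" "open T" "\<And>t. t \<in> T \<Longrightarrow> a + L t \<in> S"
  shows "smooth_on T (\<lambda>t. f (a + L t))"
  using assms Ck_on_compose_affine unfolding smooth_on_def by blast

lemma smooth_on_imp_C1:
  fixes g :: "real \<Rightarrow> 'b::real_normed_vector"
  assumes "smooth_on T g"
  shows "g C1_differentiable_on T"
  unfolding C1_differentiable_on_eq
proof (intro conjI ballI)
  fix t assume t: "t \<in> T"
  show "g differentiable at t" by (rule smooth_on_differentiable[OF assms t])
next
  have eq: "vector_derivative g (at t) = frechet_derivative g (at t) 1" if "t \<in> T" for t
    using fun_cong[OF frechet_derivative_eq_vector_derivative[OF smooth_on_differentiable[OF assms that]], of 1] by simp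
  have "continuous_on T (\<lambda>t. frechet_derivative g (at t) 1)"
    by (rule smooth_on_continuous[OF smooth_on_frechet_derivative[OF assms]])
  then show "continuous_on T (\<lambda>t. vector_derivative g (at t))"
    by (rule continuous_on_eq) (simp add: eq)
qed

lemma C1_differentiable_on_open_Un:
  fixes g :: "real \<Rightarrow> 'b::real_normed_vector"
  assumes "g C1_differentiable_on A" "g C1_differentiable_on B" "open A" "open B"
  shows "g C1_differentiable_on (A \<union> B)"
  using assms unfolding C1_differentiable_on_eq by (auto intro: continuous_on_open_Un)

section \<open>Differential inequalities for quadratic forms\<close>

lemma quadratic_form_null_vector:
  assumes bil: "bilinear Q" and sym: "\<And>u v. Q u v = Q v u"
    and neg: "\<And>v. Q v v \<le> (0::real)" and null: "Q v v = 0"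
  shows "Q u v = 0"
proof (rule ccontr)
  assume ne: "Q u v \<noteq> 0"
  define q where "q = Q u u"
  define c where "c = Q u v"
  have exp: "Q (v + s *\<^sub>R u) (v + s *\<^sub>R u) = 2 * s * c + s\<^sup>2 * q" for s
    using null sym[of v u] by (simp add: bilinear_ladd[OF bil] bilinear_radd[OF bil] bilinear_lmul[OF bil]
        bilinear_rmul[OF bil] q_def c_def power2_eq_square algebra_simps)
  have q: "q \<le> 0" using neg[of u] by (simp add: q_def)
  define s where "s = c / (1 - q)"
  have c: "c = s * (1 - q)" using q by (simp add: s_def)
  have "2 * s * c + s\<^sup>2 * q = s\<^sup>2 * (2 - q)"
    unfolding c by (simp add: power2_eq_square algebra_simps)
  moreover have "s\<^sup>2 * (2 - q) > 0" using q ne by (intro mult_pos_pos) (auto simp: c_def s_def)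
  ultimately show False using neg[of "v + s *\<^sub>R u"] exp[of s] by linarith
qed

text \<open>A quadratic form that is negative semidefinite at time \<open>s\<close> stays so if its derivative at \<open>v\<close> is at
  most \<open>2 Q(L v, v)\<close>: this bound vanishes on null vectors of a semidefinite form.\<close>

lemma quadratic_form_comparison:
  fixes Q :: "real \<Rightarrow> 'e::euclidean_space \<Rightarrow> 'e \<Rightarrow> real"
  assumes st: "s \<le> t"
    and bil: "\<And>\<tau>. \<tau> \<in> {s..t} \<Longrightarrow> bilinear (Q \<tau>)"
    and sym: "\<And>\<tau> u v. \<tau> \<in> {s..t} \<Longrightarrow> Q \<tau> u v = Q \<tau> v u"
    and cont: "\<And>u v. continuous_on {s..t} (\<lambda>\<tau>. Q \<tau> u v)"
    and bound: "\<And>\<tau> v. \<tau> \<in> {s..t} \<Longrightarrow> norm (L \<tau> v) \<le> C * norm v"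
    and der: "\<And>\<tau> v. \<tau> \<in> {s<..t} \<Longrightarrow>
        \<exists>D. ((\<lambda>\<tau>. Q \<tau> v v) has_real_derivative D) (at \<tau>) \<and> D \<le> 2 * Q \<tau> (L \<tau> v) v"
    and init: "\<And>v. Q s v v \<le> 0"
  shows "Q t v v \<le> 0"
proof -
  define K where "K = 2 * C + 1"
  \<comment> \<open>Subtracting a small exponentially growing multiple of the Euclidean form makes the
      differential inequality strict, which excludes a first time of contact with 0.\<close>
  have strict: "Q \<tau>' v' v' < \<epsilon> * exp (K * (\<tau>' - s))" if \<epsilon>: "\<epsilon> > 0" and \<tau>': "\<tau>' \<in> {s..t}" and v': "norm v' = 1" for \<epsilon> \<tau>' v'
  proof (rule ccontr)
    assume not: "\<not> ?thesis"
    define E where "E \<tau> = \<epsilon> * exp (K * (\<tau> - s))" for \<tau>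
    have E: "E \<tau> > 0" for \<tau> using \<epsilon> by (simp add: E_def)
    define q where "q \<tau> v = Q \<tau> v v - E \<tau> * (v \<bullet> v)" for \<tau> v
    let ?P = "{s..t} \<times> sphere (0::'e) 1"
    have "continuous_on ?P (\<lambda>p. Q (fst p) (snd p) (snd p))"
    proof (rule continuous_on_bilinear_family[where B="\<lambda>p. Q (fst p)"])
      fix u v
      show "continuous_on ?P (\<lambda>y. Q (fst y) u v)"
        by (rule continuous_on_compose2[OF cont]) (auto intro!: continuous_intros)
    qed (auto intro!: continuous_intros bil)
    then have cq: "continuous_on ?P (\<lambda>p. q (fst p) (snd p))"
      unfolding q_def E_def by (intro continuous_intros)
    define Z where "Z = {p \<in> ?P. 0 \<le> q (fst p) (snd p)}"
    have "compact ?P" by (intro compact_Times) auto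
    then have "compact Z"
      unfolding compact_eq_bounded_closed Z_def
      by (auto intro: bounded_subset continuous_on_closed_Collect_le[OF continuous_on_const cq])
    moreover have "(\<tau>', v') \<in> Z"
      using not \<tau>' v' by (auto simp: Z_def q_def E_def dot_square_norm)
    ultimately obtain p where p: "p \<in> Z" and pmin: "\<And>p'. p' \<in> Z \<Longrightarrow> fst p \<le> fst p'"
      using continuous_attains_inf[of Z fst] continuous_on_fst[OF continuous_on_id] by blast
    obtain \<tau> v where pv: "p = (\<tau>, v)" by force
    have \<tau>: "\<tau> \<in> {s..t}" and v: "norm v = 1" and qpos: "q \<tau> v \<ge> 0" using p by (auto simp: Z_def pv)
    have before: "q \<sigma> w < 0" if "\<sigma> \<in> {s..<\<tau>}" "norm w = 1" for \<sigma> w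
    proof (rule ccontr)
      assume "\<not> q \<sigma> w < 0"
      then have "(\<sigma>, w) \<in> Z" using that \<tau> by (auto simp: Z_def)
      then show False using pmin[of "(\<sigma>, w)"] that by (simp add: pv)
    qed
    have "s \<noteq> \<tau>"
      using init[of v] qpos E[of s] v by (auto simp: q_def dot_square_norm)
    then have \<tau>s: "s < \<tau>" "\<tau> \<in> {s<..t}" using \<tau> by auto
    have qneg1: "q \<tau> w \<le> 0" if w: "norm w = 1" for w
    proof -
      have "continuous_on {s..t} (\<lambda>\<sigma>. q \<sigma> w)"
        unfolding q_def E_def by (intro continuous_intros cont)
      then have "continuous_on {s..\<tau>} (\<lambda>\<sigma>. q \<sigma> w)" by (rule continuous_on_subset) (use \<tau> in auto)
      then have "((\<lambda>\<sigma>. q \<sigma> w) \<longlongrightarrow> q \<tau> w) (at_left \<tau>)"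
        using \<tau>s(1) continuous_on_Icc_at_leftD by metis
      moreover have "\<forall>\<^sub>F \<sigma> in at_left \<tau>. q \<sigma> w \<le> 0"
        using eventually_at_left[OF \<tau>s(1)] before[OF _ w] \<tau>s(1)
        by (metis (mono_tags, lifting) atLeastLessThan_iff less_eq_real_def)
      ultimately show ?thesis using tendsto_upperbound trivial_limit_at_left_real by blast
    qed
    have bq: "bilinear (\<lambda>u w. Q \<tau> u w - E \<tau> * (u \<bullet> w))"
      unfolding bilinear_def
      by (auto intro!: linearI simp: inner_add_left inner_add_right algebra_simps bilinear_ladd[OF bil[OF \<tau>]]
          bilinear_radd[OF bil[OF \<tau>]] bilinear_lmul[OF bil[OF \<tau>]] bilinear_rmul[OF bil[OF \<tau>]])
    have qneg: "q \<tau> w \<le> 0" for w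
    proof (cases "w = 0")
      case True then show ?thesis by (simp add: q_def bilinear_lzero[OF bil[OF \<tau>]])
    next
      case False
      have "q \<tau> (w /\<^sub>R norm w) = q \<tau> w / (norm w)\<^sup>2"
        by (simp add: q_def bilinear_lmul[OF bil[OF \<tau>]] bilinear_rmul[OF bil[OF \<tau>]] power2_eq_square divide_inverse algebra_simps)
      moreover have "q \<tau> (w /\<^sub>R norm w) \<le> 0" using False by (intro qneg1) simp
      ultimately show ?thesis using False by (simp add: divide_le_0_iff)
    qed
    have null: "q \<tau> v = 0" using qpos qneg[of v] by simp
    have "Q \<tau> u v - E \<tau> * (u \<bullet> v) = 0" for u
      by (rule quadratic_form_null_vector[OF bq]) (use qneg null sym[OF \<tau>] in \<open>auto simp: q_def inner_commute\<close>)
    then have LQ: "Q \<tau> (L \<tau> v) v = E \<tau> * (L \<tau> v \<bullet> v)" by simp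
    obtain D where D: "((\<lambda>\<tau>. Q \<tau> v v) has_real_derivative D) (at \<tau>)" "D \<le> 2 * Q \<tau> (L \<tau> v) v"
      using der[OF \<tau>s(2)] by blast
    have "((\<lambda>\<tau>. E \<tau> * (v \<bullet> v)) has_real_derivative K * E \<tau>) (at \<tau>)"
      unfolding E_def using v by (auto intro!: derivative_eq_intros simp: dot_square_norm)
    then have D': "((\<lambda>\<tau>. q \<tau> v) has_real_derivative D - K * E \<tau>) (at \<tau>)"
      unfolding q_def by (intro DERIV_diff D)
    have "L \<tau> v \<bullet> v \<le> C"
      using norm_cauchy_schwarz[of "L \<tau> v" v] bound[OF \<tau>, of v] v by simp
    then have "Q \<tau> (L \<tau> v) v \<le> E \<tau> * C" unfolding LQ using E[of \<tau>] by (intro mult_left_mono) auto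
    then have "D \<le> E \<tau> * (2 * C)" using D(2) by simp
    then have "D - K * E \<tau> < 0" using E[of \<tau>] by (simp add: K_def algebra_simps)
    then obtain d where d: "d > 0" "\<And>h. 0 < h \<Longrightarrow> h < d \<Longrightarrow> q \<tau> v < q (\<tau> - h) v"
      using DERIV_neg_dec_left[OF D'] by auto
    define h where "h = min (d/2) (\<tau> - s)"
    have h: "0 < h" "h < d" "\<tau> - h \<in> {s..<\<tau>}" using d \<tau>s by (auto simp: h_def)
    from d(2)[OF h(1,2)] before[OF h(3) v] null show False by simp
  qed
  \<comment> \<open>The parameter \<open>\<epsilon>\<close> tends to 0.\<close>
  show ?thesis
  proof (cases "v = 0")
    case True then show ?thesis using bil[of t] st by (simp add: bilinear_lzero)
  next
    case False
    define w where "w = v /\<^sub>R norm v"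
    have w: "norm w = 1" using False by (simp add: w_def)
    have vw: "v = norm v *\<^sub>R w" using False by (simp add: w_def)
    have "Q t w w \<le> 0"
    proof (rule field_le_epsilon)
      fix e :: real assume "e > 0"
      then have "Q t w w < (e * exp (- K * (t - s))) * exp (K * (t - s))"
        using w st by (intro strict) auto
      moreover have "e * exp (- K * (t - s)) * exp (K * (t - s)) = e"
        by (simp add: exp_minus)
      ultimately show "Q t w w \<le> 0 + e" by linarith
    qed
    moreover have "Q t (norm v *\<^sub>R w) (norm v *\<^sub>R w) = (norm v)\<^sup>2 * Q t w w"
      using bil[of t] st by (simp add: bilinear_lmul bilinear_rmul power2_eq_square)
    then have "Q t v v = (norm v)\<^sup>2 * Q t w w" unfolding vw[symmetric] .
    ultimately show ?thesis by (simp add: mult_nonneg_nonpos)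
  qed
qed

text \<open>Bisection globalizes a property that is passed on within a neighbourhood of every time.\<close>

lemma real_nearby_propagation:
  fixes r :: real
  assumes r: "0 \<le> r" and P0: "P 0"
    and local: "\<And>t. t \<in> {0..r} \<Longrightarrow> \<exists>d>0. \<forall>a b. 0 \<le> a \<longrightarrow> b \<le> r \<longrightarrow> a \<le> t \<longrightarrow> t \<le> b \<longrightarrow> b - a < d \<longrightarrow> P a \<longrightarrow> P b"
  shows "P r"
proof -
  have "0 \<le> (0::real) \<longrightarrow> r \<le> r \<longrightarrow> P 0 \<longrightarrow> P r"
  proof (rule Bolzano[OF r, where P="\<lambda>a b. 0 \<le> a \<longrightarrow> b \<le> r \<longrightarrow> P a \<longrightarrow> P b"])
    fix t assume "0 \<le> t" "t \<le> r"
    then obtain d where "d > 0" "\<forall>a b. 0 \<le> a \<longrightarrow> b \<le> r \<longrightarrow> a \<le> t \<longrightarrow> t \<le> b \<longrightarrow> b - a < d \<longrightarrow> P a \<longrightarrow> P b"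
      using local[of t] by auto
    then show "\<exists>d>0. \<forall>a b. a \<le> t \<and> t \<le> b \<and> b - a < d \<longrightarrow> 0 \<le> a \<longrightarrow> b \<le> r \<longrightarrow> P a \<longrightarrow> P b"
      by blast
  qed auto
  with P0 show ?thesis by simp
qed

section \<open>Levi-Civita calculus in a coordinate domain\<close>

definition metric_derivative :: "'e::euclidean_space coord_metric \<Rightarrow> 'e \<Rightarrow> 'e \<Rightarrow> 'e \<Rightarrow> 'e \<Rightarrow> real" where
  "metric_derivative m x h u v = frechet_derivative (\<lambda>y. m y u v) (at x) h"

locale metric_domain =
  fixes m :: "'e::euclidean_space coord_metric" and D :: "'e set"
  assumes open_D: "open D"
    and smooth_m: "\<And>u v. smooth_on D (\<lambda>x. m x u v)"
    and bil: "\<And>x. x \<in> D \<Longrightarrow> bilinear (m x)"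
    and sym: "\<And>x u v. x \<in> D \<Longrightarrow> m x u v = m x v u"
    and pos: "\<And>x v. x \<in> D \<Longrightarrow> v \<noteq> 0 \<Longrightarrow> 0 < m x v v"
begin

abbreviation "dm \<equiv> metric_derivative m"
abbreviation "\<Gamma> \<equiv> christoffel m"

lemmas m_ladd = bilinear_ladd[OF bil] and m_radd = bilinear_radd[OF bil]
  and m_lmul = bilinear_lmul[OF bil] and m_rmul = bilinear_rmul[OF bil]
  and m_lsub = bilinear_lsub[OF bil] and m_rsub = bilinear_rsub[OF bil]
  and m_lneg = bilinear_lneg[OF bil] and m_rneg = bilinear_rneg[OF bil]
  and m_lzero = bilinear_lzero[OF bil] and m_rzero = bilinear_rzero[OF bil]

lemma m_eqI: "x \<in> D \<Longrightarrow> (\<And>z. m x u z = m x v z) \<Longrightarrow> u = v"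
  using nondegenerate_eqI[OF bil pos] by blast

lemma m_has_derivative: "x \<in> D \<Longrightarrow> ((\<lambda>y. m y u v) has_derivative (\<lambda>h. dm x h u v)) (at x)"
  unfolding metric_derivative_def by (rule smooth_on_has_derivative[OF smooth_m])

lemma dm_linear: "x \<in> D \<Longrightarrow> linear (\<lambda>h. dm x h u v)"
  using m_has_derivative has_derivative_bounded_linear bounded_linear.linear by blast

lemma dm_eqI:
  assumes "x \<in> D" "((\<lambda>y. m y u v) has_derivative F) (at x)"
  shows "dm x h u v = F h"
  using has_derivative_unique[OF m_has_derivative[OF assms(1)] assms(2)] by metis

lemma dm_sym: assumes x: "x \<in> D" shows "dm x h u v = dm x h v u"
  by (rule dm_eqI[OF x], rule has_derivative_transform_within_open[OF m_has_derivative[OF x] open_D x])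
     (rule sym)

lemma dm_bilinear: assumes x: "x \<in> D" shows "bilinear (dm x h)"
proof -
  have add: "dm x h (u + v) w = dm x h u w + dm x h v w" for u v w
    by (rule dm_eqI[OF x], rule has_derivative_transform_within_open[OF
          has_derivative_add[OF m_has_derivative[OF x] m_has_derivative[OF x]] open_D x]) (simp add: m_ladd)
  have mul: "dm x h (r *\<^sub>R u) w = r * dm x h u w" for r u w
    by (rule dm_eqI[OF x], rule has_derivative_transform_within_open[OF
          has_derivative_mult_right[OF m_has_derivative[OF x]] open_D x]) (simp add: m_lmul)
  show ?thesis
    unfolding bilinear_def
  proof (intro conjI allI linearI)
    fix u v w :: 'e and r :: real
    show "dm x h w (u + v) = dm x h w u + dm x h w v" by (simp only: dm_sym[OF x, of h w] add)
    show "dm x h w (r *\<^sub>R u) = r *\<^sub>R dm x h w u" by (simp only: dm_sym[OF x, of h w] mul real_scaleR_def)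
  qed (simp_all add: add mul)
qed

lemma dm_differentiable: "x \<in> D \<Longrightarrow> (\<lambda>y. dm y h u v) differentiable (at x)"
  unfolding metric_derivative_def
  by (rule smooth_on_differentiable[OF smooth_on_frechet_derivative[OF smooth_m]])

lemma koszul:
  assumes x: "x \<in> D"
  shows "2 * m x (\<Gamma> x u v) z = dm x u v z + dm x v u z - dm x z u v"
proof -
  let ?l = "\<lambda>z. (dm x u v z + dm x v u z - dm x z u v) / 2"
  have lin: "linear ?l"
    by (intro linearI) (simp_all add: bilinear_radd[OF dm_bilinear[OF x]] bilinear_rmul[OF dm_bilinear[OF x]]
        linear_add[OF dm_linear[OF x]] linear_cmul[OF dm_linear[OF x]] algebra_simps add_divide_distrib diff_divide_distrib)
  obtain w where w: "\<And>z. m x w z = ?l z"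
    by (rule positive_definite_represents[OF bil[OF x] _ lin]) (auto intro: pos x)
  have "\<exists>!w. \<forall>z. 2 * m x w z = dm x u v z + dm x v u z - dm x z u v"
  proof (rule ex1I[of _ w])
    fix w' assume "\<forall>z. 2 * m x w' z = dm x u v z + dm x v u z - dm x z u v"
    then have "2 * m x w' z = 2 * m x w z" for z using w[of z] by simp
    then have "m x w' z = m x w z" for z by simp
    then show "w' = w" by (rule m_eqI[OF x])
  qed (simp add: w)
  from theI'[OF this] show ?thesis
    unfolding christoffel_def metric_derivative_def by blast
qed

lemma \<Gamma>_sym: "x \<in> D \<Longrightarrow> \<Gamma> x u v = \<Gamma> x v u"
proof (rule m_eqI)
  fix z assume x: "x \<in> D"
  show "m x (\<Gamma> x u v) z = m x (\<Gamma> x v u) z"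
    using koszul[OF x, of u v z] koszul[OF x, of v u z] dm_sym[OF x, of z u v] by simp
qed

lemma \<Gamma>_bilinear: assumes x: "x \<in> D" shows "bilinear (\<Gamma> x)"
proof -
  note dm = bilinear_ladd[OF dm_bilinear[OF x]] bilinear_radd[OF dm_bilinear[OF x]]
    bilinear_lmul[OF dm_bilinear[OF x]] bilinear_rmul[OF dm_bilinear[OF x]]
    linear_add[OF dm_linear[OF x]] linear_cmul[OF dm_linear[OF x]]
  have add: "\<Gamma> x (u + v) w = \<Gamma> x u w + \<Gamma> x v w" for u v w
  proof (rule m_eqI[OF x])
    fix z
    show "m x (\<Gamma> x (u + v) w) z = m x (\<Gamma> x u w + \<Gamma> x v w) z"
      using koszul[OF x, of "u + v" w z] koszul[OF x, of u w z] koszul[OF x, of v w z]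
      by (simp add: dm m_ladd[OF x])
  qed
  have mul: "\<Gamma> x (r *\<^sub>R u) w = r *\<^sub>R \<Gamma> x u w" for r u w
  proof (rule m_eqI[OF x])
    fix z
    have "2 * m x (\<Gamma> x (r *\<^sub>R u) w) z = r * (2 * m x (\<Gamma> x u w) z)"
      unfolding koszul[OF x] by (simp add: dm algebra_simps)
    then show "m x (\<Gamma> x (r *\<^sub>R u) w) z = m x (r *\<^sub>R \<Gamma> x u w) z"
      by (simp add: m_lmul[OF x])
  qed
  show ?thesis
    unfolding bilinear_def
  proof (intro conjI allI linearI)
    fix u v w :: 'e and r :: real
    show "\<Gamma> x w (u + v) = \<Gamma> x w u + \<Gamma> x w v" by (simp only: \<Gamma>_sym[OF x, of w] add)
    show "\<Gamma> x w (r *\<^sub>R u) = r *\<^sub>R \<Gamma> x w u" by (simp only: \<Gamma>_sym[OF x, of w] mul)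
  qed (simp_all add: add mul)
qed

lemmas \<Gamma>_ladd = bilinear_ladd[OF \<Gamma>_bilinear] and \<Gamma>_radd = bilinear_radd[OF \<Gamma>_bilinear]
  and \<Gamma>_lmul = bilinear_lmul[OF \<Gamma>_bilinear] and \<Gamma>_rmul = bilinear_rmul[OF \<Gamma>_bilinear]
  and \<Gamma>_rneg = bilinear_rneg[OF \<Gamma>_bilinear]

text \<open>The Koszul formula determines the Christoffel symbols by a linear equation whose right-hand side is
  differentiable.\<close>

lemma \<Gamma>_differentiable: assumes x: "x \<in> D" shows "(\<lambda>y. \<Gamma> y u v) differentiable (at x)"
proof -
  let ?l = "\<lambda>y z. (dm y u v z + dm y v u z - dm y z u v) / 2"
  have "(\<lambda>y. ?l y z) differentiable (at x)" for z
    by (intro differentiable_divide differentiable_diff differentiable_add dm_differentiable x) simp_all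
  then have l: "((\<lambda>y. ?l y z) has_derivative (\<lambda>h. frechet_derivative (\<lambda>y. ?l y z) (at x) h)) (at x)" for z
    by (simp add: frechet_derivative_works)
  show ?thesis
    by (rule solution_has_derivative[where l="?l", OF open_D x bil pos[OF x] m_has_derivative[OF x] l])
       (use koszul in \<open>auto simp: differentiable_def field_simps\<close>)
qed

lemma metric_compatible:
  assumes x: "x \<in> D"
  shows "dm x h u v = m x (\<Gamma> x h u) v + m x u (\<Gamma> x h v)"
  using koszul[OF x, of h u v] koszul[OF x, of h v u] dm_sym[OF x, of h u v] dm_sym[OF x, of u h v]
    dm_sym[OF x, of v h u] sym[OF x, of u "\<Gamma> x h v"] by simp

lemma metric_field_derivative:
  assumes x: "x \<in> D" and Y: "(Y has_derivative Y') (at x)" and Z: "(Z has_derivative Z') (at x)"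
  shows "((\<lambda>y. m y (Y y) (Z y)) has_derivative
           (\<lambda>h. m x (Y' h + \<Gamma> x h (Y x)) (Z x) + m x (Y x) (Z' h + \<Gamma> x h (Z x)))) (at x)"
  using has_derivative_bilinear_family[OF open_D x bil m_has_derivative[OF x] Y Z]
  by (simp add: metric_compatible[OF x] m_ladd[OF x] m_radd[OF x] algebra_simps)

lemma continuous_on_metric:
  assumes "continuous_on S p" "p ` S \<subseteq> D" "continuous_on S Y" "continuous_on S Z"
  shows "continuous_on S (\<lambda>s. m (p s) (Y s) (Z s))"
proof (rule continuous_on_bilinear_family[where B="\<lambda>s. m (p s)"])
  show "continuous_on S (\<lambda>s. m (p s) u v)" for u v
    by (rule continuous_on_compose2[OF smooth_on_continuous[OF smooth_m] assms(1,2)])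
qed (use assms bil in auto)

lemma cauchy_schwarz:
  assumes x: "x \<in> D"
  shows "(m x u v)\<^sup>2 \<le> m x u u * m x v v"
proof (cases "v = 0")
  case True then show ?thesis by (simp add: m_rzero[OF x])
next
  case False
  define c where "c = m x v v"
  have c: "c > 0" using pos[OF x False] by (simp add: c_def)
  define w where "w = c *\<^sub>R u - m x u v *\<^sub>R v"
  have "0 \<le> m x w w" using pos[OF x, of w] m_lzero[OF x] by (cases "w = 0") auto
  also have "m x w w = c * (c * m x u u - (m x u v)\<^sup>2)"
    using sym[OF x, of v u] unfolding w_def
    by (simp add: m_lsub[OF x] m_rsub[OF x] m_lmul[OF x] m_rmul[OF x] c_def[symmetric] power2_eq_square algebra_simps)
  finally show ?thesis using c by (simp add: zero_le_mult_iff c_def mult.commute)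
qed

end

section \<open>Gradient and Hessian in coordinates\<close>

locale metric_domain_function = metric_domain m D
  for m :: "'e::euclidean_space coord_metric" and D :: "'e set" +
  fixes f :: "'e \<Rightarrow> real" and V :: "'e set"
  assumes open_V: "open V" and V_D: "V \<subseteq> D" and smooth_f: "smooth_on V f"
begin

abbreviation "X \<equiv> coord_gradient m f"
abbreviation "DX x \<equiv> frechet_derivative X (at x)"
abbreviation "A \<equiv> cov_deriv m X"
abbreviation "hess \<equiv> coord_hessian m f"

lemma in_D: "x \<in> V \<Longrightarrow> x \<in> D" using V_D by blast

lemma A_def: "A x u = DX x u + \<Gamma> x u (X x)"
  by (simp add: cov_deriv_def)

lemma hess_def: "hess x u v = m x (A x u) v"
  by (simp add: coord_hessian_def)

lemma gradient_inner:
  assumes x: "x \<in> V"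
  shows "m x (X x) v = frechet_derivative f (at x) v"
proof -
  have lin: "linear (frechet_derivative f (at x))"
    by (rule linear_frechet_derivative[OF smooth_on_differentiable[OF smooth_f x]])
  obtain w where w: "\<And>z. m x w z = frechet_derivative f (at x) z"
    by (rule positive_definite_represents[OF bil[OF in_D[OF x]] _ lin]) (auto intro: pos in_D x)
  have "\<exists>!w. \<forall>v. m x w v = frechet_derivative f (at x) v"
  proof (rule ex1I[of _ w])
    fix w' assume "\<forall>v. m x w' v = frechet_derivative f (at x) v"
    then have "m x w' z = m x w z" for z using w[of z] by metis
    then show "w' = w" by (rule m_eqI[OF in_D[OF x]])
  qed (simp add: w)
  from theI'[OF this] show ?thesis unfolding coord_gradient_def by blast
qed

lemma f_has_derivative: "x \<in> V \<Longrightarrow> (f has_derivative (\<lambda>v. m x (X x) v)) (at x)"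
  using smooth_on_has_derivative[OF smooth_f] by (simp add: gradient_inner)

lemma f_along_line:
  assumes x: "x \<in> V"
  shows "((\<lambda>s. f (x + s *\<^sub>R w)) has_real_derivative m x (X x) w) (at 0)"
proof -
  have "((\<lambda>s. x + s *\<^sub>R w) has_derivative (\<lambda>h. h *\<^sub>R w)) (at 0)" by (auto intro!: derivative_eq_intros)
  moreover have "(f has_derivative (\<lambda>v. m x (X x) v)) (at (x + 0 *\<^sub>R w))"
    using f_has_derivative[OF x] by simp
  ultimately have "(f \<circ> (\<lambda>s. x + s *\<^sub>R w) has_derivative (\<lambda>v. m x (X x) v) \<circ> (\<lambda>h. h *\<^sub>R w)) (at 0)"
    by (rule diff_chain_at)
  then have "((\<lambda>s. f (x + s *\<^sub>R w)) has_derivative (\<lambda>h. m x (X x) (h *\<^sub>R w))) (at 0)"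
    by (simp only: o_def)
  then show ?thesis
    by (rule has_derivative_imp_has_field_derivative) (simp add: m_rmul[OF in_D[OF x]])
qed

lemma second_derivative:
  "x \<in> V \<Longrightarrow> ((\<lambda>y. frechet_derivative f (at y) z) has_derivative
     frechet_derivative (\<lambda>y. frechet_derivative f (at y) z) (at x)) (at x)"
  by (rule smooth_on_has_derivative[OF smooth_on_frechet_derivative[OF smooth_f]])

lemma X_differentiable: assumes x: "x \<in> V" shows "X differentiable (at x)"
  by (rule solution_has_derivative[OF open_V x bil[OF in_D] pos[OF in_D[OF x]] m_has_derivative[OF in_D[OF x]]
        second_derivative[OF x] gradient_inner]) (auto simp: differentiable_def)

lemma X_has_derivative: "x \<in> V \<Longrightarrow> (X has_derivative DX x) (at x)"
  using X_differentiable by (simp add: frechet_derivative_works)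

lemma DX_linear: "x \<in> V \<Longrightarrow> linear (DX x)"
  by (rule linear_frechet_derivative[OF X_differentiable])

lemma DX_inner:
  assumes x: "x \<in> V"
  shows "m x (DX x u) z = frechet_derivative (\<lambda>y. frechet_derivative f (at y) z) (at x) u - dm x u (X x) z"
proof -
  have "((\<lambda>y. m y (X y) z) has_derivative (\<lambda>h. dm x h (X x) z + m x (DX x h) z + m x (X x) 0)) (at x)"
    by (rule has_derivative_bilinear_family[OF open_D in_D[OF x] bil m_has_derivative[OF in_D[OF x]]
          X_has_derivative[OF x] has_derivative_const])
  moreover have "((\<lambda>y. m y (X y) z) has_derivative frechet_derivative (\<lambda>y. frechet_derivative f (at y) z) (at x)) (at x)"
    by (rule has_derivative_transform_within_open[OF second_derivative[OF x] open_V x]) (simp add: gradient_inner)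
  ultimately have "(\<lambda>h. dm x h (X x) z + m x (DX x h) z + m x (X x) 0) = frechet_derivative (\<lambda>y. frechet_derivative f (at y) z) (at x)"
    by (rule has_derivative_unique)
  from fun_cong[OF this, of u] show ?thesis by (simp add: m_rzero[OF in_D[OF x]])
qed

lemma DX_differentiable: assumes x: "x \<in> V" shows "(\<lambda>y. DX y u) differentiable (at x)"
proof -
  let ?F = "\<lambda>y z. frechet_derivative (\<lambda>w. frechet_derivative f (at w) z) (at y) u"
  let ?l = "\<lambda>y z. ?F y z - dm y u (X y) z"
  have "(\<lambda>y. ?F y z) differentiable (at x)" for z
    by (rule smooth_on_differentiable[OF smooth_on_frechet_derivative[OF smooth_on_frechet_derivative[OF smooth_f]] x])
  moreover have "(\<lambda>y. dm y u (X y) z) differentiable (at x)" for z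
  proof -
    have d: "((\<lambda>y. dm y u w z) has_derivative (\<lambda>h. frechet_derivative (\<lambda>y. dm y u w z) (at x) h)) (at x)" for w
      using dm_differentiable[OF in_D[OF x]] by (simp add: frechet_derivative_works)
    have "linear (\<lambda>w. dm y u w z)" if "y \<in> D" for y using dm_bilinear[OF that] by (simp add: bilinear_def)
    from has_derivative_linear_family[where L="\<lambda>y w. dm y u w z", OF open_D in_D[OF x] this d X_has_derivative[OF x]]
    show ?thesis by (auto simp: differentiable_def)
  qed
  ultimately have "(\<lambda>y. ?l y z) differentiable (at x)" for z by (intro differentiable_diff)
  then have l: "((\<lambda>y. ?l y z) has_derivative (\<lambda>h. frechet_derivative (\<lambda>y. ?l y z) (at x) h)) (at x)" for z
    by (simp add: frechet_derivative_works)
  show ?thesis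
    by (rule solution_has_derivative[where l="?l", OF open_V x bil[OF in_D] pos[OF in_D[OF x]] m_has_derivative[OF in_D[OF x]] l])
       (auto simp: DX_inner differentiable_def)
qed

lemma X_continuous: "continuous_on V X"
  using X_differentiable by (intro differentiable_imp_continuous_on) (auto simp: differentiable_on_def differentiable_at_withinI)

text \<open>In coordinates the Hessian is the matrix of second derivatives plus a combination of first
  derivatives of the metric that is symmetric by the Koszul formula.\<close>

lemma hess_sym:
  assumes x: "x \<in> V"
  shows "hess x u v = hess x v u"
proof -
  have "frechet_derivative (\<lambda>y. frechet_derivative f (at y) u) (at x) v
      = frechet_derivative (\<lambda>y. frechet_derivative f (at y) v) (at x) u"
    by (rule second_derivative_symmetric[OF open_V x smooth_on_differentiable[OF smooth_f]
          second_derivative[OF x] second_derivative[OF x]])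
  moreover have "2 * hess x w z = 2 * frechet_derivative (\<lambda>y. frechet_derivative f (at y) z) (at x) w
     - dm x w (X x) z + dm x (X x) w z - dm x z w (X x)" for w z
    using koszul[OF in_D[OF x], of w "X x" z] DX_inner[OF x, of w z]
    by (simp add: hess_def A_def m_ladd[OF in_D[OF x]])
  from this[of u v] this[of v u] calculation show ?thesis
    using dm_sym[OF in_D[OF x], of _ "X x"] dm_sym[OF in_D[OF x], of _ u v] by simp
qed

text \<open>Half the Lie derivative of the metric along the gradient: this expression for the Hessian
  involves no Christoffel symbols, so that its invariance under coordinate changes is a matter
  of the chain rule.\<close>

lemma hess_lie:
  assumes x: "x \<in> V"
  shows "hess x u u = m x (DX x u) u + dm x (X x) u u / 2"
  using koszul[OF in_D[OF x], of u "X x" u] dm_sym[OF in_D[OF x], of u "X x" u]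
  by (simp add: hess_def A_def m_ladd[OF in_D[OF x]])

lemma A_linear: assumes x: "x \<in> V" shows "linear (A x)"
  using DX_linear[OF x]
  by (intro linearI) (simp_all add: A_def linear_add linear_cmul \<Gamma>_ladd[OF in_D[OF x]] \<Gamma>_lmul[OF in_D[OF x]] algebra_simps)

lemma hess_bilinear: assumes x: "x \<in> V" shows "bilinear (hess x)"
  using linear_add[OF A_linear[OF x]] linear_cmul[OF A_linear[OF x]]
  unfolding bilinear_def hess_def
  by (auto intro!: linearI simp: m_ladd[OF in_D[OF x]] m_lmul[OF in_D[OF x]] m_radd[OF in_D[OF x]] m_rmul[OF in_D[OF x]])

lemma \<Gamma>_has_derivative:
  "x \<in> D \<Longrightarrow> ((\<lambda>y. \<Gamma> y u v) has_derivative frechet_derivative (\<lambda>y. \<Gamma> y u v) (at x)) (at x)"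
  using \<Gamma>_differentiable by (simp add: frechet_derivative_works)

lemma \<Gamma>_X_has_derivative:
  assumes x: "x \<in> V"
  shows "((\<lambda>y. \<Gamma> y u (X y)) has_derivative
          (\<lambda>h. frechet_derivative (\<lambda>y. \<Gamma> y u (X x)) (at x) h + \<Gamma> x u (DX x h))) (at x)"
  by (rule has_derivative_linear_family[where L="\<lambda>y w. \<Gamma> y u w", OF open_D in_D[OF x] _ \<Gamma>_has_derivative[OF in_D[OF x]]
        X_has_derivative[OF x]]) (use \<Gamma>_bilinear in \<open>auto simp: bilinear_def\<close>)

lemma DX_has_derivative:
  "x \<in> V \<Longrightarrow> ((\<lambda>y. DX y u) has_derivative frechet_derivative (\<lambda>y. DX y u) (at x)) (at x)"
  using DX_differentiable by (simp add: frechet_derivative_works)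

lemma A_has_derivative:
  assumes x: "x \<in> V"
  shows "((\<lambda>y. A y u) has_derivative (\<lambda>h. frechet_derivative (\<lambda>y. DX y u) (at x) h +
           (frechet_derivative (\<lambda>y. \<Gamma> y u (X x)) (at x) h + \<Gamma> x u (DX x h)))) (at x)"
  unfolding A_def by (intro has_derivative_add DX_has_derivative \<Gamma>_X_has_derivative x)

lemma A_continuous: "continuous_on V (\<lambda>y. A y u)"
  using A_has_derivative
  by (intro differentiable_imp_continuous_on) (auto simp: differentiable_on_def differentiable_def intro: has_derivative_at_withinI)

lemma hess_continuous: "continuous_on V (\<lambda>y. hess y u v)"
  unfolding hess_def
  by (rule continuous_on_metric) (use V_D in \<open>auto intro: continuous_intros A_continuous\<close>)

text \<open>The form whose sign is to be controlled (\<open>E\<close> in the introduction): the Hessian minus \<open>\<omega>\<close> times the part of the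
  metric that is orthogonal to the gradient (when the gradient has length 1).\<close>

definition excess :: "real \<Rightarrow> 'e \<Rightarrow> 'e \<Rightarrow> 'e \<Rightarrow> real" where
  "excess \<omega> x u v = hess x u v - \<omega> * (m x u v - m x (X x) u * m x (X x) v)"

lemma excess_bilinear: assumes x: "x \<in> V" shows "bilinear (excess \<omega> x)"
  using bilinear_ladd[OF hess_bilinear[OF x]] bilinear_radd[OF hess_bilinear[OF x]]
    bilinear_lmul[OF hess_bilinear[OF x]] bilinear_rmul[OF hess_bilinear[OF x]]
  unfolding bilinear_def excess_def
  by (auto intro!: linearI simp: m_ladd[OF in_D[OF x]] m_lmul[OF in_D[OF x]] m_radd[OF in_D[OF x]]
       m_rmul[OF in_D[OF x]] algebra_simps)

lemma excess_sym: "x \<in> V \<Longrightarrow> excess \<omega> x u v = excess \<omega> x v u"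
  unfolding excess_def using hess_sym[of x u v] sym[OF in_D, of x u v] by simp

end

section \<open>The Riccati equation\<close>

text \<open>In the application \<open>W\<close> is the part of \<open>V\<close> where the signed distance is positive; an integral
  curve starts at a point of \<open>V\<close> on the hypersurface, which is only a limit of points of \<open>W\<close>.\<close>

locale unit_gradient = metric_domain_function m D f V
  for m :: "'e::euclidean_space coord_metric" and D f V +
  fixes W :: "'e set"
  assumes open_W: "open W" and W_V: "W \<subseteq> V" and unit: "\<And>x. x \<in> W \<Longrightarrow> m x (X x) (X x) = 1"
begin

lemma in_V: "x \<in> W \<Longrightarrow> x \<in> V" using W_V by blast
lemma in_D': "x \<in> W \<Longrightarrow> x \<in> D" using W_V V_D by blast

text \<open>Differentiation of \<open>\<langle>X,X\<rangle> = 1\<close>.\<close>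

lemma hess_gradient_zero:
  assumes x: "x \<in> W"
  shows "hess x u (X x) = 0"
proof -
  have "((\<lambda>y. m y (X y) (X y)) has_derivative
          (\<lambda>h. m x (DX x h + \<Gamma> x h (X x)) (X x) + m x (X x) (DX x h + \<Gamma> x h (X x)))) (at x)"
    by (rule metric_field_derivative[OF in_D'[OF x] X_has_derivative[OF in_V[OF x]] X_has_derivative[OF in_V[OF x]]])
  moreover have "((\<lambda>y. m y (X y) (X y)) has_derivative (\<lambda>h. 0)) (at x)"
    by (rule has_derivative_transform_within_open[OF has_derivative_const[of 1] open_W x]) (simp add: unit)
  ultimately have "(\<lambda>h. m x (DX x h + \<Gamma> x h (X x)) (X x) + m x (X x) (DX x h + \<Gamma> x h (X x))) = (\<lambda>h. 0)"
    by (rule has_derivative_unique)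
  from fun_cong[OF this, of u] show ?thesis
    unfolding hess_def A_def sym[OF in_D'[OF x], of "X x" "DX x u + \<Gamma> x u (X x)"] by simp
qed

lemma gradient_geodesic: assumes x: "x \<in> W" shows "A x (X x) = 0"
proof (rule m_eqI[OF in_D'[OF x]])
  fix z
  show "m x (A x (X x)) z = m x 0 z"
    using hess_gradient_zero[OF x, of z] hess_sym[OF in_V[OF x], of z "X x"]
    unfolding hess_def by (simp add: m_lzero[OF in_D'[OF x]])
qed

text \<open>The curvature term arises from commuting the derivatives in the directions \<open>X\<close> and \<open>u\<close>: in the
  direction \<open>u\<close> one may differentiate the identity \<open>\<nabla>\<^sub>X X = 0\<close>, and the second derivatives of
  \<open>X\<close> are symmetric. For the constant field \<open>u\<close> the bracket \<open>[X,u]\<close> is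
  \<open>- DX u\<close>, which accounts for the term \<open>A (DX u)\<close>.\<close>

lemma riccati:
  assumes x: "x \<in> W"
  shows "cov_deriv m (\<lambda>y. A y u) x (X x) = - A x (DX x u) - coord_curvature m x u (X x) (X x)"
proof -
  let ?T = "X x"
  let ?D2 = "\<lambda>h w. frechet_derivative (\<lambda>y. DX y w) (at x) h"
  let ?G = "\<lambda>h v w. frechet_derivative (\<lambda>y. \<Gamma> y v w) (at x) h"
  note xV = in_V[OF x] and xD = in_D'[OF x]
  \<comment> \<open>The gradient field is geodesic, and this holds on an open set.\<close>
  have "((\<lambda>y. DX y (X y)) has_derivative (\<lambda>h. ?D2 h ?T + DX x (DX x h))) (at x)"
    by (rule has_derivative_linear_family[where L="DX", OF open_V xV DX_linear DX_has_derivative[OF xV] X_has_derivative[OF xV]])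
  moreover have "((\<lambda>y. \<Gamma> y (X y) (X y)) has_derivative (\<lambda>h. ?G h ?T ?T + \<Gamma> x (DX x h) ?T + \<Gamma> x ?T (DX x h))) (at x)"
    by (rule has_derivative_bilinear_family[where B=\<Gamma>, OF open_D xD \<Gamma>_bilinear \<Gamma>_has_derivative[OF xD]
          X_has_derivative[OF xV] X_has_derivative[OF xV]])
  ultimately have "((\<lambda>y. A y (X y)) has_derivative
      (\<lambda>h. ?D2 h ?T + DX x (DX x h) + (?G h ?T ?T + \<Gamma> x (DX x h) ?T + \<Gamma> x ?T (DX x h)))) (at x)"
    unfolding A_def by (rule has_derivative_add)
  moreover have "((\<lambda>y. A y (X y)) has_derivative (\<lambda>h. 0)) (at x)"
    by (rule has_derivative_transform_within_open[OF has_derivative_const[of 0] open_W x]) (simp add: gradient_geodesic)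
  ultimately have "(\<lambda>h. ?D2 h ?T + DX x (DX x h) + (?G h ?T ?T + \<Gamma> x (DX x h) ?T + \<Gamma> x ?T (DX x h))) = (\<lambda>h. 0)"
    by (rule has_derivative_unique)
  from fun_cong[OF this, of u]
  have geo: "?D2 u ?T = - DX x (DX x u) - ?G u ?T ?T - \<Gamma> x (DX x u) ?T - \<Gamma> x ?T (DX x u)"
    by (simp add: algebra_simps eq_neg_iff_add_eq_0)
  have DT: "DX x ?T = - \<Gamma> x ?T ?T" using gradient_geodesic[OF x] by (simp add: A_def add_eq_0_iff2)
  have D2: "?D2 ?T u = ?D2 u ?T"
    by (rule second_derivative_symmetric[OF open_V xV X_differentiable DX_has_derivative[OF xV] DX_has_derivative[OF xV]])
  have "frechet_derivative (\<lambda>y. A y u) (at x) ?T = ?D2 ?T u + (?G ?T u ?T + \<Gamma> x u (DX x ?T))"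
    using fun_cong[OF frechet_derivative_at[OF A_has_derivative[OF xV, of u]], of ?T] by simp
  then have "cov_deriv m (\<lambda>y. A y u) x ?T
      = ?D2 ?T u + (?G ?T u ?T + \<Gamma> x u (DX x ?T)) + \<Gamma> x ?T (DX x u + \<Gamma> x u ?T)"
    by (simp add: cov_deriv_def)
  also have "\<dots> = - A x (DX x u) - coord_curvature m x u ?T ?T"
    unfolding D2 geo DT coord_curvature_def cov_deriv_def
    by (simp add: \<Gamma>_radd[OF xD] \<Gamma>_rneg[OF xD] algebra_simps)
  finally show ?thesis .
qed

lemma curvature_linear: assumes x: "x \<in> D" shows "linear (\<lambda>u. coord_curvature m x u w w)"
proof -
  have 1: "frechet_derivative (\<lambda>y. \<Gamma> y (u + v) w) (at x) h
      = frechet_derivative (\<lambda>y. \<Gamma> y u w) (at x) h + frechet_derivative (\<lambda>y. \<Gamma> y v w) (at x) h" for u v h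
  proof -
    have "((\<lambda>y. \<Gamma> y (u + v) w) has_derivative
        (\<lambda>h. frechet_derivative (\<lambda>y. \<Gamma> y u w) (at x) h + frechet_derivative (\<lambda>y. \<Gamma> y v w) (at x) h)) (at x)"
      by (rule has_derivative_transform_within_open[OF
            has_derivative_add[OF \<Gamma>_has_derivative[OF x] \<Gamma>_has_derivative[OF x]] open_D x]) (simp add: \<Gamma>_ladd)
    from fun_cong[OF frechet_derivative_at[OF this], of h] show ?thesis by simp
  qed
  have 2: "frechet_derivative (\<lambda>y. \<Gamma> y (r *\<^sub>R u) w) (at x) h = r *\<^sub>R frechet_derivative (\<lambda>y. \<Gamma> y u w) (at x) h" for r u h
  proof -
    have "((\<lambda>y. \<Gamma> y (r *\<^sub>R u) w) has_derivative (\<lambda>h. r *\<^sub>R frechet_derivative (\<lambda>y. \<Gamma> y u w) (at x) h)) (at x)"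
      by (rule has_derivative_transform_within_open[OF
            has_derivative_scaleR_right[OF \<Gamma>_has_derivative[OF x]] open_D x]) (simp add: \<Gamma>_lmul)
    from fun_cong[OF frechet_derivative_at[OF this], of h] show ?thesis by simp
  qed
  have 3: "linear (frechet_derivative (\<lambda>y. \<Gamma> y w w) (at x))"
    by (rule linear_frechet_derivative[OF \<Gamma>_differentiable[OF x]])
  show ?thesis
    unfolding coord_curvature_def cov_deriv_def
    by (intro linearI) (simp_all add: 1 2 linear_add[OF 3] linear_cmul[OF 3] \<Gamma>_ladd[OF x] \<Gamma>_radd[OF x] \<Gamma>_lmul[OF x] \<Gamma>_rmul[OF x] algebra_simps)
qed

text \<open>This is part of the antisymmetry of the curvature tensor; for the gradient field it can be read off
  from the Riccati equation, as \<open>A\<close> takes values orthogonal to \<open>X\<close>.\<close>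

lemma curvature_orthogonal:
  assumes x: "x \<in> W"
  shows "m x (coord_curvature m x u (X x) (X x)) (X x) = 0"
proof -
  note xV = in_V[OF x] and xD = in_D'[OF x]
  let ?A' = "\<lambda>h. frechet_derivative (\<lambda>y. DX y u) (at x) h +
           (frechet_derivative (\<lambda>y. \<Gamma> y u (X x)) (at x) h + \<Gamma> x u (DX x h))"
  have "((\<lambda>y. m y (A y u) (X y)) has_derivative
      (\<lambda>h. m x (?A' h + \<Gamma> x h (A x u)) (X x) + m x (A x u) (DX x h + \<Gamma> x h (X x)))) (at x)"
    by (rule metric_field_derivative[OF xD A_has_derivative[OF xV] X_has_derivative[OF xV]])
  moreover have "((\<lambda>y. m y (A y u) (X y)) has_derivative (\<lambda>h. 0)) (at x)"
    by (rule has_derivative_transform_within_open[OF has_derivative_const[of 0] open_W x])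
       (use hess_gradient_zero in \<open>simp add: hess_def\<close>)
  ultimately have "(\<lambda>h. m x (?A' h + \<Gamma> x h (A x u)) (X x) + m x (A x u) (DX x h + \<Gamma> x h (X x))) = (\<lambda>h. 0)"
    by (rule has_derivative_unique)
  from fun_cong[OF this, of "X x"] have "m x (cov_deriv m (\<lambda>y. A y u) x (X x)) (X x) = 0"
    using frechet_derivative_at[OF A_has_derivative[OF xV, of u], symmetric] gradient_geodesic[OF x]
    by (simp add: cov_deriv_def m_rzero[OF xD])
  then show ?thesis
    using riccati[OF x, of u] hess_gradient_zero[OF x, of "DX x u"] by (simp add: hess_def m_lsub[OF xD] m_lneg[OF xD])
qed

text \<open>A bound for the sectional curvatures of the planes containing the gradient is a bound for the
  whole quadratic form \<open>\<langle>R(u,X)X,u\<rangle>\<close>, because the component of \<open>u\<close> along the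
  gradient does not contribute.\<close>

lemma sectional_bound:
  assumes x: "x \<in> W"
    and K: "\<And>v. m x v v = 1 \<Longrightarrow> m x v (X x) = 0 \<Longrightarrow> 0 \<le> \<sigma> * (coord_sectional m x v (X x) + g)"
  shows "0 \<le> \<sigma> * (m x (coord_curvature m x u (X x) (X x)) u + g * (m x u u - (m x (X x) u)\<^sup>2))"
proof -
  note xD = in_D'[OF x]
  define \<alpha> where "\<alpha> = m x (X x) u"
  define n where "n = u - \<alpha> *\<^sub>R X x"
  have u: "u = n + \<alpha> *\<^sub>R X x" by (simp add: n_def)
  let ?R = "\<lambda>u. coord_curvature m x u (X x) (X x)"
  note linR = curvature_linear[OF xD, of "X x"]
  have "?R (X x) = 0" by (simp add: coord_curvature_def)
  then have "?R u = ?R n" unfolding u using linear_add[OF linR] linear_cmul[OF linR] by simp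
  then have Ru: "m x (?R u) u = m x (?R n) n"
    using curvature_orthogonal[OF x, of n] by (subst (2) u) (simp add: m_radd[OF xD] m_rmul[OF xD])
  have nX: "m x n (X x) = 0"
    using unit[OF x] sym[OF xD, of u "X x"] by (simp add: n_def \<alpha>_def m_lsub[OF xD] m_lmul[OF xD])
  have mn: "m x n n = m x u u - (m x (X x) u)\<^sup>2"
    using unit[OF x] sym[OF xD, of u "X x"]
    by (simp add: n_def m_lsub[OF xD] m_rsub[OF xD] m_lmul[OF xD] m_rmul[OF xD] \<alpha>_def power2_eq_square)
  have "0 \<le> \<sigma> * (m x (?R n) n + g * m x n n)"
  proof (cases "n = 0")
    case True then show ?thesis by (simp add: m_rzero[OF xD])
  next
    case False
    define c where "c = sqrt (m x n n)"
    have c: "c > 0" "c\<^sup>2 = m x n n" using pos[OF xD False] by (auto simp: c_def)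
    define v where "v = n /\<^sub>R c"
    have n: "n = c *\<^sub>R v" using c by (simp add: v_def)
    have v1: "m x v v = 1"
    proof -
      have "m x v v = m x n n / c\<^sup>2"
        by (simp add: v_def m_lmul[OF xD] m_rmul[OF xD] power2_eq_square divide_inverse)
      then show ?thesis using c pos[OF xD False] by simp
    qed
    have vX: "m x v (X x) = 0" using nX by (simp add: v_def m_lmul[OF xD])
    have "coord_sectional m x v (X x) = m x (?R v) v"
      using v1 vX unit[OF x] by (simp add: coord_sectional_def)
    then have "0 \<le> \<sigma> * (m x (?R v) v + g)" using K[OF v1 vX] by simp
    then have "0 \<le> c\<^sup>2 * (\<sigma> * (m x (?R v) v + g))" by simp
    also have "\<dots> = \<sigma> * (m x (?R n) n + g * m x n n)"
      unfolding c(2)[symmetric] unfolding n linear_cmul[OF linR]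
      by (simp add: m_lmul[OF xD] m_rmul[OF xD] power2_eq_square algebra_simps)
    finally show ?thesis .
  qed
  then show ?thesis unfolding Ru mn .
qed

text \<open>The form \<open>excess\<close> satisfies a linear differential equation along integral curves of the gradient, with a
  source term whose sign is that of the curvature condition: factoring \<open>A\<^sup>2 - \<omega>\<^sup>2\<close> absorbs the
  quadratic terms of the two Riccati equations.\<close>

lemma excess_derivative:
  assumes x: "c \<tau> \<in> W" and c: "(c has_vector_derivative X (c \<tau>)) (at \<tau>)"
    and \<omega>: "(\<omega> has_real_derivative g - (\<omega> \<tau>)\<^sup>2) (at \<tau>)"
  shows "((\<lambda>\<tau>. excess (\<omega> \<tau>) (c \<tau>) u u) has_real_derivative
     2 * excess (\<omega> \<tau>) (c \<tau>) (\<Gamma> (c \<tau>) (X (c \<tau>)) u - (1/2) *\<^sub>R (A (c \<tau>) u + \<omega> \<tau> *\<^sub>R u)) u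
     - (m (c \<tau>) (coord_curvature m (c \<tau>) u (X (c \<tau>)) (X (c \<tau>))) u
        + g * (m (c \<tau>) u u - (m (c \<tau>) (X (c \<tau>)) u)\<^sup>2))) (at \<tau>)"
proof -
  define x where "x = c \<tau>"
  define T where "T = X x"
  have xW: "x \<in> W" using x by (simp add: x_def)
  note xV = in_V[OF xW] and xD = in_D'[OF xW]
  let ?R = "coord_curvature m x u T T"
  have along: "((\<lambda>\<tau>. F (c \<tau>)) has_real_derivative F' T) (at \<tau>)"
    if "(F has_derivative F') (at x)" for F :: "'e \<Rightarrow> real" and F'
  proof -
    have "(c has_derivative (\<lambda>h. h *\<^sub>R T)) (at \<tau>)" using c by (simp add: has_vector_derivative_def T_def x_def)
    from diff_chain_at[OF this that[unfolded x_def]]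
    have "((\<lambda>\<tau>. F (c \<tau>)) has_derivative (\<lambda>h. F' (h *\<^sub>R T))) (at \<tau>)" by (simp add: o_def)
    moreover have "F' (h *\<^sub>R T) = F' T * h" for h
      using linear_cmul[OF bounded_linear.linear[OF has_derivative_bounded_linear[OF that]]] by simp
    ultimately show ?thesis by (simp add: has_field_derivative_def)
  qed
  let ?A' = "\<lambda>h. frechet_derivative (\<lambda>y. DX y u) (at x) h +
           (frechet_derivative (\<lambda>y. \<Gamma> y u (X x)) (at x) h + \<Gamma> x u (DX x h))"
  have "((\<lambda>y. m y (A y u) u) has_derivative
      (\<lambda>h. m x (?A' h + \<Gamma> x h (A x u)) u + m x (A x u) (0 + \<Gamma> x h u))) (at x)"
    by (rule metric_field_derivative[OF xD A_has_derivative[OF xV] has_derivative_const])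
  from along[OF this]
  have H: "((\<lambda>\<tau>. hess (c \<tau>) u u) has_real_derivative m x (?A' T + \<Gamma> x T (A x u)) u + m x (A x u) (\<Gamma> x T u)) (at \<tau>)"
    by (simp add: hess_def)
  have R: "?A' T + \<Gamma> x T (A x u) = - A x (DX x u) - ?R"
    using riccati[OF xW, of u] fun_cong[OF frechet_derivative_at[OF A_has_derivative[OF xV, of u]], of T]
    by (simp add: cov_deriv_def[of m "\<lambda>y. A y u"] T_def)
  have "DX x u = A x u - \<Gamma> x T u" by (simp add: A_def T_def \<Gamma>_sym[OF xD, of u])
  then have A2: "A x (DX x u) = A x (A x u) - A x (\<Gamma> x T u)" by (simp only: linear_diff[OF A_linear[OF xV]])
  have "m x (?A' T + \<Gamma> x T (A x u)) u + m x (A x u) (\<Gamma> x T u)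
      = - hess x (A x u) u + 2 * hess x (\<Gamma> x T u) u - m x ?R u"
    unfolding R A2 using hess_sym[OF xV, of u "\<Gamma> x T u"]
    by (simp add: hess_def m_lsub[OF xD] m_lneg[OF xD])
  with H have 1: "((\<lambda>\<tau>. hess (c \<tau>) u u) has_real_derivative
      - hess x (A x u) u + 2 * hess x (\<Gamma> x T u) u - m x ?R u) (at \<tau>)" by (simp only:)
  have "((\<lambda>y. m y u u) has_derivative (\<lambda>h. m x (0 + \<Gamma> x h u) u + m x u (0 + \<Gamma> x h u))) (at x)"
    by (rule metric_field_derivative[OF xD has_derivative_const has_derivative_const])
  from along[OF this] have 2: "((\<lambda>\<tau>. m (c \<tau>) u u) has_real_derivative 2 * m x (\<Gamma> x T u) u) (at \<tau>)"
    using sym[OF xD, of u "\<Gamma> x T u"] by simp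
  have "((\<lambda>y. m y (X y) u) has_derivative (\<lambda>h. m x (DX x h + \<Gamma> x h (X x)) u + m x (X x) (0 + \<Gamma> x h u))) (at x)"
    by (rule metric_field_derivative[OF xD X_has_derivative[OF xV] has_derivative_const])
  from along[OF this] have 3: "((\<lambda>\<tau>. m (c \<tau>) (X (c \<tau>)) u) has_real_derivative m x T (\<Gamma> x T u)) (at \<tau>)"
    using gradient_geodesic[OF xW] by (simp add: A_def T_def m_lzero[OF xD])
  define a where "a = hess x (A x u) u"
  define b where "b = hess x (\<Gamma> x T u) u"
  have excess_exp: "excess (\<omega> \<tau>) x (\<Gamma> x T u - (1/2) *\<^sub>R (A x u + \<omega> \<tau> *\<^sub>R u)) u
      = b - \<omega> \<tau> * (m x (\<Gamma> x T u) u - m x T (\<Gamma> x T u) * m x T u)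
        - (a - (\<omega> \<tau>)\<^sup>2 * (m x u u - (m x T u)\<^sup>2)) / 2"
  proof -
    have "m x T (A x u) = 0" using hess_gradient_zero[OF xW, of u] sym[OF xD, of T] by (simp add: hess_def T_def)
    then show ?thesis
      unfolding excess_def T_def[symmetric] a_def b_def
      by (simp add: bilinear_lsub[OF hess_bilinear[OF xV]] bilinear_ladd[OF hess_bilinear[OF xV]] bilinear_lmul[OF hess_bilinear[OF xV]]
        m_lsub[OF xD] m_ladd[OF xD] m_lmul[OF xD] m_rsub[OF xD] m_radd[OF xD] m_rmul[OF xD] hess_def[of x u u]
        power2_eq_square field_simps)
  qed
  show ?thesis
    unfolding excess_exp[unfolded x_def T_def[unfolded x_def]]
    unfolding excess_def
    by (rule derivative_eq_intros 1 2 3 \<omega> | simp)+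
       (simp add: a_def b_def x_def T_def power2_eq_square field_simps)
qed

lemma comparison_along_integral_curve:
  assumes st: "s \<le> t" and cV: "c ` {s..t} \<subseteq> V" and cont: "continuous_on {s..t} c" "continuous_on {s..t} \<omega>"
    and cW: "\<And>\<tau>. \<tau> \<in> {s<..t} \<Longrightarrow> c \<tau> \<in> W"
    and c': "\<And>\<tau>. \<tau> \<in> {s<..t} \<Longrightarrow> (c has_vector_derivative X (c \<tau>)) (at \<tau>)"
    and \<omega>': "\<And>\<tau>. \<tau> \<in> {s<..t} \<Longrightarrow> (\<omega> has_real_derivative g \<tau> - (\<omega> \<tau>)\<^sup>2) (at \<tau>)"
    and K: "\<And>\<tau> v. \<tau> \<in> {s<..t} \<Longrightarrow> m (c \<tau>) v v = 1 \<Longrightarrow> m (c \<tau>) v (X (c \<tau>)) = 0 \<Longrightarrow>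
        0 \<le> \<sigma> * (coord_sectional m (c \<tau>) v (X (c \<tau>)) + g \<tau>)"
    and init: "\<And>u. \<sigma> * excess (\<omega> s) (c s) u u \<le> 0"
  shows "\<sigma> * excess (\<omega> t) (c t) u u \<le> 0"
proof -
  define L where "L \<tau> u = \<Gamma> (c \<tau>) (X (c \<tau>)) u - (1/2) *\<^sub>R (A (c \<tau>) u + \<omega> \<tau> *\<^sub>R u)" for \<tau> u
  have V: "c \<tau> \<in> V" if "\<tau> \<in> {s..t}" for \<tau> using cV that by blast
  note D = in_D[OF V]
  have cX: "continuous_on {s..t} (\<lambda>\<tau>. X (c \<tau>))"
    by (rule continuous_on_compose2[OF X_continuous cont(1) cV])
  have \<Gamma>c: "continuous_on {s..t} (\<lambda>\<tau>. \<Gamma> (c \<tau>) u v)" for u v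
  proof (rule continuous_on_compose2[OF _ cont(1)])
    show "continuous_on D (\<lambda>y. \<Gamma> y u v)" using \<Gamma>_differentiable
      by (intro differentiable_imp_continuous_on) (auto simp: differentiable_on_def differentiable_at_withinI)
  qed (use cV V_D in auto)
  have "linear (L \<tau>)" if "\<tau> \<in> {s..t}" for \<tau>
    unfolding L_def
    using linear_add[OF A_linear[OF V[OF that]]] linear_cmul[OF A_linear[OF V[OF that]]]
    by (intro linearI) (simp_all add: \<Gamma>_radd[OF D[OF that]] \<Gamma>_rmul[OF D[OF that]] algebra_simps)
  moreover have "continuous_on {s..t} (\<lambda>\<tau>. L \<tau> u)" for u
  proof -
    have 1: "continuous_on {s..t} (\<lambda>\<tau>. A (c \<tau>) u)"
      by (rule continuous_on_compose2[OF A_continuous cont(1) cV])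
    have 2: "continuous_on {s..t} (\<lambda>\<tau>. \<Gamma> (c \<tau>) (X (c \<tau>)) u)"
      by (rule continuous_on_linear_family[where L="\<lambda>\<tau> w. \<Gamma> (c \<tau>) w u", OF _ \<Gamma>c cX])
         (use \<Gamma>_bilinear[OF D] in \<open>simp add: bilinear_def\<close>)
    show ?thesis unfolding L_def by (intro continuous_intros cont 1 2)
  qed
  ultimately obtain C where C: "\<And>\<tau> u. \<tau> \<in> {s..t} \<Longrightarrow> norm (L \<tau> u) \<le> C * norm u"
    using linear_family_bound[OF compact_Icc, of s t L] by metis
  have "(\<lambda>u v. \<sigma> * excess (\<omega> t) (c t) u v) u u \<le> 0"
  proof (rule quadratic_form_comparison[where Q="\<lambda>\<tau> u v. \<sigma> * excess (\<omega> \<tau>) (c \<tau>) u v" and L=L and C=C, OF st])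
    fix \<tau> assume \<tau>: "\<tau> \<in> {s..t}"
    show "bilinear (\<lambda>u v. \<sigma> * excess (\<omega> \<tau>) (c \<tau>) u v)"
      unfolding bilinear_def
      by (intro conjI allI linearI) (simp_all add: bilinear_ladd[OF excess_bilinear[OF V[OF \<tau>]]] bilinear_radd[OF excess_bilinear[OF V[OF \<tau>]]]
          bilinear_lmul[OF excess_bilinear[OF V[OF \<tau>]]] bilinear_rmul[OF excess_bilinear[OF V[OF \<tau>]]] algebra_simps)
    show "\<sigma> * excess (\<omega> \<tau>) (c \<tau>) u v = \<sigma> * excess (\<omega> \<tau>) (c \<tau>) v u" for u v
      using excess_sym[OF V[OF \<tau>]] by simp
  next
    fix u v
    show "continuous_on {s..t} (\<lambda>\<tau>. \<sigma> * excess (\<omega> \<tau>) (c \<tau>) u v)"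
    proof -
      have cD: "c ` {s..t} \<subseteq> D" using cV V_D by blast
      have 1: "continuous_on {s..t} (\<lambda>\<tau>. hess (c \<tau>) u v)"
        by (rule continuous_on_compose2[OF hess_continuous cont(1) cV])
      have 2: "continuous_on {s..t} (\<lambda>\<tau>. m (c \<tau>) u v)"
        by (rule continuous_on_metric[OF cont(1) cD continuous_on_const continuous_on_const])
      have 3: "continuous_on {s..t} (\<lambda>\<tau>. m (c \<tau>) (X (c \<tau>)) w)" for w
        by (rule continuous_on_metric[OF cont(1) cD cX continuous_on_const])
      show ?thesis unfolding excess_def by (intro continuous_intros cont 1 2 3)
    qed
  next
    fix \<tau> v assume \<tau>: "\<tau> \<in> {s<..t}"
    let ?r = "m (c \<tau>) (coord_curvature m (c \<tau>) v (X (c \<tau>)) (X (c \<tau>))) v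
        + g \<tau> * (m (c \<tau>) v v - (m (c \<tau>) (X (c \<tau>)) v)\<^sup>2)"
    have "((\<lambda>\<tau>. \<sigma> * excess (\<omega> \<tau>) (c \<tau>) v v) has_real_derivative \<sigma> * (2 * excess (\<omega> \<tau>) (c \<tau>) (L \<tau> v) v - ?r)) (at \<tau>)"
      unfolding L_def by (intro DERIV_cmult excess_derivative cW[OF \<tau>] c'[OF \<tau>] \<omega>'[OF \<tau>])
    moreover have "0 \<le> \<sigma> * ?r" by (rule sectional_bound[OF cW[OF \<tau>] K[OF \<tau>]])
    ultimately show "\<exists>D. ((\<lambda>\<tau>. \<sigma> * excess (\<omega> \<tau>) (c \<tau>) v v) has_real_derivative D) (at \<tau>)
        \<and> D \<le> 2 * (\<sigma> * excess (\<omega> \<tau>) (c \<tau>) (L \<tau> v) v)"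
      by (intro exI conjI) (assumption, simp add: algebra_simps)
  qed (use C init in auto)
  then show ?thesis .
qed

end

section \<open>Invariance under coordinate changes\<close>

locale coordinate_change =
  one: metric_domain_function m1 D1 f1 V1 + two: metric_domain_function m2 D2 f2 V2
  for m1 :: "'e::euclidean_space coord_metric" and D1 f1 V1 and m2 :: "'e coord_metric" and D2 f2 V2 +
  fixes \<phi> :: "'e \<Rightarrow> 'e" and Q :: "'e set"
  assumes open_Q: "open Q" and Q_V1: "Q \<subseteq> V1" and \<phi>_V2: "\<phi> ` Q \<subseteq> V2" and smooth_\<phi>: "smooth_on Q \<phi>"
    and f_eq: "\<And>y. y \<in> Q \<Longrightarrow> f1 y = f2 (\<phi> y)"
    and m_eq: "\<And>y u v. y \<in> Q \<Longrightarrow>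
        m1 y u v = m2 (\<phi> y) (frechet_derivative \<phi> (at y) u) (frechet_derivative \<phi> (at y) v)"
    and surj: "\<And>y. y \<in> Q \<Longrightarrow> surj (frechet_derivative \<phi> (at y))"
begin

abbreviation "D\<phi> y \<equiv> frechet_derivative \<phi> (at y)"

lemma \<phi>_has_derivative: "y \<in> Q \<Longrightarrow> (\<phi> has_derivative D\<phi> y) (at y)"
  by (rule smooth_on_has_derivative[OF smooth_\<phi>])

lemma D\<phi>_linear: "y \<in> Q \<Longrightarrow> linear (D\<phi> y)"
  by (rule linear_frechet_derivative[OF smooth_on_differentiable[OF smooth_\<phi>]])

lemma D\<phi>_has_derivative: "y \<in> Q \<Longrightarrow> ((\<lambda>y. D\<phi> y u) has_derivative frechet_derivative (\<lambda>y. D\<phi> y u) (at y)) (at y)"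
  by (rule smooth_on_has_derivative[OF smooth_on_frechet_derivative[OF smooth_\<phi>]])

text \<open>A vector is determined by its inner products, and all vectors at the image point come from the first
  chart.\<close>

lemma gradient_eq:
  assumes y: "y \<in> Q"
  shows "two.X (\<phi> y) = D\<phi> y (one.X y)"
proof (rule two.m_eqI)
  have y1: "y \<in> V1" and y2: "\<phi> y \<in> V2" using y Q_V1 \<phi>_V2 by auto
  show "\<phi> y \<in> D2" using two.in_D[OF y2] .
  fix z
  obtain v where z: "z = D\<phi> y v" using surj[OF y] by (metis surjD)
  have "(f2 has_derivative (\<lambda>v. m2 (\<phi> y) (two.X (\<phi> y)) v)) (at (\<phi> y))" by (rule two.f_has_derivative[OF y2])
  from diff_chain_at[OF \<phi>_has_derivative[OF y] this]
  have "((\<lambda>y. f2 (\<phi> y)) has_derivative (\<lambda>v. m2 (\<phi> y) (two.X (\<phi> y)) (D\<phi> y v))) (at y)" by (simp add: o_def)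
  then have "(f1 has_derivative (\<lambda>v. m2 (\<phi> y) (two.X (\<phi> y)) (D\<phi> y v))) (at y)"
    by (rule has_derivative_transform_within_open[OF _ open_Q y]) (simp add: f_eq)
  from fun_cong[OF has_derivative_unique[OF this one.f_has_derivative[OF y1]], of v]
  show "m2 (\<phi> y) (two.X (\<phi> y)) z = m2 (\<phi> y) (D\<phi> y (one.X y)) z"
    by (simp add: z m_eq[OF y])
qed

text \<open>The second derivative of the transition map enters twice, once from the metric and once from the
  gradient field; by its symmetry the two contributions cancel.\<close>

lemma hess_eq:
  assumes x: "x \<in> Q"
  shows "one.hess x u u = two.hess (\<phi> x) (D\<phi> x u) (D\<phi> x u)"
proof -
  have x1: "x \<in> V1" and x2: "\<phi> x \<in> V2" using x Q_V1 \<phi>_V2 by auto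
  have x2': "\<phi> x \<in> D2" using two.in_D[OF x2] .
  let ?T = "one.X x" and ?u = "D\<phi> x u"
  let ?H = "\<lambda>h u. frechet_derivative (\<lambda>y. D\<phi> y u) (at x) h"
  have H: "?H ?T u = ?H u ?T"
    by (rule second_derivative_symmetric[OF open_Q x smooth_on_differentiable[OF smooth_\<phi>]
          D\<phi>_has_derivative[OF x] D\<phi>_has_derivative[OF x]])
  have "\<And>a b. ((\<lambda>y. m2 (\<phi> y) a b) has_derivative (\<lambda>h. two.dm (\<phi> x) (D\<phi> x h) a b)) (at x)"
    using diff_chain_at[OF \<phi>_has_derivative[OF x] two.m_has_derivative[OF x2']] by (simp add: o_def)
  moreover have "bilinear (m2 (\<phi> y))" if "y \<in> Q" for y using that \<phi>_V2 two.in_D two.bil by blast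
  ultimately have "((\<lambda>y. m2 (\<phi> y) (D\<phi> y u) (D\<phi> y u)) has_derivative
      (\<lambda>h. two.dm (\<phi> x) (D\<phi> x h) ?u ?u + m2 (\<phi> x) (?H h u) ?u + m2 (\<phi> x) ?u (?H h u))) (at x)"
    by (intro has_derivative_bilinear_family[where B="\<lambda>y. m2 (\<phi> y)", OF open_Q x] D\<phi>_has_derivative x) auto
  then have "((\<lambda>y. m1 y u u) has_derivative
      (\<lambda>h. two.dm (\<phi> x) (D\<phi> x h) ?u ?u + m2 (\<phi> x) (?H h u) ?u + m2 (\<phi> x) ?u (?H h u))) (at x)"
    by (rule has_derivative_transform_within_open[OF _ open_Q x]) (simp add: m_eq)
  from one.dm_eqI[OF one.in_D[OF x1] this, of ?T]
  have 1: "one.dm x ?T u u = two.dm (\<phi> x) (two.X (\<phi> x)) ?u ?u + 2 * m2 (\<phi> x) (?H u ?T) ?u"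
    using two.sym[OF x2', of ?u] by (simp add: H gradient_eq[OF x])
  have "((\<lambda>y. two.X (\<phi> y)) has_derivative (\<lambda>h. two.DX (\<phi> x) (D\<phi> x h))) (at x)"
    using diff_chain_at[OF \<phi>_has_derivative[OF x] two.X_has_derivative[OF x2]] by (simp add: o_def)
  then have "((\<lambda>y. D\<phi> y (one.X y)) has_derivative (\<lambda>h. two.DX (\<phi> x) (D\<phi> x h))) (at x)"
    by (rule has_derivative_transform_within_open[OF _ open_Q x]) (simp add: gradient_eq)
  moreover have "((\<lambda>y. D\<phi> y (one.X y)) has_derivative (\<lambda>h. ?H h ?T + D\<phi> x (one.DX x h))) (at x)"
    by (rule has_derivative_linear_family[where L="D\<phi>", OF open_Q x D\<phi>_linear D\<phi>_has_derivative[OF x] one.X_has_derivative[OF x1]])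
  ultimately have "(\<lambda>h. two.DX (\<phi> x) (D\<phi> x h)) = (\<lambda>h. ?H h ?T + D\<phi> x (one.DX x h))"
    by (rule has_derivative_unique)
  from fun_cong[OF this, of u] have 2: "two.DX (\<phi> x) ?u = ?H u ?T + D\<phi> x (one.DX x u)" .
  show ?thesis
    unfolding one.hess_lie[OF x1] two.hess_lie[OF x2] 1 2 m_eq[OF x] by (simp add: two.m_ladd[OF x2'] field_simps)
qed

lemma excess_eq:
  assumes x: "x \<in> Q"
  shows "one.excess \<omega> x u u = two.excess \<omega> (\<phi> x) (D\<phi> x u) (D\<phi> x u)"
  unfolding one.excess_def two.excess_def hess_eq[OF x] m_eq[OF x] gradient_eq[OF x] ..

end

section \<open>Charts, transition maps and velocities\<close>

locale manifold =
  fixes N :: "('a::{t2_space,second_countable_topology}, 'e::euclidean_space) riem"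
  assumes riem: "riemannian_manifold N"
begin

lemma chart: "c \<in> charts N \<Longrightarrow> is_chart c"
  using riem unfolding riemannian_manifold_def smooth_structure_def by blast

lemma chart_around: obtains c where "c \<in> charts N" "p \<in> cdom c"
  using riem unfolding riemannian_manifold_def smooth_structure_def by blast

lemma open_cdom: "c \<in> charts N \<Longrightarrow> open (cdom c)"
  using chart unfolding is_chart_def by blast

lemma open_image: "c \<in> charts N \<Longrightarrow> open (crd c ` cdom c)"
  using chart unfolding is_chart_def by blast

lemma chart_homeomorphism: "c \<in> charts N \<Longrightarrow> homeomorphism (cdom c) (crd c ` cdom c) (crd c) (chart_inv c)"
  using chart unfolding is_chart_def by blast

lemma chart_inv_crd: "c \<in> charts N \<Longrightarrow> p \<in> cdom c \<Longrightarrow> chart_inv c (crd c p) = p"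
  using chart_homeomorphism homeomorphism_apply1 by metis

lemma crd_chart_inv: "c \<in> charts N \<Longrightarrow> x \<in> crd c ` cdom c \<Longrightarrow> crd c (chart_inv c x) = x"
  using chart_homeomorphism homeomorphism_apply2 by metis

lemma chart_inv_in: "c \<in> charts N \<Longrightarrow> x \<in> crd c ` cdom c \<Longrightarrow> chart_inv c x \<in> cdom c"
  by (auto simp: chart_inv_crd)

lemma continuous_crd: "c \<in> charts N \<Longrightarrow> continuous_on (cdom c) (crd c)"
  using chart_homeomorphism unfolding homeomorphism_def by blast

lemma continuous_chart_inv: "c \<in> charts N \<Longrightarrow> continuous_on (crd c ` cdom c) (chart_inv c)"
  using chart_homeomorphism unfolding homeomorphism_def by blast

lemma open_image_Int:
  assumes c: "c \<in> charts N" and U: "open U"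
  shows "open (crd c ` (cdom c \<inter> U))"
proof -
  have "crd c ` (cdom c \<inter> U) = crd c ` cdom c \<inter> chart_inv c -` U"
    using chart_inv_crd[OF c] by (auto simp: image_iff)
  then show ?thesis
    using continuous_open_preimage[OF continuous_chart_inv[OF c] open_image[OF c] U] by simp
qed

lemma mem_image_Int:
  assumes c: "c \<in> charts N"
  shows "x \<in> crd c ` (cdom c \<inter> U) \<longleftrightarrow> x \<in> crd c ` cdom c \<and> chart_inv c x \<in> U"
  using chart_inv_crd[OF c] by (auto simp: image_iff)

lemma metric_domain:
  assumes c: "c \<in> charts N"
  shows "metric_domain (rmetric N c) (crd c ` cdom c)"
proof
  show "open (crd c ` cdom c)" by (rule open_image[OF c])
  show "smooth_on (crd c ` cdom c) (\<lambda>x. rmetric N c x u v)" for u v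
    using riem c unfolding riemannian_manifold_def by blast
  have *: "bilinear (inner_at N c p) \<and> (\<forall>u v. inner_at N c p u v = inner_at N c p v u) \<and>
      (\<forall>v. v \<noteq> 0 \<longrightarrow> 0 < inner_at N c p v v)" if "p \<in> cdom c" for p
    using riem c that unfolding riemannian_manifold_def by blast
  fix x u v assume "x \<in> crd c ` cdom c"
  then obtain p where p: "p \<in> cdom c" "rmetric N c x = inner_at N c p" by (auto simp: inner_at_def[abs_def])
  show "bilinear (rmetric N c x)" and "rmetric N c x u v = rmetric N c x v u"
    and "v \<noteq> 0 \<Longrightarrow> 0 < rmetric N c x v v"
    using *[OF p(1)] unfolding p(2) by blast+
qed

lemma metric_domain_function:
  assumes "c \<in> charts N" "open U" "smooth_fun_on N U \<rho>"
  shows "metric_domain_function (rmetric N c) (crd c ` cdom c) (\<rho> \<circ> chart_inv c) (crd c ` (cdom c \<inter> U))"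
  using metric_domain[OF assms(1)] open_image_Int[OF assms(1,2)] assms(1,3)
  unfolding metric_domain_function_def metric_domain_function_axioms_def smooth_fun_on_def by auto

lemma transition_smooth:
  "c \<in> charts N \<Longrightarrow> d \<in> charts N \<Longrightarrow> smooth_on (crd c ` (cdom c \<inter> cdom d)) (crd d \<circ> chart_inv c)"
  using riem unfolding riemannian_manifold_def smooth_structure_def compatible_def by blast

lemma transition_has_derivative:
  assumes "c \<in> charts N" "d \<in> charts N" "p \<in> cdom c" "p \<in> cdom d"
  shows "((crd d \<circ> chart_inv c) has_derivative change_chart c d p) (at (crd c p))"
  using smooth_on_has_derivative[OF transition_smooth[OF assms(1,2)], of "crd c p"] assms(3,4)
  by (simp add: change_chart_def[abs_def])

lemma change_chart_inverse:
  assumes c: "c \<in> charts N" and d: "d \<in> charts N" and p: "p \<in> cdom c" "p \<in> cdom d"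
  shows "change_chart d c p (change_chart c d p v) = v"
proof -
  have "((crd c \<circ> chart_inv d) has_derivative change_chart d c p) (at ((crd d \<circ> chart_inv c) (crd c p)))"
    using transition_has_derivative[OF d c p(2,1)] by (simp add: chart_inv_crd[OF c p(1)])
  from diff_chain_at[OF transition_has_derivative[OF c d p] this]
  have "((crd c \<circ> chart_inv d) \<circ> (crd d \<circ> chart_inv c) has_derivative change_chart d c p \<circ> change_chart c d p) (at (crd c p))" .
  then have "((\<lambda>x. x) has_derivative change_chart d c p \<circ> change_chart c d p) (at (crd c p))"
  proof (rule has_derivative_transform_within_open[OF _ open_image_Int[OF c open_cdom[OF d]]])
    show "crd c p \<in> crd c ` (cdom c \<inter> cdom d)" using p by auto
    fix x assume "x \<in> crd c ` (cdom c \<inter> cdom d)"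
    then show "((crd c \<circ> chart_inv d) \<circ> (crd d \<circ> chart_inv c)) x = x"
      using chart_inv_crd[OF c] chart_inv_crd[OF d] by auto
  qed
  from has_derivative_unique[OF this has_derivative_ident] show ?thesis by (metis comp_apply)
qed

lemma inner_change_chart:
  assumes "c \<in> charts N" "d \<in> charts N" "p \<in> cdom c" "p \<in> cdom d"
  shows "inner_at N c p u v = inner_at N d p (change_chart c d p u) (change_chart c d p v)"
  using riem assms unfolding riemannian_manifold_def by blast

lemma coordinate_change:
  assumes c: "c \<in> charts N" and d: "d \<in> charts N" and U: "open U" and \<rho>: "smooth_fun_on N U \<rho>"
  shows "coordinate_change (rmetric N c) (crd c ` cdom c) (\<rho> \<circ> chart_inv c) (crd c ` (cdom c \<inter> U))
    (rmetric N d) (crd d ` cdom d) (\<rho> \<circ> chart_inv d) (crd d ` (cdom d \<inter> U))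
    (crd d \<circ> chart_inv c) (crd c ` (cdom c \<inter> (cdom d \<inter> U)))"
proof -
  interpret one: metric_domain_function "rmetric N c" "crd c ` cdom c" "\<rho> \<circ> chart_inv c" "crd c ` (cdom c \<inter> U)"
    by (rule metric_domain_function[OF c U \<rho>])
  interpret two: metric_domain_function "rmetric N d" "crd d ` cdom d" "\<rho> \<circ> chart_inv d" "crd d ` (cdom d \<inter> U)"
    by (rule metric_domain_function[OF d U \<rho>])
  show ?thesis
  proof (unfold_locales)
    show "open (crd c ` (cdom c \<inter> (cdom d \<inter> U)))"
      by (rule open_image_Int[OF c]) (use U open_cdom[OF d] in auto)
    show "crd c ` (cdom c \<inter> (cdom d \<inter> U)) \<subseteq> crd c ` (cdom c \<inter> U)" by auto
    show "(crd d \<circ> chart_inv c) ` (crd c ` (cdom c \<inter> (cdom d \<inter> U))) \<subseteq> crd d ` (cdom d \<inter> U)"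
      using chart_inv_crd[OF c] by auto
    show "smooth_on (crd c ` (cdom c \<inter> (cdom d \<inter> U))) (crd d \<circ> chart_inv c)"
      by (rule smooth_on_subset[OF transition_smooth[OF c d]]) auto
  next
    fix y assume "y \<in> crd c ` (cdom c \<inter> (cdom d \<inter> U))"
    then obtain p where p: "p \<in> cdom c" "p \<in> cdom d" "p \<in> U" and y: "y = crd c p" by auto
    have D: "frechet_derivative (crd d \<circ> chart_inv c) (at y) = change_chart c d p"
      by (simp add: y change_chart_def[abs_def])
    show "(\<rho> \<circ> chart_inv c) y = (\<rho> \<circ> chart_inv d) ((crd d \<circ> chart_inv c) y)"
      by (simp add: y chart_inv_crd[OF c p(1)] chart_inv_crd[OF d p(2)])
    show "rmetric N c y u v = rmetric N d ((crd d \<circ> chart_inv c) y) (frechet_derivative (crd d \<circ> chart_inv c) (at y) u)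
             (frechet_derivative (crd d \<circ> chart_inv c) (at y) v)" for u v
      using inner_change_chart[OF c d p(1,2), of u v] unfolding D inner_at_def
      by (simp add: y chart_inv_crd[OF c p(1)])
    show "surj (frechet_derivative (crd d \<circ> chart_inv c) (at y))"
      unfolding D by (rule surjI[of _ "change_chart d c p"]) (rule change_chart_inverse[OF d c p(2,1)])
  qed
qed

lemma open_preimage_cdom:
  "open T \<Longrightarrow> continuous_on T F \<Longrightarrow> c \<in> charts N \<Longrightarrow> open (T \<inter> F -` cdom c)"
  by (rule continuous_open_preimage) (auto simp: open_cdom)

lemma velocity_change_chart:
  assumes T: "open T" "t \<in> T" "continuous_on T \<gamma>" and c: "c \<in> charts N" "\<gamma> t \<in> cdom c"
    and d: "d \<in> charts N" "\<gamma> t \<in> cdom d" and v: "((crd c \<circ> \<gamma>) has_vector_derivative v) (at t)"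
  shows "((crd d \<circ> \<gamma>) has_vector_derivative change_chart c d (\<gamma> t) v) (at t)"
proof -
  let ?T = "T \<inter> \<gamma> -` (cdom c \<inter> cdom d)"
  have "open ?T" by (rule continuous_open_preimage[OF T(3,1) open_Int[OF open_cdom[OF c(1)] open_cdom[OF d(1)]]])
  moreover have "t \<in> ?T" using T c d by auto
  moreover have "((crd d \<circ> chart_inv c) \<circ> (crd c \<circ> \<gamma>) has_derivative change_chart c d (\<gamma> t) \<circ> (\<lambda>h. h *\<^sub>R v)) (at t)"
    using diff_chain_at[of "crd c \<circ> \<gamma>" _ t] v transition_has_derivative[OF c(1) d(1) c(2) d(2)]
    unfolding has_vector_derivative_def by simp
  ultimately have "((crd d \<circ> \<gamma>) has_derivative change_chart c d (\<gamma> t) \<circ> (\<lambda>h. h *\<^sub>R v)) (at t)"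
    by (elim has_derivative_transform_within_open) (auto simp: chart_inv_crd[OF c(1)])
  moreover have "linear (change_chart c d (\<gamma> t))"
    using transition_has_derivative[OF c(1) d(1) c(2) d(2)] has_derivative_bounded_linear bounded_linear.linear by blast
  ultimately show ?thesis by (simp add: has_vector_derivative_def o_def linear_cmul)
qed

text \<open>The speed is defined through an arbitrarily chosen chart; the compatibility of the metrics of
  different charts makes the choice irrelevant.\<close>

lemma speed_eq:
  assumes T: "open T" "t \<in> T" "continuous_on T \<gamma>" and c: "c \<in> charts N" "\<gamma> t \<in> cdom c"
    and v: "((crd c \<circ> \<gamma>) has_vector_derivative v) (at t)"
  shows "speed N \<gamma> t = sqrt (inner_at N c (\<gamma> t) v v)"
proof -
  define d where "d = (SOME c. c \<in> charts N \<and> \<gamma> t \<in> cdom c)"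
  have d: "d \<in> charts N \<and> \<gamma> t \<in> cdom d"
    unfolding d_def by (rule someI[of _ c]) (use c in simp)
  have "velocity d \<gamma> t = change_chart c d (\<gamma> t) v"
    unfolding velocity_def by (rule vector_derivative_at[OF velocity_change_chart[OF T c _ _ v]]) (use d in auto)
  then show ?thesis
    unfolding speed_def d_def[symmetric] Let_def using inner_change_chart[OF c(1) _ c(2), of d v v] d by simp
qed

lemma smooth_into_velocity:
  assumes "smooth_into N T \<gamma>" "t \<in> T" "c \<in> charts N" "\<gamma> t \<in> cdom c"
  shows "((crd c \<circ> \<gamma>) has_vector_derivative velocity c \<gamma> t) (at t)"
proof -
  have "smooth_on (T \<inter> \<gamma> -` cdom c) (crd c \<circ> \<gamma>)" using assms(1,3) by (simp add: smooth_into_def)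
  then have "(crd c \<circ> \<gamma>) differentiable (at t)" by (rule smooth_on_differentiable) (use assms in auto)
  then show ?thesis unfolding velocity_def by (simp add: vector_derivative_works)
qed

section \<open>A curve with a corner as competitor for the distance\<close>

text \<open>The distance to the hypersurface is an infimum over all curves, but only one kind of curve is
  ever needed: a unit speed curve leaving the hypersurface, continued by a straight segment in
  a chart.\<close>

lemma rdist_to_le_broken_curve:
  assumes I: "open I" "{0..r} \<subseteq> I" "0 \<le> r" and \<gamma>: "smooth_into N I \<gamma>" "\<gamma> 0 \<in> S"
    and speed: "\<And>t. t \<in> I \<Longrightarrow> speed N \<gamma> t = 1"
    and c: "c \<in> charts N" "\<gamma> r \<in> cdom c"
    and seg: "closed_segment (crd c (\<gamma> r)) x \<subseteq> crd c ` cdom c"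
    and K: "\<And>z. z \<in> closed_segment (crd c (\<gamma> r)) x \<Longrightarrow>
        sqrt (rmetric N c z (x - crd c (\<gamma> r)) (x - crd c (\<gamma> r))) \<le> K"
  shows "rdist_to N S (chart_inv c x) \<le> ennreal (r + K)"
proof -
  define y where "y = crd c (\<gamma> r)"
  define w where "w = x - y"
  \<comment> \<open>Each of the two pieces takes half of the parameter interval, hence the factors 2: the segment
      starts at \<open>y\<close> for \<open>t = 1/2\<close> and arrives at \<open>x\<close> for \<open>t = 1\<close>.\<close>
  define l where "l t = (y - w) + t *\<^sub>R (2 *\<^sub>R w)" for t :: real
  define \<kappa> where "\<kappa> t = (if t \<le> 1/2 then \<gamma> (0 + t * (2 * r)) else chart_inv c (l t))" for t
  have cont\<gamma>: "continuous_on I \<gamma>" using \<gamma> by (simp add: smooth_into_def)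
  have y: "y \<in> crd c ` cdom c" using c by (simp add: y_def)
  have l_seg: "l t \<in> closed_segment y x" if "1/2 \<le> t" "t \<le> 1" for t
  proof -
    have "l t = y + (2 * t - 1) *\<^sub>R w" by (simp add: l_def algebra_simps)
    also have "\<dots> = (1 - (2 * t - 1)) *\<^sub>R y + (2 * t - 1) *\<^sub>R x"
      by (simp add: w_def scaleR_left_diff_distrib scaleR_right_diff_distrib scaleR_2)
    finally show ?thesis unfolding closed_segment_def using that by (auto intro!: exI[of _ "2 * t - 1"])
  qed
  have l_in: "l t \<in> crd c ` cdom c" if "1/2 \<le> t" "t \<le> 1" for t
    using l_seg[OF that] seg by (auto simp: y_def)
  have l_half: "l (1/2) = y" and l_one: "l 1 = x" by (simp_all add: l_def w_def scaleR_2)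
  have K0: "0 \<le> K"
  proof -
    have "0 \<le> sqrt (rmetric N c y w w)"
    proof -
      interpret metric_domain "rmetric N c" "crd c ` cdom c" by (rule metric_domain[OF c(1)])
      show ?thesis using pos[OF y, of w] by (cases "w = 0") (auto simp: m_lzero[OF y])
    qed
    also have "\<dots> \<le> K" using K[of y] by (simp add: y_def w_def)
    finally show ?thesis .
  qed
  have \<gamma>_in: "0 + t * (2 * r) \<in> I" if "0 \<le> t" "t \<le> 1/2" for t
  proof -
    have "t * (2 * r) \<le> (1/2) * (2 * r)" using that I(3) by (intro mult_right_mono) auto
    then show ?thesis using I that by auto
  qed
  have cont_l: "continuous_on A l" for A unfolding l_def by (intro continuous_intros)
  have cont1: "continuous_on {0..1/2} (\<lambda>t. \<gamma> (0 + t * (2 * r)))"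
    by (rule continuous_on_compose2[OF cont\<gamma>]) (use \<gamma>_in in \<open>auto intro!: continuous_intros\<close>)
  have cont2: "continuous_on {1/2..1} (\<lambda>t. chart_inv c (l t))"
    by (rule continuous_on_compose2[OF continuous_chart_inv[OF c(1)] cont_l]) (use l_in in auto)
  have "continuous_on ({0..1/2} \<union> {1/2..1}) \<kappa>"
    unfolding \<kappa>_def
  proof (rule continuous_on_cases[OF _ _ cont1 cont2])
    show "\<forall>t. t \<in> {0..1/2} \<and> \<not> t \<le> 1/2 \<or> t \<in> {1/2..1} \<and> t \<le> 1/2 \<longrightarrow> \<gamma> (0 + t * (2 * r)) = chart_inv c (l t)"
    proof (intro allI impI)
      fix t :: real assume "t \<in> {0..1/2} \<and> \<not> t \<le> 1/2 \<or> t \<in> {1/2..1} \<and> t \<le> 1/2"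
      then have t: "t = 1/2" by auto
      show "\<gamma> (0 + t * (2 * r)) = chart_inv c (l t)" unfolding t l_half by (simp add: y_def chart_inv_crd[OF c])
    qed
  qed auto
  moreover have "{0..1/2} \<union> {1/2..1} = {0..1::real}" by auto
  ultimately have cont\<kappa>: "continuous_on {0..1} \<kappa>" by simp
  \<comment> \<open>The curve is differentiable off the corner, so it is treated on the two open halves of the
      parameter interval; the three remaining parameters form a null set.\<close>
  define T1 T2 where "T1 = {0<..<1/2::real}" and "T2 = {1/2<..<1::real}"
  have T: "open T1" "open T2" "T1 \<subseteq> {0..1}" "T2 \<subseteq> {0..1}" by (auto simp: T1_def T2_def)
  have smooth1: "smooth_on (T1 \<inter> \<kappa> -` cdom d) (crd d \<circ> \<kappa>)" and open1: "open (T1 \<inter> \<kappa> -` cdom d)"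
    if d: "d \<in> charts N" for d
  proof -
    show op: "open (T1 \<inter> \<kappa> -` cdom d)"
      by (rule open_preimage_cdom[OF T(1) continuous_on_subset[OF cont\<kappa> T(3)] d])
    have "smooth_on (I \<inter> \<gamma> -` cdom d) (crd d \<circ> \<gamma>)" using \<gamma> d by (simp add: smooth_into_def)
    then have "smooth_on (T1 \<inter> \<kappa> -` cdom d) (\<lambda>t. (crd d \<circ> \<gamma>) (0 + t * (2 * r)))"
      by (rule smooth_on_compose_affine[OF _ bounded_linear_mult_left op])
         (use \<gamma>_in in \<open>auto simp: T1_def \<kappa>_def\<close>)
    then show "smooth_on (T1 \<inter> \<kappa> -` cdom d) (crd d \<circ> \<kappa>)"
      by (rule smooth_on_cong[OF _ op]) (auto simp: T1_def \<kappa>_def)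
  qed
  have smooth2: "smooth_on (T2 \<inter> \<kappa> -` cdom d) (crd d \<circ> \<kappa>)" and open2: "open (T2 \<inter> \<kappa> -` cdom d)"
    if d: "d \<in> charts N" for d
  proof -
    show op: "open (T2 \<inter> \<kappa> -` cdom d)"
      by (rule open_preimage_cdom[OF T(2) continuous_on_subset[OF cont\<kappa> T(4)] d])
    have "smooth_on (T2 \<inter> \<kappa> -` cdom d) (\<lambda>t. (crd d \<circ> chart_inv c) ((y - w) + t *\<^sub>R (2 *\<^sub>R w)))"
      by (rule smooth_on_compose_affine[OF transition_smooth[OF c(1) d] bounded_linear_scaleR_left op])
         (use l_in in \<open>auto simp: T2_def \<kappa>_def mem_image_Int[OF c(1)] l_def\<close>)
    then show "smooth_on (T2 \<inter> \<kappa> -` cdom d) (crd d \<circ> \<kappa>)"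
      by (rule smooth_on_cong[OF _ op]) (auto simp: T2_def \<kappa>_def l_def)
  qed
  have "piecewise_C1_curve N \<kappa>"
    unfolding piecewise_C1_curve_def
  proof (intro conjI cont\<kappa> exI[of _ "{1/2}"] ballI)
    fix d assume d: "d \<in> charts N"
    have "({0<..<1} - {1/2}) \<inter> \<kappa> -` cdom d = (T1 \<inter> \<kappa> -` cdom d) \<union> (T2 \<inter> \<kappa> -` cdom d)"
      by (auto simp: T1_def T2_def)
    then show "(crd d \<circ> \<kappa>) C1_differentiable_on (({0<..<1} - {1/2}) \<inter> \<kappa> -` cdom d)"
      using C1_differentiable_on_open_Un[OF smooth_on_imp_C1[OF smooth1[OF d]] smooth_on_imp_C1[OF smooth2[OF d]] open1[OF d] open2[OF d]]
      by simp
  qed simp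
  moreover have \<kappa>0: "\<kappa> 0 = \<gamma> 0" and \<kappa>1: "\<kappa> 1 = chart_inv c x" by (simp_all add: \<kappa>_def l_one)
  ultimately have "rdist N UNIV (\<gamma> 0) (chart_inv c x) \<le> curve_length N \<kappa>"
    unfolding rdist_def by (intro INF_lower) auto
  then have "rdist_to N S (chart_inv c x) \<le> curve_length N \<kappa>"
    unfolding rdist_to_def by (rule INF_lower2[OF \<gamma>(2)])
  also have "curve_length N \<kappa> \<le> (\<integral>\<^sup>+t. ennreal (2 * r) * indicator {0..1/2::real} t + ennreal (2 * K) * indicator {1/2..1} t \<partial>lborel)"
    unfolding curve_length_def
  proof (rule nn_integral_mono_AE)
    have speed1: "speed N \<kappa> t = 2 * r" if t: "t \<in> T1" for t
    proof -
      obtain d where d: "d \<in> charts N" "\<kappa> t \<in> cdom d" by (rule chart_around)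
      define s where "s = 0 + t * (2 * r)"
      have s: "s \<in> I" "\<gamma> s \<in> cdom d" "\<kappa> t = \<gamma> s" using t d \<gamma>_in by (auto simp: T1_def \<kappa>_def s_def)
      note v = smooth_into_velocity[OF \<gamma>(1) s(1) d(1) s(2)]
      have "((\<lambda>t. 0 + t * (2 * r)) has_vector_derivative 2 * r) (at t)"
        by (auto intro!: derivative_eq_intros simp: has_real_derivative_iff_has_vector_derivative[symmetric])
      from vector_diff_chain_at[OF this v[unfolded s_def]]
      have "((\<lambda>t. (crd d \<circ> \<gamma>) (0 + t * (2 * r))) has_vector_derivative (2 * r) *\<^sub>R velocity d \<gamma> s) (at t)"
        by (simp add: o_def s_def)
      then have "((crd d \<circ> \<kappa>) has_vector_derivative (2 * r) *\<^sub>R velocity d \<gamma> s) (at t)"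
        by (rule has_vector_derivative_transform_within_open[OF _ T(1) t]) (auto simp: T1_def \<kappa>_def)
      from speed_eq[OF T(1) t continuous_on_subset[OF cont\<kappa> T(3)] d this]
      have "speed N \<kappa> t = sqrt (inner_at N d (\<kappa> t) ((2 * r) *\<^sub>R velocity d \<gamma> s) ((2 * r) *\<^sub>R velocity d \<gamma> s))" .
      also have "\<dots> = sqrt ((2 * r)\<^sup>2 * inner_at N d (\<gamma> s) (velocity d \<gamma> s) (velocity d \<gamma> s))"
      proof -
        interpret metric_domain "rmetric N d" "crd d ` cdom d" by (rule metric_domain[OF d(1)])
        show ?thesis using s(2) unfolding inner_at_def s(3) by (simp add: m_lmul m_rmul power2_eq_square mult.assoc)
      qed
      also have "\<dots> = 2 * r * speed N \<gamma> s"
        unfolding speed_eq[OF I(1) s(1) cont\<gamma> d(1) s(2) v] using I(3) by (simp add: real_sqrt_mult)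
      finally show ?thesis using speed[OF s(1)] by simp
    qed
    have speed2: "speed N \<kappa> t \<le> 2 * K" if t: "t \<in> T2" for t
    proof -
      have lt: "l t \<in> crd c ` cdom c" "l t \<in> closed_segment y x" using t l_in l_seg by (auto simp: T2_def)
      have \<kappa>t: "\<kappa> t = chart_inv c (l t)" "\<kappa> t \<in> cdom c" using t chart_inv_in[OF c(1) lt(1)] by (auto simp: T2_def \<kappa>_def)
      have "(l has_vector_derivative 2 *\<^sub>R w) (at t)"
        unfolding l_def by (auto intro!: derivative_eq_intros)
      then have "((crd c \<circ> \<kappa>) has_vector_derivative 2 *\<^sub>R w) (at t)"
        by (rule has_vector_derivative_transform_within_open[OF _ T(2) t])
           (use l_in crd_chart_inv[OF c(1)] in \<open>auto simp: T2_def \<kappa>_def\<close>)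
      from speed_eq[OF T(2) t continuous_on_subset[OF cont\<kappa> T(4)] c(1) \<kappa>t(2) this]
      have "speed N \<kappa> t = sqrt (rmetric N c (l t) (2 *\<^sub>R w) (2 *\<^sub>R w))"
        using crd_chart_inv[OF c(1) lt(1)] by (simp add: inner_at_def \<kappa>t(1))
      also have "\<dots> = sqrt (2\<^sup>2 * rmetric N c (l t) w w)"
      proof -
        interpret metric_domain "rmetric N c" "crd c ` cdom c" by (rule metric_domain[OF c(1)])
        show ?thesis using lt(1) by (simp add: m_lmul m_rmul)
      qed
      also have "\<dots> = 2 * sqrt (rmetric N c (l t) w w)" by (simp add: real_sqrt_mult)
      also have "\<dots> \<le> 2 * K" using K[of "l t"] lt(2) by (simp add: y_def w_def)
      finally show ?thesis .
    qed
    have "AE t in lborel. t \<noteq> (0::real)" "AE t in lborel. t \<noteq> (1/2::real)" "AE t in lborel. t \<noteq> (1::real)"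
      by (rule AE_lborel_singleton)+
    then show "AE t in lborel. ennreal (speed N \<kappa> t) * indicator {0..1} t
        \<le> ennreal (2 * r) * indicator {0..1/2} t + ennreal (2 * K) * indicator {1/2..1} t"
    proof eventually_elim
      case (elim t)
      have "t \<in> T1 \<or> t \<in> T2 \<or> t \<notin> {0..1}" using elim unfolding T1_def T2_def by fastforce
      then consider "t \<in> T1" | "t \<in> T2" | "t \<notin> {0..1}" by blast
      then show ?case
      proof cases
        case 1 then show ?thesis using speed1[OF 1] by (auto simp: T1_def indicator_def)
      next
        case 2 then show ?thesis using speed2[OF 2] by (auto simp: T2_def indicator_def intro: ennreal_leI)
      next
        case 3 then show ?thesis by (auto simp: indicator_def)
      qed
    qed
  qed
  also have "\<dots> = ennreal (2 * r) * ennreal (1/2) + ennreal (2 * K) * ennreal (1/2)"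
    by (subst nn_integral_add) (simp_all add: nn_integral_cmult_indicator)
  also have "\<dots> = ennreal (r + K)"
  proof -
    have "ennreal (2 * a) * ennreal (1/2) = ennreal a" if "0 \<le> a" for a
      by (subst ennreal_mult[symmetric]) (use that in auto)
    then show ?thesis using I(3) K0 by (simp only: ennreal_plus)
  qed
  finally show ?thesis .
qed

end

section \<open>The gradient of the signed distance\<close>

locale signed_distance_setting = manifold N
  for N :: "('a::{t2_space,second_countable_topology}, 'e::euclidean_space) riem" +
  fixes S :: "'a set" and \<nu> :: "('a, 'e) chart \<Rightarrow> 'a \<Rightarrow> 'e" and U :: "'a set" and \<rho> :: "'a \<Rightarrow> real"
  assumes hypersurface: "embedded_hypersurface N S"
    and normal: "unit_normal_field N S \<nu>"
    and open_U: "open U"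
    and signed_distance: "signed_distance_on N S \<nu> U \<rho>"
    and smooth_\<rho>: "smooth_fun_on N U \<rho>"
    and segment: "\<And>p. p \<in> U \<Longrightarrow> 0 \<le> \<rho> p \<Longrightarrow> normal_segment_in N S U p (\<rho> p)"
begin

abbreviation "f c \<equiv> \<rho> \<circ> chart_inv c"
abbreviation "V c \<equiv> crd c ` (cdom c \<inter> U)"
abbreviation "img c \<equiv> crd c ` cdom c"
abbreviation "grad c \<equiv> coord_gradient (rmetric N c) (f c)"
abbreviation "W c \<equiv> {x \<in> V c. 0 < f c x}"

lemma chart_domain: "c \<in> charts N \<Longrightarrow> metric_domain_function (rmetric N c) (img c) (f c) (V c)"
  by (rule metric_domain_function[OF _ open_U smooth_\<rho>])

lemma \<rho>_dist: "p \<in> U \<Longrightarrow> ennreal \<bar>\<rho> p\<bar> = rdist_to N S p"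
  and \<rho>_zero: "p \<in> U \<Longrightarrow> \<rho> p = 0 \<longleftrightarrow> p \<in> S"
  using signed_distance unfolding signed_distance_on_def by blast+

lemma unit_speed_segment:
  assumes "p \<in> U" "0 \<le> \<rho> p"
  obtains I \<gamma> where "open I" "{0..\<rho> p} \<subseteq> I" "smooth_into N I \<gamma>" "\<gamma> 0 \<in> S" "\<gamma> ` {0..\<rho> p} \<subseteq> U" "\<gamma> (\<rho> p) = p"
    "\<And>t. t \<in> I \<Longrightarrow> speed N \<gamma> t = 1"
proof -
  obtain I \<gamma> where g: "normal_geodesic N S I \<gamma>" "{0..\<rho> p} \<subseteq> I" "\<gamma> ` {0..\<rho> p} \<subseteq> U" "\<gamma> (\<rho> p) = p"
    "\<forall>t\<in>I. speed N \<gamma> t = 1"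
    using segment[OF assms] unfolding normal_segment_in_def by blast
  have "open I" "smooth_into N I \<gamma>" "\<gamma> 0 \<in> S"
    using g(1) unfolding normal_geodesic_def geodesic_on_def by simp_all
  then show ?thesis using g by (intro that[of I \<gamma>]) auto
qed

text \<open>The distance to the hypersurface does not grow faster than arc length: reaching \<open>p\<close> through a
  nearby point with smaller value of \<open>\<rho>\<close> is one way of reaching it.\<close>

lemma gradient_norm_le_1:
  assumes c: "c \<in> charts N" and x: "x \<in> W c"
  shows "rmetric N c x (grad c x) (grad c x) \<le> 1"
proof -
  interpret metric_domain_function "rmetric N c" "img c" "f c" "V c" by (rule chart_domain[OF c])
  let ?m = "rmetric N c"
  have xV: "x \<in> V c" and fx: "0 < f c x" using x by auto
  note xD = in_D[OF xV]
  have lower: "- k \<le> ?m x (grad c x) w" if k: "sqrt (?m x w w) < k" for w k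
  proof -
    let ?O = "V c \<inter> (\<lambda>z. (f c z, sqrt (?m z w w))) -` ({0<..} \<times> {..<k})"
    have "continuous_on (V c) (\<lambda>z. ?m z w w)"
      by (rule continuous_on_subset[OF smooth_on_continuous[OF smooth_m] V_D])
    then have "continuous_on (V c) (\<lambda>z. (f c z, sqrt (?m z w w)))"
      by (intro continuous_on_Pair smooth_on_continuous[OF smooth_f] continuous_on_real_sqrt)
    then have "open ?O" by (rule continuous_open_preimage[OF _ open_V open_Times]) auto
    moreover have "x \<in> ?O" using xV fx k by auto
    ultimately obtain e where e: "e > 0" "ball x e \<subseteq> ?O" by (meson open_contains_ball)
    have step: "f c x \<le> f c (x + s *\<^sub>R w) + s * k" if s: "0 < s" "s * norm w < e" for s
    proof -
      define y where "y = x + s *\<^sub>R w"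
      define q where "q = chart_inv c y"
      have "y \<in> ball x e" "x \<in> ball x e" using s e(1) by (auto simp: y_def dist_norm)
      then have seg: "closed_segment y x \<subseteq> ?O" using e(2) closed_segment_subset[OF _ _ convex_ball] by blast
      then have "y \<in> ?O" using ends_in_segment by blast
      then have yV: "y \<in> V c" and fy: "0 < f c y" by auto
      have q: "q \<in> U" "q \<in> cdom c" "crd c q = y" "\<rho> q = f c y"
        using yV chart_inv_in[OF c] crd_chart_inv[OF c] by (auto simp: q_def chart_inv_crd[OF c])
      obtain I \<gamma> where g: "open I" "{0..\<rho> q} \<subseteq> I" "smooth_into N I \<gamma>" "\<gamma> 0 \<in> S" "\<gamma> (\<rho> q) = q"
        "\<And>t. t \<in> I \<Longrightarrow> speed N \<gamma> t = 1"
        using unit_speed_segment[OF q(1)] fy q(4) by (metis less_imp_le)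
      have "rdist_to N S (chart_inv c x) \<le> ennreal (\<rho> q + s * k)"
      proof (rule rdist_to_le_broken_curve[OF g(1,2) _ g(3,4,6) c])
        fix z assume "z \<in> closed_segment (crd c (\<gamma> (\<rho> q))) x"
        then have "z \<in> ?O" using seg by (auto simp: g(5) q(3))
        then have z: "z \<in> V c" "sqrt (?m z w w) < k" by auto
        have xy: "x - crd c (\<gamma> (\<rho> q)) = (- s) *\<^sub>R w" by (simp add: g(5) q(3) y_def)
        have "sqrt (?m z ((- s) *\<^sub>R w) ((- s) *\<^sub>R w)) = sqrt (s\<^sup>2 * ?m z w w)"
          by (simp only: m_lmul[OF in_D[OF z(1)]] m_rmul[OF in_D[OF z(1)]]) (simp add: power2_eq_square mult.assoc)
        also have "\<dots> \<le> s * k" using s z(2) by (simp add: real_sqrt_mult)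
        finally show "sqrt (?m z (x - crd c (\<gamma> (\<rho> q))) (x - crd c (\<gamma> (\<rho> q)))) \<le> s * k" unfolding xy .
      next
        show "closed_segment (crd c (\<gamma> (\<rho> q))) x \<subseteq> img c" using seg V_D by (auto simp: g(5) q(3))
      qed (use fy q g(5) in auto)
      moreover have "chart_inv c x \<in> U" using xV chart_inv_crd[OF c] by auto
      ultimately have "ennreal \<bar>f c x\<bar> \<le> ennreal (f c y + s * k)" using \<rho>_dist q(4) by simp
      moreover have "0 \<le> f c y + s * k"
      proof -
        have "0 \<le> sqrt (?m x w w)" using pos[OF xD, of w] by (cases "w = 0") (auto simp: m_lzero[OF xD])
        then have "0 \<le> k" using k by linarith
        then show ?thesis using fy s by (intro add_nonneg_nonneg mult_nonneg_nonneg) auto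
      qed
      ultimately show ?thesis using fx by (simp add: y_def)
    qed
    have "((\<lambda>s. f c (x + s *\<^sub>R w)) has_real_derivative ?m x (grad c x) w) (at_right 0)"
      by (rule has_field_derivative_at_within[OF f_along_line[OF xV]])
    then have "((\<lambda>s. (f c (x + s *\<^sub>R w) - f c x) / s) \<longlongrightarrow> ?m x (grad c x) w) (at_right 0)"
      by (simp add: has_field_derivative_iff)
    moreover have "\<forall>\<^sub>F s in at_right 0. - k \<le> (f c (x + s *\<^sub>R w) - f c x) / s"
    proof -
      have "\<forall>\<^sub>F s in at_right 0. s * norm w < e"
        by (rule order_tendstoD[of _ 0]) (use e(1) in \<open>auto intro!: tendsto_eq_intros\<close>)
      moreover have "\<forall>\<^sub>F s::real in at_right 0. 0 < s" by (simp add: eventually_at_right_less)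
      ultimately show ?thesis
      proof eventually_elim
        case (elim s)
        then show ?case using step[OF elim(2,1)] by (simp add: pos_le_divide_eq algebra_simps)
      qed
    qed
    ultimately show ?thesis by (rule tendsto_lowerbound) simp
  qed
  \<comment> \<open>For \<open>w = - X\<close> the lower bound reads \<open>\<langle>X,X\<rangle> \<le> \<bar>X\<bar>\<close>.\<close>
  define g where "g = ?m x (grad c x) (grad c x)"
  have g: "0 \<le> g" unfolding g_def using pos[OF xD, of "grad c x"] by (cases "grad c x = 0") (auto simp: m_lzero[OF xD])
  have neg: "?m x (- grad c x) (- grad c x) = g" by (simp add: g_def m_lneg[OF xD] m_rneg[OF xD])
  have "g \<le> sqrt g"
  proof (rule field_le_epsilon)
    fix e :: real assume "0 < e"
    then show "g \<le> sqrt g + e" using lower[of "- grad c x" "sqrt g + e"] unfolding neg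
      by (simp add: m_rneg[OF xD] g_def)
  qed
  then have "g\<^sup>2 \<le> (sqrt g)\<^sup>2" using g by (rule power_mono)
  then have "g * g \<le> g" using g by (simp add: power2_eq_square)
  then have "g \<le> 1" using g by (cases "g = 0") (auto simp: mult_le_cancel_left_pos)
  then show ?thesis by (simp add: g_def)
qed

lemma \<rho>_curve_derivative:
  assumes I: "open I" "t \<in> I" "smooth_into N I \<gamma>" and c: "c \<in> charts N" "\<gamma> t \<in> cdom c" and U: "\<gamma> t \<in> U"
  shows "((\<lambda>t. \<rho> (\<gamma> t)) has_real_derivative rmetric N c (crd c (\<gamma> t)) (grad c (crd c (\<gamma> t))) (velocity c \<gamma> t)) (at t)"
proof -
  interpret metric_domain_function "rmetric N c" "img c" "f c" "V c" by (rule chart_domain[OF c(1)])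
  let ?x = "crd c (\<gamma> t)"
  have xV: "?x \<in> V c" using c U by auto
  have "((crd c \<circ> \<gamma>) has_derivative (\<lambda>h. h *\<^sub>R velocity c \<gamma> t)) (at t)"
    using smooth_into_velocity[OF I(3,2) c] by (simp add: has_vector_derivative_def)
  moreover have "(f c has_derivative (\<lambda>v. rmetric N c ?x (grad c ?x) v)) (at ((crd c \<circ> \<gamma>) t))"
    using f_has_derivative[OF xV] by simp
  ultimately have "(f c \<circ> (crd c \<circ> \<gamma>) has_derivative (\<lambda>v. rmetric N c ?x (grad c ?x) v) \<circ> (\<lambda>h. h *\<^sub>R velocity c \<gamma> t)) (at t)"
    by (rule diff_chain_at)
  then have "((\<lambda>t. \<rho> (\<gamma> t)) has_derivative (\<lambda>v. rmetric N c ?x (grad c ?x) v) \<circ> (\<lambda>h. h *\<^sub>R velocity c \<gamma> t)) (at t)"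
  proof (rule has_derivative_transform_within_open)
    show "open (I \<inter> \<gamma> -` cdom c)"
      by (rule open_preimage_cdom[OF I(1) _ c(1)]) (use I(3) in \<open>simp add: smooth_into_def\<close>)
  qed (use I c chart_inv_crd[OF c(1)] in auto)
  then show ?thesis
    by (rule has_derivative_imp_has_field_derivative) (simp add: m_rmul[OF in_D[OF xV]])
qed

text \<open>Along the normal segment \<open>\<rho>\<close> is at most the arc length, with equality at the end point. As the
  gradient has length at most 1, \<open>\<rho>\<close> could not catch up if it fell behind, so that
  equality holds all along.\<close>

lemma \<rho>_along_segment:
  assumes I: "open I" "{0..r} \<subseteq> I" "smooth_into N I \<gamma>" "\<gamma> 0 \<in> S" "\<gamma> ` {0..r} \<subseteq> U"
    and speed: "\<And>t. t \<in> I \<Longrightarrow> speed N \<gamma> t = 1" and end_point: "\<rho> (\<gamma> r) = r" and t: "t \<in> {0..r}"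
  shows "\<rho> (\<gamma> t) = t"
proof -
  define F where "F t = \<rho> (\<gamma> t)" for t
  have cont\<gamma>: "continuous_on I \<gamma>" using I by (simp add: smooth_into_def)
  have le: "F t \<le> t" if t: "t \<in> {0..r}" for t
  proof -
    obtain c where c: "c \<in> charts N" "\<gamma> t \<in> cdom c" by (rule chart_around)
    interpret metric_domain_function "rmetric N c" "img c" "f c" "V c" by (rule chart_domain[OF c(1)])
    have D: "crd c (\<gamma> t) \<in> img c" using c by auto
    \<comment> \<open>The competitor is the initial piece of the segment itself, with a trivial second piece.\<close>
    have "rdist_to N S (chart_inv c (crd c (\<gamma> t))) \<le> ennreal (t + 0)"
      by (rule rdist_to_le_broken_curve[OF I(1) _ _ I(3,4) speed c])
         (use t I(2) c in \<open>auto simp: m_lzero[OF D]\<close>)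
    moreover have "\<gamma> t \<in> U" using I(5) t by blast
    ultimately have "ennreal \<bar>F t\<bar> \<le> ennreal t"
      unfolding F_def by (simp only: \<rho>_dist chart_inv_crd[OF c] add_0_right)
    then show ?thesis using t by simp
  qed
  have deriv: "\<exists>D. (F has_real_derivative D) (at t) \<and> (F t > 0 \<longrightarrow> D \<le> 1)" if t: "t \<in> {0..r}" for t
  proof -
    obtain c where c: "c \<in> charts N" "\<gamma> t \<in> cdom c" by (rule chart_around)
    interpret metric_domain_function "rmetric N c" "img c" "f c" "V c" by (rule chart_domain[OF c(1)])
    let ?x = "crd c (\<gamma> t)"
    have tI: "t \<in> I" and U: "\<gamma> t \<in> U" using t I by auto
    have xV: "?x \<in> V c" using c U by auto
    note v = smooth_into_velocity[OF I(3) tI c]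
    have "sqrt (rmetric N c ?x (velocity c \<gamma> t) (velocity c \<gamma> t)) = 1"
      using speed_eq[OF I(1) tI cont\<gamma> c v] speed[OF tI] by (simp add: inner_at_def)
    then have v1: "rmetric N c ?x (velocity c \<gamma> t) (velocity c \<gamma> t) = 1" by simp
    have "rmetric N c ?x (grad c ?x) (velocity c \<gamma> t) \<le> 1" if "F t > 0"
    proof -
      have "?x \<in> W c" using xV that c by (simp add: F_def chart_inv_crd)
      from gradient_norm_le_1[OF c(1) this] cauchy_schwarz[OF in_D[OF xV], of "grad c ?x" "velocity c \<gamma> t"] v1
      have "(rmetric N c ?x (grad c ?x) (velocity c \<gamma> t))\<^sup>2 \<le> 1" by simp
      then show ?thesis by (simp add: power2_le_iff_abs_le abs_square_le_1)
    qed
    with \<rho>_curve_derivative[OF I(1) tI I(3) c U] show ?thesis unfolding F_def by blast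
  qed
  have contF: "continuous_on {0..r} F"
  proof (rule continuous_at_imp_continuous_on, rule ballI)
    fix t assume "t \<in> {0..r}"
    then show "isCont F t" using deriv DERIV_isCont by blast
  qed
  show ?thesis
  proof (rule ccontr)
    assume "\<rho> (\<gamma> t) \<noteq> t"
    then have lt: "F t < t" using le[OF t] by (simp add: F_def)
    \<comment> \<open>the first time at which \<open>\<rho>\<close> has caught up with arc length\<close>
    let ?Z = "{s \<in> {t..r}. F s - s = 0}"
    have "continuous_on {t..r} (\<lambda>s. F s - s)"
      by (intro continuous_intros continuous_on_subset[OF contF]) (use t in auto)
    then have closed: "closed ?Z" by (rule continuous_closed_preimage_constant) simp
    have "r \<in> ?Z" using t end_point by (simp add: F_def)
    then have ne: "?Z \<noteq> {}" by blast
    have bdd: "bdd_below ?Z" by (rule bdd_belowI[of _ t]) auto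
    have Inf: "Inf ?Z \<in> ?Z" by (rule closed_contains_Inf[OF ne bdd closed])
    define t2 where "t2 = Inf ?Z"
    have t2: "t2 \<in> {t..r}" "F t2 = t2" using Inf by (auto simp: t2_def)
    have "t < t2" using t2 lt by (cases "t = t2") auto
    then have t2pos: "0 < t2" using t by simp
    have before: "F s < s" if "t \<le> s" "s < t2" for s
    proof -
      have "s \<notin> ?Z" using cInf_lower[OF _ bdd, of s] that by (force simp: t2_def)
      then have "F s \<noteq> s" using that t2 by auto
      moreover have "F s \<le> s" using le[of s] that t t2 by auto
      ultimately show ?thesis by simp
    qed
    have "continuous_on {0..t2} F" using contF by (rule continuous_on_subset) (use t2 in auto)
    then have "(F \<longlongrightarrow> F t2) (at_left t2)" using t2pos continuous_on_Icc_at_leftD by blast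
    then have "\<forall>\<^sub>F s in at_left t2. 0 < F s" by (rule order_tendstoD) (use t2 t2pos in simp)
    then obtain b where b: "b < t2" "\<And>s. b < s \<Longrightarrow> s < t2 \<Longrightarrow> 0 < F s"
      unfolding eventually_at_left[OF t2pos] by auto
    define s where "s = max t ((b + t2) / 2)"
    have s: "t \<le> s" "s < t2" "b < s" using b \<open>t < t2\<close> by (auto simp: s_def max_def)
    have "F t2 - t2 \<le> F s - s"
    proof (rule DERIV_nonpos_imp_nonincreasing[of s t2 "\<lambda>s. F s - s"])
      fix u assume u: "s \<le> u" "u \<le> t2"
      have "u \<in> {0..r}" using u s t t2 by auto
      from deriv[OF this] obtain D where D: "(F has_real_derivative D) (at u)" "F u > 0 \<longrightarrow> D \<le> 1" by blast
      have "F u > 0" using b(2)[of u] u s t2 t2pos by (cases "u = t2") auto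
      then show "\<exists>y. ((\<lambda>s. F s - s) has_real_derivative y) (at u) \<and> y \<le> 0"
        using D by (intro exI[of _ "D - 1"] conjI DERIV_diff DERIV_ident) auto
    qed (use s in simp)
    then show False using before[OF s(1,2)] t2(2) by simp
  qed
qed

text \<open>Equality in the Cauchy-Schwarz inequality: velocity and gradient have length at most 1 and inner
  product 1.\<close>

lemma segment_is_integral_curve:
  assumes I: "open I" "{0..r} \<subseteq> I" "smooth_into N I \<gamma>" "\<gamma> 0 \<in> S" "\<gamma> ` {0..r} \<subseteq> U"
    and speed: "\<And>t. t \<in> I \<Longrightarrow> speed N \<gamma> t = 1" and end_point: "\<rho> (\<gamma> r) = r" and t: "t \<in> {0<..r}"
    and c: "c \<in> charts N" "\<gamma> t \<in> cdom c"
  shows "velocity c \<gamma> t = grad c (crd c (\<gamma> t))"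
    and "rmetric N c (crd c (\<gamma> t)) (grad c (crd c (\<gamma> t))) (grad c (crd c (\<gamma> t))) = 1"
proof -
  interpret metric_domain_function "rmetric N c" "img c" "f c" "V c" by (rule chart_domain[OF c(1)])
  let ?x = "crd c (\<gamma> t)" and ?m = "rmetric N c"
  have tI: "t \<in> I" and U: "\<gamma> t \<in> U" using t I by auto
  have cont\<gamma>: "continuous_on I \<gamma>" using I by (simp add: smooth_into_def)
  have xV: "?x \<in> V c" using c U by auto
  note xD = in_D[OF xV]
  have \<rho>t: "\<rho> (\<gamma> t) = t" if "t \<in> {0..r}" for t
    by (rule \<rho>_along_segment[OF I _ end_point that]) (rule speed)
  have xW: "?x \<in> W c" using xV t \<rho>t[of t] c by (simp add: chart_inv_crd)
  let ?v = "velocity c \<gamma> t" and ?X = "grad c ?x"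
  have "sqrt (?m ?x ?v ?v) = 1"
    using speed_eq[OF I(1) tI cont\<gamma> c smooth_into_velocity[OF I(3) tI c]] speed[OF tI] by (simp add: inner_at_def)
  then have v1: "?m ?x ?v ?v = 1" by simp
  have D: "((\<lambda>t. \<rho> (\<gamma> t)) has_real_derivative ?m ?x ?X ?v) (at t)"
    by (rule \<rho>_curve_derivative[OF I(1) tI I(3) c U])
  have Xv: "?m ?x ?X ?v = 1"
  proof -
    have "((\<lambda>s. (\<rho> (\<gamma> s) - \<rho> (\<gamma> t)) / (s - t)) \<longlongrightarrow> ?m ?x ?X ?v) (at_left t)"
      using has_field_derivative_at_within[OF D, of "{..<t}"] by (simp add: has_field_derivative_iff)
    moreover have "\<forall>\<^sub>F s in at_left t. (\<rho> (\<gamma> s) - \<rho> (\<gamma> t)) / (s - t) = 1"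
      unfolding eventually_at_left[of 0 t, OF t[THEN greaterThanAtMost_iff[THEN iffD1], THEN conjunct1]]
      by (rule exI[of _ 0]) (use t \<rho>t in auto)
    ultimately have "((\<lambda>s. 1::real) \<longlongrightarrow> ?m ?x ?X ?v) (at_left t)"
      by (rule Lim_transform_eventually)
    then show ?thesis using tendsto_unique[OF trivial_limit_at_left_real _ tendsto_const] by blast
  qed
  have le1: "?m ?x ?X ?X \<le> 1" by (rule gradient_norm_le_1[OF c(1) xW])
  have "?m ?x (?X - ?v) (?X - ?v) \<le> 0"
    using le1 v1 Xv sym[OF xD, of ?v ?X] by (simp add: m_lsub[OF xD] m_rsub[OF xD])
  then have "?X - ?v = 0" using pos[OF xD, of "?X - ?v"] by fastforce
  then show eq: "?v = ?X" by simp
  show "?m ?x ?X ?X = 1" using v1 unfolding eq .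
qed

lemma unit_gradient:
  assumes c: "c \<in> charts N"
  shows "unit_gradient (rmetric N c) (img c) (f c) (V c) (W c)"
proof -
  interpret metric_domain_function "rmetric N c" "img c" "f c" "V c" by (rule chart_domain[OF c])
  show ?thesis
  proof unfold_locales
    have "W c = V c \<inter> f c -` {0<..}" by auto
    then show "open (W c)" using continuous_open_preimage[OF smooth_on_continuous[OF smooth_f] open_V, of "{0<..}"] by simp
    fix x assume x: "x \<in> W c"
    then obtain p where p: "p \<in> cdom c" "p \<in> U" "x = crd c p" by auto
    have \<rho>p: "0 < \<rho> p" using x p by (simp add: chart_inv_crd[OF c])
    obtain I \<gamma> where g: "open I" "{0..\<rho> p} \<subseteq> I" "smooth_into N I \<gamma>" "\<gamma> 0 \<in> S" "\<gamma> ` {0..\<rho> p} \<subseteq> U" "\<gamma> (\<rho> p) = p"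
        "\<And>t. t \<in> I \<Longrightarrow> speed N \<gamma> t = 1"
      using unit_speed_segment[OF p(2)] \<rho>p by (metis less_imp_le)
    show "rmetric N c x (grad c x) (grad c x) = 1"
      using segment_is_integral_curve(2)[OF g(1-5,7), of "\<rho> p" c] \<rho>p c p g(6) by simp
  qed auto
qed

text \<open>The points of the hypersurface in \<open>U\<close> are limits of points with positive \<open>\<rho>\<close>, because
  \<open>\<rho>\<close> is positive on the side into which the normal points.\<close>

lemma vanishes_on_hypersurface:
  assumes c: "c \<in> charts N" and p: "p \<in> cdom c" "p \<in> U" "p \<in> S"
    and cont: "continuous_on (V c) \<Phi>" and zero: "\<And>x. x \<in> W c \<Longrightarrow> \<Phi> x = (0::real)"
  shows "\<Phi> (crd c p) = 0"
proof -
  interpret metric_domain_function "rmetric N c" "img c" "f c" "V c" by (rule chart_domain[OF c])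
  let ?y = "\<lambda>t. crd c p + t *\<^sub>R \<nu> c p"
  have xV: "crd c p \<in> V c" using p by auto
  have lim: "(?y \<longlongrightarrow> crd c p) (at_right 0)" by (auto intro!: tendsto_eq_intros)
  have "\<forall>\<^sub>F t in at_right 0. \<rho> (chart_inv c (crd c p + t *\<^sub>R \<nu> c p)) > 0 \<and> \<rho> (chart_inv c (crd c p - t *\<^sub>R \<nu> c p)) < 0"
    using signed_distance c p unfolding signed_distance_on_def by blast
  moreover have "\<forall>\<^sub>F t in at_right 0. ?y t \<in> V c"
    by (rule topological_tendstoD[OF lim open_V xV])
  ultimately have "\<forall>\<^sub>F t in at_right 0. \<Phi> (?y t) = 0"
    by eventually_elim (intro zero, simp)
  moreover have "((\<lambda>t. \<Phi> (?y t)) \<longlongrightarrow> \<Phi> (crd c p)) (at_right 0)"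
    using cont xV lim open_V by (intro isCont_tendsto_compose[of _ \<Phi>]) (auto simp: continuous_on_eq_continuous_at)
  ultimately have "((\<lambda>t. 0) \<longlongrightarrow> \<Phi> (crd c p)) (at_right (0::real))"
    by (rule Lim_transform_eventually[rotated])
  then show ?thesis using tendsto_unique[OF trivial_limit_at_right_real _ tendsto_const] by blast
qed

lemma gradient_norm_on_hypersurface:
  assumes c: "c \<in> charts N" and p: "p \<in> cdom c" "p \<in> U" "p \<in> S"
  shows "rmetric N c (crd c p) (grad c (crd c p)) (grad c (crd c p)) = 1"
proof -
  interpret unit_gradient "rmetric N c" "img c" "f c" "V c" "W c" by (rule unit_gradient[OF c])
  have "continuous_on (V c) (\<lambda>x. rmetric N c x (grad c x) (grad c x) - 1)"
    by (intro continuous_intros continuous_on_metric X_continuous) (use V_D in auto)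
  from vanishes_on_hypersurface[OF c p this] show ?thesis using unit by simp
qed

lemma hess_gradient_on_hypersurface:
  assumes c: "c \<in> charts N" and p: "p \<in> cdom c" "p \<in> U" "p \<in> S"
  shows "coord_hessian (rmetric N c) (f c) (crd c p) u (grad c (crd c p)) = 0"
proof -
  interpret unit_gradient "rmetric N c" "img c" "f c" "V c" "W c" by (rule unit_gradient[OF c])
  have "continuous_on (V c) (\<lambda>x. rmetric N c x (A x u) (grad c x))"
    by (intro continuous_on_metric X_continuous A_continuous continuous_on_id) (use V_D in auto)
  then have "continuous_on (V c) (\<lambda>x. hess x u (grad c x))" by (simp add: hess_def)
  from vanishes_on_hypersurface[OF c p this] show ?thesis using hess_gradient_zero by simp
qed

section \<open>The initial condition\<close>

text \<open>In a slice chart the hypersurface is a piece of the hyperplane orthogonal to \<open>b\<close>. The differential of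
  \<open>\<rho>\<close> vanishes on this hyperplane without being zero, so its kernel is the hyperplane, and a
  straight line in the slice realizes every vector of the kernel as a velocity.\<close>

lemma tangent_to_level_set:
  assumes c: "c \<in> charts N" and p: "p \<in> cdom c" "p \<in> U" "p \<in> S"
    and v: "rmetric N c (crd c p) (grad c (crd c p)) v = 0"
  shows "v \<in> tangent_to N S c p"
proof -
  obtain d b where d: "d \<in> charts N" "b \<noteq> 0" "p \<in> cdom d" and slice: "S \<inter> cdom d = {q \<in> cdom d. crd d q \<bullet> b = 0}"
    using hypersurface p(3) unfolding embedded_hypersurface_def by blast
  interpret coordinate_change "rmetric N c" "img c" "f c" "V c" "rmetric N d" "img d" "f d" "V d"
    "crd d \<circ> chart_inv c" "crd c ` (cdom c \<inter> (cdom d \<inter> U))"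
    by (rule coordinate_change[OF c d(1) open_U smooth_\<rho>])
  define y where "y = crd d p"
  have Q: "crd c p \<in> crd c ` (cdom c \<inter> (cdom d \<inter> U))" using p d by auto
  have \<phi>p: "(crd d \<circ> chart_inv c) (crd c p) = y" by (simp add: y_def chart_inv_crd[OF c p(1)])
  have yV: "y \<in> V d" using p d by (simp add: y_def)
  note yD = two.in_D[OF yV]
  define w where "w = change_chart c d p v"
  have w0: "rmetric N d y (grad d y) w = 0"
    using gradient_eq[OF Q] m_eq[OF Q, of "grad c (crd c p)" v] v unfolding \<phi>p by (simp add: w_def change_chart_def)
  have yb: "y \<bullet> b = 0" using slice p d by (auto simp: y_def)
  have small: "\<exists>e>0. \<forall>t\<in>{-e<..<e}. y + t *\<^sub>R u \<in> V d" for u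
  proof -
    obtain e where e: "e > 0" "ball y e \<subseteq> V d" using two.open_V yV open_contains_ball by meson
    have "y + t *\<^sub>R u \<in> V d" if "t \<in> {- (e / (norm u + 1))<..<e / (norm u + 1)}" for t
    proof -
      have "\<bar>t\<bar> < e / (norm u + 1)" using that by auto
      then have "\<bar>t\<bar> * (norm u + 1) < e" by (simp add: pos_less_divide_eq add_nonneg_pos)
      moreover have "\<bar>t\<bar> * norm u \<le> \<bar>t\<bar> * (norm u + 1)" by (intro mult_left_mono) auto
      ultimately have "dist y (y + t *\<^sub>R u) < e" by (simp add: dist_norm)
      then show ?thesis using e(2) by auto
    qed
    moreover have "e / (norm u + 1) > 0" using e(1) by (simp add: add_nonneg_pos)
    ultimately show ?thesis by blast
  qed
  have in_S: "chart_inv d (y + t *\<^sub>R u) \<in> S" if "u \<bullet> b = 0" "y + t *\<^sub>R u \<in> V d" for u t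
  proof -
    have "y + t *\<^sub>R u \<in> img d" using that by auto
    then have "chart_inv d (y + t *\<^sub>R u) \<in> cdom d" "crd d (chart_inv d (y + t *\<^sub>R u)) \<bullet> b = 0"
      using that yb chart_inv_in[OF d(1)] crd_chart_inv[OF d(1)] by (auto simp: inner_add_left)
    then show ?thesis using slice by blast
  qed
  \<comment> \<open>\<open>\<rho>\<close> vanishes on the slice, so its differential vanishes on the tangent space of the slice.\<close>
  have slice_kernel: "rmetric N d y (grad d y) u = 0" if u: "u \<bullet> b = 0" for u
  proof -
    obtain e where e: "e > 0" "\<And>t. t \<in> {-e<..<e} \<Longrightarrow> y + t *\<^sub>R u \<in> V d" using small by blast
    have "((\<lambda>t. f d (y + t *\<^sub>R u)) has_real_derivative 0) (at 0)"
    proof (rule has_field_derivative_transform_within_open[OF DERIV_const[of 0], of "{-e<..<e}"])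
      fix t assume t: "t \<in> {-e<..<e}"
      have "chart_inv d (y + t *\<^sub>R u) \<in> U" using e(2)[OF t] by (simp add: mem_image_Int[OF d(1)])
      then show "0 = f d (y + t *\<^sub>R u)" using in_S[OF u e(2)[OF t]] \<rho>_zero by simp
    qed (use e in auto)
    from DERIV_unique[OF two.f_along_line[OF yV] this] show ?thesis .
  qed
  have wb: "w \<bullet> b = 0"
  proof (rule ccontr)
    assume wb: "w \<bullet> b \<noteq> 0"
    let ?X = "grad d y"
    define \<beta> where "\<beta> = (?X \<bullet> b) / (w \<bullet> b)"
    have "(?X - \<beta> *\<^sub>R w) \<bullet> b = 0" using wb by (simp add: \<beta>_def inner_diff_left)
    from slice_kernel[OF this] have "rmetric N d y ?X ?X = 0"
      using w0 by (simp add: two.m_rsub[OF yD] two.m_rmul[OF yD])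
    then show False using gradient_norm_on_hypersurface[OF d(1,3) p(2,3)] by (simp add: y_def)
  qed
  obtain e where e: "e > 0" "\<And>t. t \<in> {-e<..<e} \<Longrightarrow> y + t *\<^sub>R w \<in> V d" using small by blast
  define \<gamma> where "\<gamma> t = chart_inv d (y + t *\<^sub>R w)" for t
  let ?T = "{-e<..<e}"
  have in_img: "y + t *\<^sub>R w \<in> img d" if "t \<in> ?T" for t using e(2)[OF that] by auto
  have cont: "continuous_on ?T \<gamma>"
    unfolding \<gamma>_def
    by (rule continuous_on_compose2[OF continuous_chart_inv[OF d(1)]]) (use in_img in \<open>auto intro!: continuous_intros\<close>)
  have "smooth_into N ?T \<gamma>"
    unfolding smooth_into_def
  proof (intro conjI cont ballI)
    fix c' assume c': "c' \<in> charts N"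
    have "smooth_on (?T \<inter> \<gamma> -` cdom c') (\<lambda>t. (crd c' \<circ> chart_inv d) (y + t *\<^sub>R w))"
    proof (rule smooth_on_compose_affine[OF transition_smooth[OF d(1) c'] bounded_linear_scaleR_left])
      show "open (?T \<inter> \<gamma> -` cdom c')" by (rule open_preimage_cdom[OF _ cont c']) simp
      show "y + t *\<^sub>R w \<in> crd d ` (cdom d \<inter> cdom c')" if "t \<in> ?T \<inter> \<gamma> -` cdom c'" for t
        using that in_img[of t] by (simp add: mem_image_Int[OF d(1)] \<gamma>_def)
    qed
    then show "smooth_on (?T \<inter> \<gamma> -` cdom c') (crd c' \<circ> \<gamma>)" by (simp add: \<gamma>_def o_def)
  qed
  moreover have "\<gamma> ` ?T \<subseteq> S" using in_S[OF wb] e(2) by (auto simp: \<gamma>_def)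
  moreover have \<gamma>0: "\<gamma> 0 = p" by (simp add: \<gamma>_def y_def chart_inv_crd[OF d(1,3)])
  moreover have "velocity c \<gamma> 0 = v"
  proof -
    have "((\<lambda>t. y + t *\<^sub>R w) has_vector_derivative w) (at 0)" by (auto intro!: derivative_eq_intros)
    then have "((crd d \<circ> \<gamma>) has_vector_derivative w) (at 0)"
      by (rule has_vector_derivative_transform_within_open[of _ _ _ ?T])
         (use e(1) in_img crd_chart_inv[OF d(1)] in \<open>auto simp: \<gamma>_def\<close>)
    from velocity_change_chart[OF _ _ cont d(1) _ c _ this]
    have "((crd c \<circ> \<gamma>) has_vector_derivative change_chart d c p w) (at 0)"
      using e(1) p d by (simp add: \<gamma>0)
    then show ?thesis
      unfolding velocity_def using vector_derivative_at change_chart_inverse[OF c d(1) p(1) d(3)] by (simp add: w_def)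
  qed
  ultimately show ?thesis unfolding tangent_to_def using e(1) by blast
qed

abbreviation "form c \<equiv> metric_domain_function.excess (rmetric N c) (f c)"

text \<open>The component of \<open>u\<close> along the gradient contributes nothing to the form, and the remaining component is
  tangent to the hypersurface.\<close>

lemma form_on_hypersurface:
  assumes c: "c \<in> charts N" and p: "p \<in> cdom c" "p \<in> U" "p \<in> S"
    and init: "\<And>v. v \<in> tangent_to N S c p \<Longrightarrow>
        \<sigma> * (coord_hessian (rmetric N c) (f c) (crd c p) v v - \<omega> * rmetric N c (crd c p) v v) \<le> 0"
  shows "\<sigma> * form c \<omega> (crd c p) u u \<le> 0"
proof -
  interpret metric_domain_function "rmetric N c" "img c" "f c" "V c" by (rule chart_domain[OF c])
  let ?x = "crd c p" and ?m = "rmetric N c"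
  have xV: "?x \<in> V c" using p by auto
  note xD = in_D[OF xV]
  define \<alpha> where "\<alpha> = ?m ?x (grad c ?x) u"
  define n where "n = u - \<alpha> *\<^sub>R grad c ?x"
  note X1 = gradient_norm_on_hypersurface[OF c p] and HX = hess_gradient_on_hypersurface[OF c p]
  have HX': "hess ?x (grad c ?x) w = 0" for w using HX[of w] hess_sym[OF xV, of w "grad c ?x"] by simp
  have Xn: "?m ?x (grad c ?x) n = 0" using X1 by (simp add: n_def m_rsub[OF xD] m_rmul[OF xD] \<alpha>_def)
  have "hess ?x u u = hess ?x n n"
    using HX HX' by (simp add: n_def bilinear_lsub[OF hess_bilinear[OF xV]] bilinear_rsub[OF hess_bilinear[OF xV]]
        bilinear_lmul[OF hess_bilinear[OF xV]] bilinear_rmul[OF hess_bilinear[OF xV]])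
  moreover have "?m ?x u u - ?m ?x (grad c ?x) u * ?m ?x (grad c ?x) u = ?m ?x n n"
    using X1 sym[OF xD, of u "grad c ?x"]
    by (simp add: n_def m_lsub[OF xD] m_rsub[OF xD] m_lmul[OF xD] m_rmul[OF xD] \<alpha>_def)
  ultimately show ?thesis using init[OF tangent_to_level_set[OF c p Xn]] by (simp add: excess_def)
qed

section \<open>Comparison along a normal segment\<close>

lemma form_change_chart:
  assumes c: "c \<in> charts N" and d: "d \<in> charts N" and p: "p \<in> cdom c" "p \<in> cdom d" "p \<in> U"
  shows "form c \<omega> (crd c p) u u = form d \<omega> (crd d p) (change_chart c d p u) (change_chart c d p u)"
proof -
  interpret coordinate_change "rmetric N c" "img c" "f c" "V c" "rmetric N d" "img d" "f d" "V d"
    "crd d \<circ> chart_inv c" "crd c ` (cdom c \<inter> (cdom d \<inter> U))"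
    by (rule coordinate_change[OF c d open_U smooth_\<rho>])
  have "crd c p \<in> crd c ` (cdom c \<inter> (cdom d \<inter> U))" using p by auto
  from excess_eq[OF this, of \<omega> u] show ?thesis by (simp add: change_chart_def chart_inv_crd[OF c p(1)])
qed

text \<open>The statement for all charts at once is what can be continued: around each time the comparison takes
  place in a single chart, and the result is carried over to the other charts at the end.\<close>

lemma form_sign_along_segment:
  assumes I: "open I" "{0..r} \<subseteq> I" "smooth_into N I \<gamma>" "\<gamma> 0 \<in> S" "\<gamma> ` {0..r} \<subseteq> U"
    and speed: "\<And>t. t \<in> I \<Longrightarrow> speed N \<gamma> t = 1" and end_point: "\<rho> (\<gamma> r) = r" and r: "0 \<le> r"
    and \<omega>: "\<And>t. t \<in> {0..r} \<Longrightarrow> (\<omega> has_real_derivative G t - (\<omega> t)\<^sup>2) (at t)"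
    and K: "\<And>p c v. p \<in> U \<Longrightarrow> c \<in> charts N \<Longrightarrow> p \<in> cdom c \<Longrightarrow> rmetric N c (crd c p) v v = 1 \<Longrightarrow>
        rmetric N c (crd c p) v (grad c (crd c p)) = 0 \<Longrightarrow>
        0 \<le> \<sigma> * (coord_sectional (rmetric N c) (crd c p) v (grad c (crd c p)) + G (\<rho> p))"
    and init: "\<And>c u. c \<in> charts N \<Longrightarrow> \<gamma> 0 \<in> cdom c \<Longrightarrow> \<sigma> * form c (\<omega> 0) (crd c (\<gamma> 0)) u u \<le> 0"
    and c: "c \<in> charts N" "\<gamma> r \<in> cdom c"
  shows "\<sigma> * form c (\<omega> r) (crd c (\<gamma> r)) u u \<le> 0"
proof -
  define P where "P t \<longleftrightarrow> (\<forall>c\<in>charts N. \<gamma> t \<in> cdom c \<longrightarrow> (\<forall>u. \<sigma> * form c (\<omega> t) (crd c (\<gamma> t)) u u \<le> 0))" for t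
  have cont\<gamma>: "continuous_on I \<gamma>" using I by (simp add: smooth_into_def)
  have \<rho>t: "\<rho> (\<gamma> t) = t" if "t \<in> {0..r}" for t
    by (rule \<rho>_along_segment[OF I _ end_point that]) (rule speed)
  have "P r"
  proof (rule real_nearby_propagation[OF r])
    show "P 0" using init by (simp add: P_def)
    fix t0 assume t0: "t0 \<in> {0..r}"
    obtain c where c: "c \<in> charts N" "\<gamma> t0 \<in> cdom c" by (rule chart_around)
    have "open (I \<inter> \<gamma> -` cdom c)" by (rule open_preimage_cdom[OF I(1) cont\<gamma> c(1)])
    moreover have "t0 \<in> I \<inter> \<gamma> -` cdom c" using t0 I c by auto
    ultimately obtain \<delta> where \<delta>: "\<delta> > 0" "ball t0 \<delta> \<subseteq> I \<inter> \<gamma> -` cdom c" by (meson open_contains_ball)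
    interpret unit_gradient "rmetric N c" "img c" "f c" "V c" "W c" by (rule unit_gradient[OF c(1)])
    have "P b" if ab: "0 \<le> a" "b \<le> r" "a \<le> t0" "t0 \<le> b" "b - a < \<delta>" and Pa: "P a" for a b
      unfolding P_def
    proof (intro ballI impI allI)
      fix d u assume d: "d \<in> charts N" "\<gamma> b \<in> cdom d"
      have in_c: "\<gamma> t \<in> cdom c" "t \<in> I" "\<gamma> t \<in> U" "t \<in> {0..r}" if "t \<in> {a..b}" for t
      proof -
        have "t \<in> ball t0 \<delta>" using that ab by (auto simp: dist_real_def)
        then show "\<gamma> t \<in> cdom c" "t \<in> I" using \<delta>(2) by auto
        show "t \<in> {0..r}" using that ab by auto
        then show "\<gamma> t \<in> U" using I(5) by auto
      qed
      have cont: "continuous_on {a..b} (\<lambda>t. crd c (\<gamma> t))"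
        by (rule continuous_on_compose2[OF continuous_crd[OF c(1)] continuous_on_subset[OF cont\<gamma>]])
           (use in_c in auto)
      have cont\<omega>: "continuous_on {a..b} \<omega>"
        by (rule DERIV_continuous_on[OF has_field_derivative_at_within[OF \<omega>]]) (use in_c in auto)
      have Wc: "crd c (\<gamma> t) \<in> W c" if "t \<in> {a<..b}" for t
        using in_c[of t] \<rho>t[of t] that ab chart_inv_crd[OF c(1)] by auto
      have "\<sigma> * form c (\<omega> b) (crd c (\<gamma> b)) (change_chart d c (\<gamma> b) u) (change_chart d c (\<gamma> b) u) \<le> 0"
      proof (rule comparison_along_integral_curve[where c="\<lambda>t. crd c (\<gamma> t)" and s=a and g=G])
        fix t assume t: "t \<in> {a<..b}"
        then have t': "t \<in> {a..b}" by simp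
        show "crd c (\<gamma> t) \<in> W c" by (rule Wc[OF t])
        have "velocity c \<gamma> t = grad c (crd c (\<gamma> t))"
          by (rule segment_is_integral_curve(1)[OF I speed end_point _ c(1) in_c(1)[OF t']]) (use t in_c[OF t'] ab in auto)
        then show "((\<lambda>t. crd c (\<gamma> t)) has_vector_derivative grad c (crd c (\<gamma> t))) (at t)"
          using smooth_into_velocity[OF I(3) in_c(2)[OF t'] c(1) in_c(1)[OF t']] by (simp add: o_def)
        show "(\<omega> has_real_derivative G t - (\<omega> t)\<^sup>2) (at t)" by (rule \<omega>[OF in_c(4)[OF t']])
        show "0 \<le> \<sigma> * (coord_sectional (rmetric N c) (crd c (\<gamma> t)) v (grad c (crd c (\<gamma> t))) + G t)"
          if "rmetric N c (crd c (\<gamma> t)) v v = 1" "rmetric N c (crd c (\<gamma> t)) v (grad c (crd c (\<gamma> t))) = 0" for v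
          using K[OF in_c(3)[OF t'] c(1) in_c(1)[OF t'] that] \<rho>t[OF in_c(4)[OF t']] by simp
      next
        show "a \<le> b" using ab by simp
        show "(\<lambda>t. crd c (\<gamma> t)) ` {a..b} \<subseteq> V c" using in_c by auto
        show "\<sigma> * form c (\<omega> a) (crd c (\<gamma> a)) u u \<le> 0" for u
          using Pa in_c[of a] c(1) ab unfolding P_def by auto
      qed (rule cont cont\<omega>)+
      then show "\<sigma> * form d (\<omega> b) (crd d (\<gamma> b)) u u \<le> 0"
        using form_change_chart[OF d(1) c(1) d(2)] in_c[of b] ab by simp
    qed
    then show "\<exists>\<delta>>0. \<forall>a b. 0 \<le> a \<longrightarrow> b \<le> r \<longrightarrow> a \<le> t0 \<longrightarrow> t0 \<le> b \<longrightarrow> b - a < \<delta> \<longrightarrow> P a \<longrightarrow> P b"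
      using \<delta>(1) by blast
  qed
  with c show ?thesis by (simp add: P_def)
qed

text \<open>Both halves of the theorem, for \<open>\<sigma> = 1\<close> and \<open>\<sigma> = -1\<close>. On vectors orthogonal to the gradient the
  form \<open>excess\<close> is the difference of the two sides of the assertion.\<close>

lemma hessian_comparison:
  assumes h: "ode_solution G h" and h_pos: "\<And>t. 0 \<le> t \<Longrightarrow> ereal t < d_hi \<Longrightarrow> 0 < h t"
    and K: "\<And>p c v. p \<in> U \<Longrightarrow> c \<in> charts N \<Longrightarrow> p \<in> cdom c \<Longrightarrow> inner_at N c p v v = 1 \<Longrightarrow>
        inner_at N c p v (gradient N c \<rho> p) = 0 \<Longrightarrow>
        0 \<le> \<sigma> * (sectional_curvature N c p v (gradient N c \<rho> p) + G (\<rho> p))"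
    and init: "\<And>p c v. p \<in> S \<Longrightarrow> p \<in> U \<Longrightarrow> c \<in> charts N \<Longrightarrow> p \<in> cdom c \<Longrightarrow> v \<in> tangent_to N S c p \<Longrightarrow>
        \<sigma> * (hessian N c \<rho> p v v - deriv h 0 / h 0 * inner_at N c p v v) \<le> 0"
    and p: "p \<in> U" "0 \<le> \<rho> p" "ereal (\<rho> p) < d_hi" and c: "c \<in> charts N" "p \<in> cdom c"
    and v: "inner_at N c p v (gradient N c \<rho> p) = 0"
  shows "\<sigma> * (hessian N c \<rho> p v v - deriv h (\<rho> p) / h (\<rho> p) * inner_at N c p v v) \<le> 0"
proof -
  define \<omega> where "\<omega> t = deriv h t / h t" for t
  interpret metric_domain_function "rmetric N c" "img c" "f c" "V c" by (rule chart_domain[OF c(1)])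
  have xD: "crd c p \<in> img c" using c by auto
  have init': "\<sigma> * form d (\<omega> 0) (crd d q) u u \<le> 0" if "q \<in> S" "q \<in> U" "d \<in> charts N" "q \<in> cdom d" for q d u
    by (rule form_on_hypersurface[OF that(3,4,2,1)])
       (use init[OF that] in \<open>simp add: \<omega>_def hessian_def inner_at_def\<close>)
  obtain I \<gamma> where g: "open I" "{0..\<rho> p} \<subseteq> I" "smooth_into N I \<gamma>" "\<gamma> 0 \<in> S" "\<gamma> ` {0..\<rho> p} \<subseteq> U" "\<gamma> (\<rho> p) = p"
    "\<And>t. t \<in> I \<Longrightarrow> speed N \<gamma> t = 1"
    using unit_speed_segment[OF p(1,2)] by blast
  have "\<sigma> * form c (\<omega> (\<rho> p)) (crd c (\<gamma> (\<rho> p))) v v \<le> 0"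
  proof (rule form_sign_along_segment[OF g(1-5,7) _ p(2), where G=G])
    show "\<rho> (\<gamma> (\<rho> p)) = \<rho> p" by (simp add: g(6))
  next
    fix t assume t: "t \<in> {0..\<rho> p}"
    have "ereal t \<le> ereal (\<rho> p)" using t by simp
    then have ht: "0 < h t" using h_pos t p(3) by (meson atLeastAtMost_iff le_less_trans)
    have "(h has_real_derivative deriv h t) (at t)"
      using h unfolding ode_solution_def by (metis DERIV_deriv_iff_real_differentiable)
    moreover have "(deriv h has_real_derivative G t * h t) (at t)" using h unfolding ode_solution_def by blast
    ultimately have "((\<lambda>t. deriv h t / h t) has_real_derivative (G t * h t * h t - deriv h t * deriv h t) / (h t * h t)) (at t)"
      using ht by (intro DERIV_divide) auto
    moreover have "(G t * h t * h t - deriv h t * deriv h t) / (h t * h t) = G t - (\<omega> t)\<^sup>2"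
      using ht by (simp add: \<omega>_def power2_eq_square field_simps)
    ultimately show "(\<omega> has_real_derivative G t - (\<omega> t)\<^sup>2) (at t)" by (simp add: \<omega>_def[abs_def])
  next
    fix q d u assume "q \<in> U" "d \<in> charts N" "q \<in> cdom d" "rmetric N d (crd d q) u u = 1"
      "rmetric N d (crd d q) u (grad d (crd d q)) = 0"
    then show "0 \<le> \<sigma> * (coord_sectional (rmetric N d) (crd d q) u (grad d (crd d q)) + G (\<rho> q))"
      using K[of q d u] by (simp add: inner_at_def gradient_def sectional_curvature_def)
  next
    fix d u assume "d \<in> charts N" "\<gamma> 0 \<in> cdom d"
    moreover have "\<gamma> 0 \<in> U" using g(5) p(2) by auto
    ultimately show "\<sigma> * form d (\<omega> 0) (crd d (\<gamma> 0)) u u \<le> 0"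
      by (intro init' g(4))
  qed (use c g in auto)
  moreover have "rmetric N c (crd c p) (grad c (crd c p)) v = 0"
    using v sym[OF xD, of v] by (simp add: inner_at_def gradient_def)
  ultimately show ?thesis by (simp add: g(6) excess_def \<omega>_def hessian_def inner_at_def)
qed

end

theorem theorem2:
  fixes N :: "('a::{t2_space,second_countable_topology}, 'e::euclidean_space) riem"
    and \<Sigma>\<^sub>0 U :: "'a set"
    and \<nu> :: "('a, 'e) chart \<Rightarrow> 'a \<Rightarrow> 'e"
    and \<rho> :: "'a \<Rightarrow> real"
    and G h :: "real \<Rightarrow> real"
    and d_lo d_hi :: ereal
  assumes "riemannian_manifold N"
    and "embedded_hypersurface N \<Sigma>\<^sub>0"
    and "complete_hypersurface N \<Sigma>\<^sub>0"
    and "unit_normal_field N \<Sigma>\<^sub>0 \<nu>"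
    and "open U" and "connected U"
    and "signed_distance_on N \<Sigma>\<^sub>0 \<nu> U \<rho>"
    and "smooth_fun_on N U \<rho>"
    and "\<And>p. p \<in> U \<Longrightarrow> \<not> focal_point N \<Sigma>\<^sub>0 p"
    and "\<And>p. p \<in> U \<Longrightarrow> 0 \<le> \<rho> p \<Longrightarrow> normal_segment_in N \<Sigma>\<^sub>0 U p (\<rho> p)"
    and "smooth_on UNIV G" and "\<And>t. G (- t) = G t"
    and "ode_solution G h"
    and "maximal_positive_interval h d_lo d_hi" and "d_lo < 0" and "0 < d_hi"
  shows
    "((\<forall>p\<in>U. \<forall>c\<in>charts N. \<forall>v. p \<in> cdom c \<longrightarrow> inner_at N c p v v = 1 \<longrightarrow>
          inner_at N c p v (gradient N c \<rho> p) = 0 \<longrightarrow>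
          sectional_curvature N c p v (gradient N c \<rho> p) \<ge> - G (\<rho> p)) \<longrightarrow>
      (\<forall>p\<in>\<Sigma>\<^sub>0 \<inter> U. \<forall>c\<in>charts N. \<forall>v\<in>tangent_to N \<Sigma>\<^sub>0 c p. p \<in> cdom c \<longrightarrow>
          hessian N c \<rho> p v v \<le> deriv h 0 / h 0 * inner_at N c p v v) \<longrightarrow>
      (\<forall>p\<in>U. \<forall>c\<in>charts N. \<forall>v. p \<in> cdom c \<longrightarrow>
          inner_at N c p v (gradient N c \<rho> p) = 0 \<longrightarrow> 0 \<le> \<rho> p \<longrightarrow> ereal (\<rho> p) < d_hi \<longrightarrow>
          hessian N c \<rho> p v v \<le> deriv h (\<rho> p) / h (\<rho> p) * inner_at N c p v v)) \<and>
     ((\<forall>p\<in>U. \<forall>c\<in>charts N. \<forall>v. p \<in> cdom c \<longrightarrow> inner_at N c p v v = 1 \<longrightarrow>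
          inner_at N c p v (gradient N c \<rho> p) = 0 \<longrightarrow>
          sectional_curvature N c p v (gradient N c \<rho> p) \<le> - G (\<rho> p)) \<longrightarrow>
      (\<forall>p\<in>\<Sigma>\<^sub>0 \<inter> U. \<forall>c\<in>charts N. \<forall>v\<in>tangent_to N \<Sigma>\<^sub>0 c p. p \<in> cdom c \<longrightarrow>
          hessian N c \<rho> p v v \<ge> deriv h 0 / h 0 * inner_at N c p v v) \<longrightarrow>
      (\<forall>p\<in>U. \<forall>c\<in>charts N. \<forall>v. p \<in> cdom c \<longrightarrow>
          inner_at N c p v (gradient N c \<rho> p) = 0 \<longrightarrow> 0 \<le> \<rho> p \<longrightarrow> ereal (\<rho> p) < d_hi \<longrightarrow>
          hessian N c \<rho> p v v \<ge> deriv h (\<rho> p) / h (\<rho> p) * inner_at N c p v v))"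
proof -
  interpret signed_distance_setting N \<Sigma>\<^sub>0 \<nu> U \<rho>
    by unfold_locales (fact assms)+
  have h_pos: "0 < h t" if "0 \<le> t" "ereal t < d_hi" for t
  proof -
    have "d_lo < ereal t" using \<open>d_lo < 0\<close> that(1) by (metis ereal_less_eq(5) less_le_trans)
    then show ?thesis using assms(14) that(2) unfolding maximal_positive_interval_def by blast
  qed
  note comparison = hessian_comparison[OF \<open>ode_solution G h\<close> h_pos]
  show ?thesis
  proof (intro conjI impI ballI allI)
    fix p c v
    assume K: "\<forall>p\<in>U. \<forall>c\<in>charts N. \<forall>v. p \<in> cdom c \<longrightarrow> inner_at N c p v v = 1 \<longrightarrow>
          inner_at N c p v (gradient N c \<rho> p) = 0 \<longrightarrow>
          sectional_curvature N c p v (gradient N c \<rho> p) \<ge> - G (\<rho> p)"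
      and init: "\<forall>p\<in>\<Sigma>\<^sub>0 \<inter> U. \<forall>c\<in>charts N. \<forall>v\<in>tangent_to N \<Sigma>\<^sub>0 c p. p \<in> cdom c \<longrightarrow>
          hessian N c \<rho> p v v \<le> deriv h 0 / h 0 * inner_at N c p v v"
      and p: "p \<in> U" "c \<in> charts N" "p \<in> cdom c" "inner_at N c p v (gradient N c \<rho> p) = 0"
        "0 \<le> \<rho> p" "ereal (\<rho> p) < d_hi"
    have "1 * (hessian N c \<rho> p v v - deriv h (\<rho> p) / h (\<rho> p) * inner_at N c p v v) \<le> 0"
    proof (rule comparison[OF _ _ _ _ p(1,5,6,2,3,4)])
      fix q d u assume "q \<in> U" "d \<in> charts N" "q \<in> cdom d" "inner_at N d q u u = 1"
        "inner_at N d q u (gradient N d \<rho> q) = 0"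
      with K have "sectional_curvature N d q u (gradient N d \<rho> q) \<ge> - G (\<rho> q)" by blast
      then show "0 \<le> 1 * (sectional_curvature N d q u (gradient N d \<rho> q) + G (\<rho> q))" by simp
    next
      fix q d u assume "q \<in> \<Sigma>\<^sub>0" "q \<in> U" "d \<in> charts N" "q \<in> cdom d" "u \<in> tangent_to N \<Sigma>\<^sub>0 d q"
      with init have "hessian N d \<rho> q u u \<le> deriv h 0 / h 0 * inner_at N d q u u" by blast
      then show "1 * (hessian N d \<rho> q u u - deriv h 0 / h 0 * inner_at N d q u u) \<le> 0" by simp
    qed
    then show "hessian N c \<rho> p v v \<le> deriv h (\<rho> p) / h (\<rho> p) * inner_at N c p v v" by simp
  next
    fix p c v
    assume K: "\<forall>p\<in>U. \<forall>c\<in>charts N. \<forall>v. p \<in> cdom c \<longrightarrow> inner_at N c p v v = 1 \<longrightarrow>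
          inner_at N c p v (gradient N c \<rho> p) = 0 \<longrightarrow>
          sectional_curvature N c p v (gradient N c \<rho> p) \<le> - G (\<rho> p)"
      and init: "\<forall>p\<in>\<Sigma>\<^sub>0 \<inter> U. \<forall>c\<in>charts N. \<forall>v\<in>tangent_to N \<Sigma>\<^sub>0 c p. p \<in> cdom c \<longrightarrow>
          hessian N c \<rho> p v v \<ge> deriv h 0 / h 0 * inner_at N c p v v"
      and p: "p \<in> U" "c \<in> charts N" "p \<in> cdom c" "inner_at N c p v (gradient N c \<rho> p) = 0"
        "0 \<le> \<rho> p" "ereal (\<rho> p) < d_hi"
    have "(-1) * (hessian N c \<rho> p v v - deriv h (\<rho> p) / h (\<rho> p) * inner_at N c p v v) \<le> 0"
    proof (rule comparison[OF _ _ _ _ p(1,5,6,2,3,4)])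
      fix q d u assume "q \<in> U" "d \<in> charts N" "q \<in> cdom d" "inner_at N d q u u = 1"
        "inner_at N d q u (gradient N d \<rho> q) = 0"
      with K have "sectional_curvature N d q u (gradient N d \<rho> q) \<le> - G (\<rho> q)" by blast
      then show "0 \<le> (-1) * (sectional_curvature N d q u (gradient N d \<rho> q) + G (\<rho> q))" by simp
    next
      fix q d u assume "q \<in> \<Sigma>\<^sub>0" "q \<in> U" "d \<in> charts N" "q \<in> cdom d" "u \<in> tangent_to N \<Sigma>\<^sub>0 d q"
      with init have "hessian N d \<rho> q u u \<ge> deriv h 0 / h 0 * inner_at N d q u u" by blast
      then show "(-1) * (hessian N d \<rho> q u u - deriv h 0 / h 0 * inner_at N d q u u) \<le> 0" by simp
    qed
    then show "hessian N c \<rho> p v v \<ge> deriv h (\<rho> p) / h (\<rho> p) * inner_at N c p v v" by simp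
  qed
qed

end
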